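(* Let $\mathcal{O}\subset\mathbb{R}^d$ be a bounded domain with smooth boundary, let $n\in\mathbb{N}$ (or, more generally, let $n>\tfrac12$ be a real number), let $\mathcal{H}=L^2(\mathcal{O})$, $\mathcal{V}=H_0^1(\mathcal{O})\cap H^2(\mathcal{O})$ and $\mathcal{M}=\{u\in\mathcal{H}:|u|_{\mathcal{H}}^2=1\}$. Let $u(t)$, $t\in[0,T)$, be a solution of $$\frac{\partial u}{\partial t}=-Au+F(u(t)),\qquad u(0)=u_0\in\mathcal{V},$$ with $A=\Delta^2-2\Delta$ and $F(u)=\|u\|_{H_0^2}^2\,u+2\|u\|_{H_0^1}^2\,u+\|u\|_{L^{2n}}^{2n}\,u-u^{2n-1}$. If $|u_0|_{\mathcal{H}}^2=1$, then $u(t)\in\mathcal{M}$ for all $t\in[0,T)$, i.e. $|u(t)|_{\mathcal{H}}^2=1$ for all $t\in[0,T)$.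
   Context: $|\cdot|_{\mathcal{H}}$ is the $L^2(\mathcal{O})$ norm; $\|u\|_{H_0^1}=\|\nabla u\|_{L^2}$, $\|u\|_{H_0^2}=\|\Delta u\|_{L^2}$; $\|u\|_{\mathcal{V}}^2=\|u\|_{L^2}^2+2\|\nabla u\|_{L^2}^2+\|\Delta u\|_{L^2}^2$; $\mathcal{E}=D(A)=H_0^1(\mathcal{O})\cap H^2(\mathcal{O})\cap H^4(\mathcal{O})$ with $|u|_{\mathcal{E}}=|Au|_{\mathcal{H}}$. For non-integer $n$, $u^{2n-1}$ means $|u|^{2n-2}u$. The equation is the paper's main problem $\partial_tu=\pi_u(-\Delta^2u+2\Delta u-au-u^{2n-1})$ ($a$ a real constant, $\pi_u(h)=h-\langle h,u\rangle u$), whose right-hand side equals $-Au+F(u)$ for $u\in\mathcal{E}\cap\mathcal{M}$. $X_T=L^2(0,T;\mathcal{E})\cap C([0,T];\mathcal{V})$ with $|u|_{X_T}^2=\sup_{p\in[0,T]}\|u(p)\|_{\mathcal{V}}^2+\int_0^T|u(p)|_{\mathcal{E}}^2\,dp$. $\{S(t)\}_{t\ge0}$ is the analytic semigroup on $\mathcal{H}$ generated by $-A$ ($A:\mathcal{E}\to\mathcal{H}$ regarded as self-adjoint), satisfying the standing assumption that there are constants $c_1,c_2$ such that, for each $T>0$, $|S*f|_{X_T}\le c_1|f|_{L^2(0,T;\mathcal{H})}$ for $f\in L^2(0,T;\mathcal{H})$, where $(S*f)(t)=\int_0^tS(t-p)f(p)\,dp$, and $|S(\cdot)u_0|_{X_T}\le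 c_2\|u_0\|_{\mathcal{V}}$ for $u_0\in\mathcal{V}$. A solution on $[0,T)$ is a local mild solution: $u:[0,T)\to\mathcal{V}$ such that for every $t\in[0,T)$, $u|_{[0,t)}\in X_t$ and $u(t)=S(t)u_0+\int_0^tS(t-p)F(u(p))\,dp$.
   Formalization: The domain E of A additionally requires Δu ∈ H_0^1 ∩ H^2 (so Δu = 0 on the boundary), because on all of H_0^1 ∩ H^2 ∩ H^4 the operator A = Δ² − 2Δ is not symmetric and cannot be self-adjoint as assumed. *)

theory Defs
  imports "HOL-Analysis.Analysis"
begin

section \<open>The Hilbert space of square-integrable functions\<close>

text \<open>
  The type \<open>'a l2\<close> is the space of classes (modulo equality a.e.) of real square-integrable functions
  on the whole Euclidean space. It is made a separable Hilbert space, so that Bochner integrals of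
  functions with values in it are available. The space of square-integrable functions on an open
  set \<open>\<Omega>\<close> is identified, via extension by zero, with the closed subspace \<open>L2 \<Omega>\<close> of the classes
  vanishing a.e. outside \<open>\<Omega>\<close>.
\<close>

definition sq_integrable :: "('a::euclidean_space \<Rightarrow> real) \<Rightarrow> bool" where
  "sq_integrable f \<longleftrightarrow> f \<in> borel_measurable lborel \<and> integrable lborel (\<lambda>x. (f x)\<^sup>2)"

lemma sq_integrable_measurable [measurable_dest]:
  "sq_integrable f \<Longrightarrow> f \<in> borel_measurable lborel"
  by (simp add: sq_integrable_def)

lemma sq_integrable_zero [simp]: "sq_integrable (\<lambda>x. 0)"
  by (simp add: sq_integrable_def)

lemma sq_integrable_mult:
  assumes "sq_integrable f" "sq_integrable g"
  shows "integrable lborel (\<lambda>x. f x * g x)"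
proof (rule Bochner_Integration.integrable_bound)
  show "integrable lborel (\<lambda>x. (f x)\<^sup>2 + (g x)\<^sup>2)"
    using assms by (auto simp: sq_integrable_def)
  show "(\<lambda>x. f x * g x) \<in> borel_measurable lborel"
    using assms by (auto simp: sq_integrable_def)
  show "AE x in lborel. norm (f x * g x) \<le> norm ((f x)\<^sup>2 + (g x)\<^sup>2)"
  proof (rule AE_I2)
    fix x
    have "2 * (\<bar>f x\<bar> * \<bar>g x\<bar>) \<le> (f x)\<^sup>2 + (g x)\<^sup>2"
      using sum_squares_bound[of "\<bar>f x\<bar>" "\<bar>g x\<bar>"] by (simp add: mult.assoc)
    moreover have "0 \<le> \<bar>f x\<bar> * \<bar>g x\<bar>" by simp
    ultimately have "\<bar>f x\<bar> * \<bar>g x\<bar> \<le> (f x)\<^sup>2 + (g x)\<^sup>2" by linarith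
    then show "norm (f x * g x) \<le> norm ((f x)\<^sup>2 + (g x)\<^sup>2)"
      by (simp add: abs_mult)
  qed
qed

lemma sq_integrable_add [simp]:
  assumes "sq_integrable f" "sq_integrable g"
  shows "sq_integrable (\<lambda>x. f x + g x)"
  using assms sq_integrable_mult[OF assms]
  by (auto simp: sq_integrable_def power2_sum mult.assoc)

lemma sq_integrable_scale [simp]: "sq_integrable f \<Longrightarrow> sq_integrable (\<lambda>x. c * f x)"
  by (auto simp: sq_integrable_def power_mult_distrib)

lemma sq_integrable_abs [simp]: "sq_integrable f \<Longrightarrow> sq_integrable (\<lambda>x. \<bar>f x\<bar>)"
  by (auto simp: sq_integrable_def)

lemma sq_integrable_uminus [simp]: "sq_integrable f \<Longrightarrow> sq_integrable (\<lambda>x. - f x)"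
  by (auto simp: sq_integrable_def)

lemma sq_integrable_minus [simp]:
  "sq_integrable f \<Longrightarrow> sq_integrable g \<Longrightarrow> sq_integrable (\<lambda>x. f x - g x)"
  using sq_integrable_add[of f "\<lambda>x. (-1) * g x"] sq_integrable_scale[of g "-1"] by simp

definition l2_rel :: "('a::euclidean_space \<Rightarrow> real) \<Rightarrow> ('a \<Rightarrow> real) \<Rightarrow> bool" where
  "l2_rel f g \<longleftrightarrow> sq_integrable f \<and> sq_integrable g \<and> (AE x in lborel. f x = g x)"

lemma part_equivp_l2_rel: "part_equivp l2_rel"
proof (rule part_equivpI)
  show "\<exists>f. l2_rel f f"
    by (auto simp: l2_rel_def intro!: exI[of _ "\<lambda>x. 0"])
  show "symp l2_rel"
    by (auto simp: symp_def l2_rel_def elim: eventually_mono)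
  show "transp l2_rel"
  proof (rule transpI)
    fix f g h
    assume "l2_rel f g" "l2_rel g h"
    moreover from this have "AE x in lborel. f x = g x" "AE x in lborel. g x = h x"
      by (simp_all add: l2_rel_def)
    then have "AE x in lborel. f x = h x" by eventually_elim simp
    ultimately show "l2_rel f h" by (simp add: l2_rel_def)
  qed
qed

quotient_type (overloaded) 'a l2 = "'a::euclidean_space \<Rightarrow> real" / partial: l2_rel
  by (rule part_equivp_l2_rel)

text \<open>A representative, and the class of a function (the zero class if the function is
  not square-integrable).\<close>

definition l2_fun :: "'a::euclidean_space l2 \<Rightarrow> 'a \<Rightarrow> real" where
  "l2_fun = rep_l2"

definition l2_of :: "('a::euclidean_space \<Rightarrow> real) \<Rightarrow> 'a l2" where
  "l2_of f = (if sq_integrable f then abs_l2 f else abs_l2 (\<lambda>x. 0))"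

lemma l2_fun_sq_integrable [simp, measurable_dest]: "sq_integrable (l2_fun u)"
  using Quotient3_rep_reflp[OF Quotient3_l2, of u] by (simp add: l2_fun_def l2_rel_def)

lemma l2_fun_measurable [measurable]: "l2_fun u \<in> borel_measurable lborel"
  using l2_fun_sq_integrable sq_integrable_def by blast

lemma l2_of_fun [simp]: "l2_of (l2_fun u) = u"
  using Quotient3_abs_rep[OF Quotient3_l2, of u]
  by (simp add: l2_of_def l2_fun_sq_integrable) (simp add: l2_fun_def)

lemma l2_fun_of: "sq_integrable f \<Longrightarrow> AE x in lborel. l2_fun (l2_of f) x = f x"
  using rep_abs_rsp_left[OF Quotient3_l2, of f f]
  by (simp add: l2_of_def l2_fun_def l2_rel_def)

lemma l2_of_eq_iff:
  "sq_integrable f \<Longrightarrow> sq_integrable g \<Longrightarrow> l2_of f = l2_of g \<longleftrightarrow> (AE x in lborel. f x = g x)"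
  using Quotient3_rel[OF Quotient3_l2, of f g] by (auto simp: l2_of_def l2_rel_def)

lemma l2_eq_iff: "u = v \<longleftrightarrow> (AE x in lborel. l2_fun u x = l2_fun v x)"
  using l2_of_eq_iff[of "l2_fun u" "l2_fun v"] by simp

instantiation l2 :: (euclidean_space) real_vector
begin

definition zero_l2 :: "'a l2" where "zero_l2 = l2_of (\<lambda>x. 0)"
definition plus_l2 :: "'a l2 \<Rightarrow> 'a l2 \<Rightarrow> 'a l2" where
  "plus_l2 u v = l2_of (\<lambda>x. l2_fun u x + l2_fun v x)"
definition scaleR_l2 :: "real \<Rightarrow> 'a l2 \<Rightarrow> 'a l2" where
  "scaleR_l2 c u = l2_of (\<lambda>x. c * l2_fun u x)"
definition uminus_l2 :: "'a l2 \<Rightarrow> 'a l2" where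
  "uminus_l2 u = l2_of (\<lambda>x. - l2_fun u x)"
definition minus_l2 :: "'a l2 \<Rightarrow> 'a l2 \<Rightarrow> 'a l2" where
  "minus_l2 u v = l2_of (\<lambda>x. l2_fun u x - l2_fun v x)"
lemma l2_fun_zero: "AE x in lborel. l2_fun (0 :: 'a l2) x = 0"
  unfolding zero_l2_def by (rule l2_fun_of) simp

lemma l2_fun_add: "AE x in lborel. l2_fun (u + v :: 'a l2) x = l2_fun u x + l2_fun v x"
  unfolding plus_l2_def by (rule l2_fun_of) simp

lemma l2_fun_scaleR: "AE x in lborel. l2_fun (c *\<^sub>R u :: 'a l2) x = c * l2_fun u x"
  unfolding scaleR_l2_def by (rule l2_fun_of) simp

lemma l2_fun_uminus: "AE x in lborel. l2_fun (- u :: 'a l2) x = - l2_fun u x"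
  unfolding uminus_l2_def by (rule l2_fun_of) simp

lemma l2_fun_diff: "AE x in lborel. l2_fun (u - v :: 'a l2) x = l2_fun u x - l2_fun v x"
  unfolding minus_l2_def by (rule l2_fun_of) simp

instance
proof
  fix u v w :: "'a l2" and a b :: real
  show "u + v + w = u + (v + w)"
    unfolding l2_eq_iff
    using l2_fun_add[of "u + v" w] l2_fun_add[of u v] l2_fun_add[of u "v + w"] l2_fun_add[of v w]
    by eventually_elim simp
  show "u + v = v + u"
    unfolding plus_l2_def by (simp add: add.commute)
  show "0 + u = u"
    unfolding l2_eq_iff using l2_fun_add[of 0 u] l2_fun_zero by eventually_elim simp
  show "- u + u = 0"
    unfolding l2_eq_iff
    using l2_fun_add[of "- u" u] l2_fun_zero l2_fun_uminus[of u]
    by eventually_elim simp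
  show "u - v = u + - v"
    unfolding l2_eq_iff
    using l2_fun_add[of u "- v"] l2_fun_uminus[of v] l2_fun_diff[of u v]
    by eventually_elim simp
  show "a *\<^sub>R (u + v) = a *\<^sub>R u + a *\<^sub>R v"
    unfolding l2_eq_iff
    using l2_fun_scaleR[of a "u + v"] l2_fun_scaleR[of a u] l2_fun_scaleR[of a v]
      l2_fun_add[of u v] l2_fun_add[of "a *\<^sub>R u" "a *\<^sub>R v"]
    by eventually_elim (simp add: algebra_simps)
  show "(a + b) *\<^sub>R u = a *\<^sub>R u + b *\<^sub>R u"
    unfolding l2_eq_iff
    using l2_fun_scaleR[of "a + b" u] l2_fun_scaleR[of a u] l2_fun_scaleR[of b u]
      l2_fun_add[of "a *\<^sub>R u" "b *\<^sub>R u"]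
    by eventually_elim (simp add: algebra_simps)
  show "a *\<^sub>R b *\<^sub>R u = (a * b) *\<^sub>R u"
    unfolding l2_eq_iff
    using l2_fun_scaleR[of a "b *\<^sub>R u"] l2_fun_scaleR[of b u] l2_fun_scaleR[of "a * b" u]
    by eventually_elim simp
  show "1 *\<^sub>R u = u"
    unfolding l2_eq_iff using l2_fun_scaleR[of 1 u] by eventually_elim simp
qed

end

instantiation l2 :: (euclidean_space) real_inner
begin

definition inner_l2 :: "'a l2 \<Rightarrow> 'a l2 \<Rightarrow> real" where
  "inner_l2 u v = (\<integral>x. l2_fun u x * l2_fun v x \<partial>lborel)"
definition norm_l2 :: "'a l2 \<Rightarrow> real" where
  "norm_l2 u = sqrt (inner u u)"
definition dist_l2 :: "'a l2 \<Rightarrow> 'a l2 \<Rightarrow> real" where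
  "dist_l2 u v = norm (u - v)"
definition sgn_l2 :: "'a l2 \<Rightarrow> 'a l2" where
  "sgn_l2 u = u /\<^sub>R norm u"
definition [code del]:
  "(uniformity :: ('a l2 \<times> 'a l2) filter) = (INF e\<in>{0<..}. principal {(x, y). dist x y < e})"
definition [code del]:
  "open (U :: 'a l2 set) \<longleftrightarrow> (\<forall>x\<in>U. \<forall>\<^sub>F (x', y) in uniformity. x' = x \<longrightarrow> y \<in> U)"

instance
proof
  fix u v w :: "'a l2" and a :: real
  show "inner u v = inner v u"
    by (simp add: inner_l2_def mult.commute)
  show "inner (u + v) w = inner u w + inner v w"
  proof -
    have "inner (u + v) w = (\<integral>x. l2_fun u x * l2_fun w x + l2_fun v x * l2_fun w x \<partial>lborel)"
      unfolding inner_l2_def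
    proof (rule integral_cong_AE)
      show "AE x in lborel. l2_fun (u + v) x * l2_fun w x
          = l2_fun u x * l2_fun w x + l2_fun v x * l2_fun w x"
        using l2_fun_add[of u v] by eventually_elim (simp add: algebra_simps)
    qed measurable
    also have "\<dots> = inner u w + inner v w"
      unfolding inner_l2_def by (intro Bochner_Integration.integral_add sq_integrable_mult) simp_all
    finally show ?thesis .
  qed
  show "inner (a *\<^sub>R u) v = a * inner u v"
  proof -
    have "inner (a *\<^sub>R u) v = (\<integral>x. a * (l2_fun u x * l2_fun v x) \<partial>lborel)"
      unfolding inner_l2_def
    proof (rule integral_cong_AE)
      show "AE x in lborel. l2_fun (a *\<^sub>R u) x * l2_fun v x = a * (l2_fun u x * l2_fun v x)"
        using l2_fun_scaleR[of a u] by eventually_elim simp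
    qed measurable
    then show ?thesis by (simp add: inner_l2_def)
  qed
  show "0 \<le> inner u u"
    by (simp add: inner_l2_def)
  show "inner u u = 0 \<longleftrightarrow> u = 0"
  proof -
    have "inner u u = 0 \<longleftrightarrow> (AE x in lborel. l2_fun u x * l2_fun u x = 0)"
      unfolding inner_l2_def
      by (intro integral_nonneg_eq_0_iff_AE sq_integrable_mult) simp_all
    also have "\<dots> \<longleftrightarrow> u = 0"
    proof
      assume "AE x in lborel. l2_fun u x * l2_fun u x = 0"
      then show "u = 0"
        unfolding l2_eq_iff using l2_fun_zero by eventually_elim simp
    next
      assume "u = 0"
      then show "AE x in lborel. l2_fun u x * l2_fun u x = 0"
        using l2_fun_zero by simp
    qed
    finally show ?thesis .
  qed
qed (simp_all add: norm_l2_def dist_l2_def sgn_l2_def uniformity_l2_def open_l2_def)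

end

lemma norm_l2_of:
  assumes "sq_integrable f"
  shows "(norm (l2_of f))\<^sup>2 = (\<integral>x. (f x)\<^sup>2 \<partial>lborel)"
proof -
  have "(norm (l2_of f))\<^sup>2 = (\<integral>x. l2_fun (l2_of f) x * l2_fun (l2_of f) x \<partial>lborel)"
    by (simp add: power2_norm_eq_inner inner_l2_def)
  also have "\<dots> = (\<integral>x. (f x)\<^sup>2 \<partial>lborel)"
  proof (rule integral_cong_AE)
    show "AE x in lborel. l2_fun (l2_of f) x * l2_fun (l2_of f) x = (f x)\<^sup>2"
      using l2_fun_of[OF assms] by eventually_elim (simp add: power2_eq_square)
    show "(\<lambda>x. (f x)\<^sup>2) \<in> borel_measurable lborel"
      using assms by (auto simp: sq_integrable_def)
  qed measurable
  finally show ?thesis .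
qed

lemma sq_integrable_sum [simp]:
  "(\<And>i. i \<in> I \<Longrightarrow> sq_integrable (f i)) \<Longrightarrow> sq_integrable (\<lambda>x. \<Sum>i\<in>I. f i x)"
  by (induction I rule: infinite_finite_induct) simp_all

lemma l2_of_diff:
  assumes "sq_integrable f" "sq_integrable g"
  shows "l2_of (\<lambda>x. f x - g x) = l2_of f - l2_of g"
  unfolding l2_eq_iff
  using l2_fun_diff[of "l2_of f" "l2_of g"] l2_fun_of[OF assms(1)] l2_fun_of[OF assms(2)]
    l2_fun_of[OF sq_integrable_minus[OF assms]]
  by eventually_elim simp

lemma l2_of_add:
  assumes "sq_integrable f" "sq_integrable g"
  shows "l2_of (\<lambda>x. f x + g x) = l2_of f + l2_of g"
  unfolding l2_eq_iff
  using l2_fun_add[of "l2_of f" "l2_of g"] l2_fun_of[OF assms(1)] l2_fun_of[OF assms(2)]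
    l2_fun_of[OF sq_integrable_add[OF assms]]
  by eventually_elim simp

lemma l2_of_scaleR:
  assumes "sq_integrable f"
  shows "l2_of (\<lambda>x. c * f x) = c *\<^sub>R l2_of f"
  unfolding l2_eq_iff
  using l2_fun_scaleR[of c "l2_of f"] l2_fun_of[OF assms] l2_fun_of[OF sq_integrable_scale[OF assms]]
  by eventually_elim simp

lemma l2_of_sum:
  "(\<And>i. i \<in> I \<Longrightarrow> sq_integrable (f i)) \<Longrightarrow>
    l2_of (\<lambda>x. \<Sum>i\<in>I. f i x) = (\<Sum>i\<in>I. l2_of (f i))"
proof (induction I rule: infinite_finite_induct)
  case (insert i I)
  then show ?case by (simp add: l2_of_add)
qed (simp_all add: zero_l2_def)

lemma nn_integral_sq:
  "sq_integrable f \<Longrightarrow> (\<integral>\<^sup>+x. ennreal ((f x)\<^sup>2) \<partial>lborel) = ennreal ((norm (l2_of f))\<^sup>2)"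
  by (subst nn_integral_eq_integral) (auto simp: norm_l2_of sq_integrable_def)

lemma sq_integrableI_nn_integral:
  assumes "f \<in> borel_measurable lborel" "(\<integral>\<^sup>+x. ennreal ((f x)\<^sup>2) \<partial>lborel) < \<infinity>"
  shows "sq_integrable f"
  using assms by (auto simp: sq_integrable_def intro!: integrableI_nonneg)

lemma Cauchy_l2_convergent:
  fixes X :: "nat \<Rightarrow> 'a::euclidean_space l2"
  assumes "Cauchy X"
  shows "convergent X"
proof -
  have "\<forall>k. \<exists>N. \<forall>m\<ge>N. \<forall>n\<ge>N. norm (X m - X n) < (1/2) ^ k"
    using assms unfolding Cauchy_iff by auto
  then obtain N where N: "\<And>k m n. m \<ge> N k \<Longrightarrow> n \<ge> N k \<Longrightarrow> norm (X m - X n) < (1/2) ^ k"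
    by metis
  define r where "r = rec_nat (N 0) (\<lambda>k y. max (Suc y) (N (Suc k)))"
  have r_Suc: "r (Suc k) = max (Suc (r k)) (N (Suc k))" for k
    by (simp add: r_def)
  have r_N: "r k \<ge> N k" for k
    by (cases k) (simp_all add: r_def)
  have "strict_mono r"
    by (rule strict_mono_Suc_iff[THEN iffD2]) (simp add: r_Suc less_max_iff_disj)
  define Y where "Y k = l2_fun (X (r k))" for k
  have Ysq [simp]: "sq_integrable (Y k)" for k
    by (simp add: Y_def)
  have [measurable]: "Y k \<in> borel_measurable lborel" for k
    by (simp add: Y_def l2_fun_measurable)
  define G where "G n x = (\<Sum>k<n. \<bar>Y (Suc k) x - Y k x\<bar>)" for n x
  have Gsq [simp]: "sq_integrable (G n)" for n
    unfolding G_def by simp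
  have [measurable]: "G n \<in> borel_measurable lborel" for n
    unfolding G_def by measurable
  have norm_abs: "norm (l2_of (\<lambda>x. \<bar>f x\<bar>)) = norm (l2_of f)" if "sq_integrable f"
    for f :: "'a \<Rightarrow> real"
    by (rule power2_eq_imp_eq) (use that in \<open>simp_all add: norm_l2_of\<close>)
  have "norm (l2_of (G n)) \<le> 2" for n
  proof -
    have "norm (l2_of (G n)) \<le> (\<Sum>k<n. norm (l2_of (\<lambda>x. \<bar>Y (Suc k) x - Y k x\<bar>)))"
      unfolding G_def by (subst l2_of_sum) (simp_all add: norm_sum)
    also have "\<dots> = (\<Sum>k<n. norm (X (r (Suc k)) - X (r k)))"
      by (intro sum.cong refl, subst norm_abs) (simp_all add: l2_of_diff, simp add: Y_def)
    also have "\<dots> \<le> (\<Sum>k<n. (1/2) ^ k)"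
    proof (rule sum_mono)
      fix k
      have "r k \<le> r (Suc k)" by (simp add: r_Suc)
      then show "norm (X (r (Suc k)) - X (r k)) \<le> (1/2) ^ k"
        using N[of k "r (Suc k)" "r k"] r_N[of k] by simp
    qed
    also have "\<dots> \<le> (\<Sum>k. (1/2) ^ k)"
      by (rule sum_le_suminf) (auto intro: summable_geometric)
    finally show ?thesis by (simp add: suminf_geometric)
  qed
  then have "(norm (l2_of (G n)))\<^sup>2 \<le> 4" for n
    using power_mono[of "norm (l2_of (G n))" 2 2] by simp
  then have "(\<integral>\<^sup>+x. ennreal ((G n x)\<^sup>2) \<partial>lborel) \<le> 4" for n
    by (subst nn_integral_sq) (simp_all flip: ennreal_numeral)
  moreover have "(\<integral>\<^sup>+x. (SUP n. ennreal ((G n x)\<^sup>2)) \<partial>lborel)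
      = (SUP n. \<integral>\<^sup>+x. ennreal ((G n x)\<^sup>2) \<partial>lborel)"
  proof (rule nn_integral_monotone_convergence_SUP)
    have "G m x \<le> G n x" "0 \<le> G m x" if "m \<le> n" for m n x
      unfolding G_def using that by (auto intro!: sum_mono2 sum_nonneg)
    then show "incseq (\<lambda>n x. ennreal ((G n x)\<^sup>2))"
      by (auto simp: incseq_def le_fun_def intro!: ennreal_leI power_mono)
  qed measurable
  ultimately have "(\<integral>\<^sup>+x. (SUP n. ennreal ((G n x)\<^sup>2)) \<partial>lborel) \<le> 4"
    by (simp add: SUP_le_iff)
  then have "AE x in lborel. (SUP n. ennreal ((G n x)\<^sup>2)) \<noteq> \<infinity>"
    by (intro nn_integral_PInf_AE) (auto simp: top_unique)
  then have conv: "AE x in lborel. convergent (\<lambda>k. Y k x)"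
  proof eventually_elim
    case (elim x)
    then obtain c where c: "(SUP n. ennreal ((G n x)\<^sup>2)) = ennreal c" "c \<ge> 0"
      by (cases "SUP n. ennreal ((G n x)\<^sup>2)") auto
    have "(G n x)\<^sup>2 \<le> c" for n
    proof -
      have "ennreal ((G n x)\<^sup>2) \<le> ennreal c"
        unfolding c(1)[symmetric] by (rule SUP_upper) simp
      then show ?thesis using c(2) by simp
    qed
    then have "G n x \<le> sqrt c" for n
      by (rule real_le_rsqrt)
    then have "summable (\<lambda>k. \<bar>Y (Suc k) x - Y k x\<bar>)"
      unfolding G_def by (intro summableI_nonneg_bounded) auto
    then have "summable (\<lambda>k. Y (Suc k) x - Y k x)"
      by (rule summable_rabs_cancel)
    then have "convergent (\<lambda>n. \<Sum>k<n. Y (Suc k) x - Y k x)"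
      by (simp add: summable_iff_convergent)
    then have "convergent (\<lambda>n. Y n x - Y 0 x)"
      by (simp only: sum_lessThan_telescope[of "\<lambda>k. Y k x"])
    then have "convergent (\<lambda>n. (Y n x - Y 0 x) + Y 0 x)"
      by (intro convergent_add convergent_const)
    then show ?case by simp
  qed
  define f where "f x = lim (\<lambda>k. Y k x)" for x
  have [measurable]: "f \<in> borel_measurable lborel"
    unfolding f_def by measurable
  have lim: "AE x in lborel. (\<lambda>k. Y k x) \<longlonglongrightarrow> f x"
    using conv by eventually_elim (simp add: f_def convergent_LIMSEQ_iff)
  have bound: "(\<integral>\<^sup>+x. ennreal ((f x - Y k x)\<^sup>2) \<partial>lborel) \<le> ennreal (((1/2) ^ k)\<^sup>2)" for k
  proof -
    have "(\<integral>\<^sup>+x. ennreal ((f x - Y k x)\<^sup>2) \<partial>lborel)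
        = (\<integral>\<^sup>+x. liminf (\<lambda>m. ennreal ((Y m x - Y k x)\<^sup>2)) \<partial>lborel)"
    proof (rule nn_integral_cong_AE)
      show "AE x in lborel. ennreal ((f x - Y k x)\<^sup>2)
          = liminf (\<lambda>m. ennreal ((Y m x - Y k x)\<^sup>2))"
        using lim
      proof eventually_elim
        case (elim x)
        have "(\<lambda>m. ennreal ((Y m x - Y k x)\<^sup>2)) \<longlonglongrightarrow> ennreal ((f x - Y k x)\<^sup>2)"
          by (intro tendsto_ennrealI tendsto_intros elim)
        then show ?case by (intro lim_imp_Liminf[symmetric]) auto
      qed
    qed
    also have "\<dots> \<le> liminf (\<lambda>m. \<integral>\<^sup>+x. ennreal ((Y m x - Y k x)\<^sup>2) \<partial>lborel)"
      by (rule nn_integral_liminf) measurable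
    also have "\<dots> \<le> ennreal (((1/2) ^ k)\<^sup>2)"
    proof (rule Liminf_le)
      show "\<forall>\<^sub>F m in sequentially.
          (\<integral>\<^sup>+x. ennreal ((Y m x - Y k x)\<^sup>2) \<partial>lborel) \<le> ennreal (((1/2) ^ k)\<^sup>2)"
        unfolding eventually_sequentially
      proof (intro exI allI impI)
        fix m assume "k \<le> m"
        then have "r k \<le> r m"
          using \<open>strict_mono r\<close> by (simp add: strict_mono_less_eq)
        then have "norm (X (r m) - X (r k)) < (1/2) ^ k"
          using N[of k "r m" "r k"] r_N[of k] by simp
        then have "(norm (X (r m) - X (r k)))\<^sup>2 \<le> ((1/2) ^ k)\<^sup>2"
          by (intro power_mono) auto
        then show "(\<integral>\<^sup>+x. ennreal ((Y m x - Y k x)\<^sup>2) \<partial>lborel) \<le> ennreal (((1/2) ^ k)\<^sup>2)"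
          by (subst nn_integral_sq) (simp_all add: l2_of_diff Y_def ennreal_leI)
      qed
    qed simp
    finally show ?thesis .
  qed
  have dsq: "sq_integrable (\<lambda>x. f x - Y k x)" for k
    using bound[of k] by (intro sq_integrableI_nn_integral) (auto simp: le_less_trans)
  have fsq: "sq_integrable f"
    using sq_integrable_add[OF dsq[of 0] Ysq[of 0]] by simp
  have "norm (X (r k) - l2_of f) \<le> (1/2) ^ k" for k
  proof -
    have "ennreal ((norm (l2_of f - X (r k)))\<^sup>2) \<le> ennreal (((1/2) ^ k)\<^sup>2)"
      using bound[of k] nn_integral_sq[OF dsq[of k]]
      by (simp add: l2_of_diff fsq) (simp add: Y_def)
    then have "(norm (l2_of f - X (r k)))\<^sup>2 \<le> ((1/2) ^ k)\<^sup>2"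
      by (simp add: ennreal_le_iff)
    then show ?thesis
      unfolding norm_minus_commute[of "X (r k)"] by (rule power2_le_imp_le) simp
  qed
  then have "(\<lambda>k. X (r k) - l2_of f) \<longlonglongrightarrow> 0"
    by (rule Lim_null_comparison[OF always_eventually[OF allI]]) (rule LIMSEQ_power_zero, simp)
  then have "(X \<circ> r) \<longlonglongrightarrow> l2_of f"
    by (simp add: LIM_zero_cancel o_def)
  then show ?thesis
    using Cauchy_converges_subseq[OF assms \<open>strict_mono r\<close>] by (auto simp: convergent_def)
qed

instance l2 :: (euclidean_space) banach
  by standard (rule Cauchy_l2_convergent)

lemma l2_dominated_convergence:
  fixes f :: "'a::euclidean_space \<Rightarrow> real"
  assumes [measurable]: "\<And>i. s i \<in> borel_measurable lborel" "f \<in> borel_measurable lborel"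
    and w: "sq_integrable w"
    and lim: "\<And>x. (\<lambda>i. s i x) \<longlonglongrightarrow> f x" and bound: "\<And>i x. \<bar>s i x\<bar> \<le> \<bar>w x\<bar>"
  shows "\<And>i. sq_integrable (s i)" "sq_integrable f" "(\<lambda>i. l2_of (s i)) \<longlonglongrightarrow> l2_of f"
proof -
  have fw: "\<bar>f x\<bar> \<le> \<bar>w x\<bar>" for x
    by (rule LIMSEQ_le_const2[OF tendsto_rabs[OF lim[of x]]]) (use bound in blast)
  have dom: "sq_integrable h" if [measurable]: "h \<in> borel_measurable lborel"
    and h: "\<And>x. \<bar>h x\<bar> \<le> \<bar>w x\<bar>" for h :: "'a \<Rightarrow> real"
    unfolding sq_integrable_def
  proof (intro conjI that)
    show "integrable lborel (\<lambda>x. (h x)\<^sup>2)"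
    proof (rule Bochner_Integration.integrable_bound)
      show "integrable lborel (\<lambda>x. (w x)\<^sup>2)"
        using w by (simp add: sq_integrable_def)
      show "AE x in lborel. norm ((h x)\<^sup>2) \<le> norm ((w x)\<^sup>2)"
        using h by (simp add: abs_le_square_iff)
    qed measurable
  qed
  show s: "sq_integrable (s i)" for i
    by (rule dom) (use bound in auto)
  show f: "sq_integrable f"
    by (rule dom) (use fw in auto)
  have "(\<lambda>i. \<integral>x. (s i x - f x)\<^sup>2 \<partial>lborel) \<longlonglongrightarrow> (\<integral>x. (0 :: real) \<partial>(lborel :: 'a measure))"
  proof (rule integral_dominated_convergence)
    show "integrable lborel (\<lambda>x. 4 * (w x)\<^sup>2)"
      using w by (simp add: sq_integrable_def)
    show "AE x in lborel. (\<lambda>i. (s i x - f x)\<^sup>2) \<longlonglongrightarrow> 0"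
    proof (rule AE_I2)
      fix x
      have "(\<lambda>i. (s i x - f x)\<^sup>2) \<longlonglongrightarrow> (f x - f x)\<^sup>2"
        by (intro tendsto_intros lim)
      then show "(\<lambda>i. (s i x - f x)\<^sup>2) \<longlonglongrightarrow> 0" by simp
    qed
    show "AE x in lborel. norm ((s i x - f x)\<^sup>2) \<le> 4 * (w x)\<^sup>2" for i
    proof (rule AE_I2)
      fix x
      have "\<bar>s i x - f x\<bar> \<le> \<bar>2 * w x\<bar>"
        using bound[of i x] fw[of x] by (simp add: abs_mult)
      then have "(s i x - f x)\<^sup>2 \<le> (2 * w x)\<^sup>2"
        by (simp only: abs_le_square_iff)
      then show "norm ((s i x - f x)\<^sup>2) \<le> 4 * (w x)\<^sup>2"
        by (simp add: power_mult_distrib)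
    qed
  qed measurable
  then have "(\<lambda>i. (norm (l2_of (s i) - l2_of f))\<^sup>2) \<longlonglongrightarrow> 0"
    by (simp add: s f flip: norm_l2_of l2_of_diff)
  then have "(\<lambda>i. sqrt ((norm (l2_of (s i) - l2_of f))\<^sup>2)) \<longlonglongrightarrow> sqrt 0"
    by (rule tendsto_real_sqrt)
  then show "(\<lambda>i. l2_of (s i)) \<longlonglongrightarrow> l2_of f"
    by (simp add: LIM_zero_iff tendsto_norm_zero_iff)
qed

lemma sq_integrable_indicator:
  assumes "A \<in> sets lborel" "emeasure lborel A < \<infinity>"
  shows "sq_integrable (indicat_real A)"
proof -
  have "(indicat_real A x)\<^sup>2 = indicat_real A x" for x
    by (simp add: indicator_def)
  then show ?thesis
    using assms by (simp add: sq_integrable_def)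
qed

lemma l2_separable:
  "\<exists>D :: 'a::euclidean_space l2 set. countable D \<and> closure D = UNIV"
proof -
  obtain B :: "'a set set" where B: "countable B" "topological_basis B"
    using ex_countable_basis by blast
  define W where "W = Union ` {F. finite F \<and> F \<subseteq> B}"
  define I where "I = (\<lambda>A. l2_of (indicat_real A)) ` W"
  define val :: "(real \<times> 'a l2) list \<Rightarrow> 'a l2"
    where "val xs = sum_list (map (\<lambda>(q, d). q *\<^sub>R d) xs)" for xs
  define D where "D = val ` lists (\<rat> \<times> I)"
  have "countable I"
    unfolding I_def W_def by (intro countable_image countable_Collect_finite_subset B)
  then have "countable D"
    unfolding D_def by (intro countable_image countable_lists countable_SIGMA countable_rat)
  have D_add: "x + y \<in> D" if "x \<in> D" "y \<in> D" for x y
  proof -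
    from that obtain xs ys where "xs \<in> lists (\<rat> \<times> I)" "ys \<in> lists (\<rat> \<times> I)"
      "x = val xs" "y = val ys"
      by (auto simp: D_def)
    then show ?thesis
      unfolding D_def by (intro image_eqI[of _ _ "xs @ ys"]) (auto simp: val_def)
  qed
  have D_scale: "q *\<^sub>R x \<in> D" if "q \<in> \<rat>" "x \<in> D" for q x
  proof -
    from that obtain xs where xs: "xs \<in> lists (\<rat> \<times> I)" "x = val xs"
      by (auto simp: D_def)
    have "q *\<^sub>R val xs = val (map (\<lambda>(p, d). (q * p, d)) xs)"
      by (induction xs) (auto simp: val_def scaleR_add_right)
    moreover have "map (\<lambda>(p, d). (q * p, d)) xs \<in> lists (\<rat> \<times> I)"
      using xs(1) that(1) by (induction xs) auto
    ultimately show ?thesis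
      using xs(2) unfolding D_def by blast
  qed
  define K where "K = closure D"
  have "closed K" "D \<subseteq> K"
    by (simp_all add: K_def closure_subset)
  have K_lim: "x \<in> K" if "\<And>n. f n \<in> K" "f \<longlonglongrightarrow> x" for f x
    using \<open>closed K\<close> that closed_sequentially by blast
  have K_seq: "\<exists>f. (\<forall>n. f n \<in> D) \<and> f \<longlonglongrightarrow> x" if "x \<in> K" for x
    using that by (simp add: K_def closure_sequential)
  have K_add: "x + y \<in> K" if "x \<in> K" "y \<in> K" for x y
  proof -
    from K_seq[OF that(1)] obtain f where f: "\<forall>n. f n \<in> D" "f \<longlonglongrightarrow> x"
      by blast
    from K_seq[OF that(2)] obtain g where g: "\<forall>n. g n \<in> D" "g \<longlonglongrightarrow> y"
      by blast
    show ?thesis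
      by (rule K_lim[OF _ tendsto_add[OF f(2) g(2)]]) (use f g \<open>D \<subseteq> K\<close> D_add in auto)
  qed
  have K_scale: "c *\<^sub>R x \<in> K" if "x \<in> K" for c x
  proof -
    from K_seq[OF that] obtain f where f: "\<forall>n. f n \<in> D" "f \<longlonglongrightarrow> x"
      by blast
    have "c \<in> closure \<rat>"
      by (simp add: Rats_closure_real)
    then obtain q where q: "\<forall>n. q n \<in> \<rat>" "q \<longlonglongrightarrow> c"
      by (auto simp: closure_sequential)
    show ?thesis
      by (rule K_lim[OF _ tendsto_scaleR[OF q(2) f(2)]]) (use f q \<open>D \<subseteq> K\<close> D_scale in auto)
  qed
  have K_I: "x \<in> K" if "x \<in> I" for x
  proof -
    have "val [(1, x)] \<in> D"
      unfolding D_def using that by (intro imageI) auto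
    then show ?thesis
      using \<open>D \<subseteq> K\<close> by (auto simp: val_def)
  qed
  have K_0: "0 \<in> K"
  proof -
    have "val [] \<in> D" unfolding D_def by (intro imageI) auto
    then show ?thesis using \<open>D \<subseteq> K\<close> by (auto simp: val_def)
  qed
  have K_sum: "(\<Sum>i\<in>J. f i) \<in> K" if "\<And>i. i \<in> J \<Longrightarrow> f i \<in> K" for J and f :: "real \<Rightarrow> 'a l2"
    using that by (induction J rule: infinite_finite_induct) (auto simp: K_0 K_add)

  have K_open: "l2_of (indicat_real U) \<in> K" if U: "open U" "emeasure lborel U < \<infinity>" for U
  proof (cases "U = {}")
    case True
    then show ?thesis using K_0 by (simp add: indicator_def[abs_def] zero_l2_def)
  next
    case False
    obtain B' where B': "B' \<subseteq> B" "\<Union>B' = U"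
      using B(2) U(1) by (meson topological_basis_def)
    then have ne: "B' \<noteq> {}" using False by auto
    have cB': "countable B'" using B' B(1) countable_subset by blast
    define V where "V k = \<Union>(from_nat_into B' ` {..<k})" for k :: nat
    have "from_nat_into B' ` {..<k} \<subseteq> B" for k
      using B' from_nat_into[OF ne] by blast
    then have VW: "V k \<in> W" for k
      unfolding W_def V_def by (intro imageI) auto
    have "\<Union>B' = (\<Union>k. from_nat_into B' k)"
      using range_from_nat_into[OF ne cB'] by simp
    then have "x \<in> U \<longleftrightarrow> (\<exists>k. x \<in> from_nat_into B' k)" for x
      using B' by auto
    then have Vx: "(\<lambda>k. indicat_real (V k) x) \<longlonglongrightarrow> indicat_real U x" for x
    proof (cases "x \<in> U")
      case True
      then obtain j where "x \<in> from_nat_into B' j"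
        using \<open>\<And>x. x \<in> U \<longleftrightarrow> (\<exists>k. x \<in> from_nat_into B' k)\<close> by blast
      then have "indicat_real (V k) x = indicat_real U x" if "k \<ge> Suc j" for k
        using that True by (auto simp: V_def indicator_def)
      then show ?thesis
        by (intro tendsto_eventually) (auto simp: eventually_sequentially)
    next
      case False
      then have "x \<notin> V k" for k
        using \<open>\<And>x. x \<in> U \<longleftrightarrow> (\<exists>k. x \<in> from_nat_into B' k)\<close> by (auto simp: V_def)
      then show ?thesis using False by simp
    qed
    have VU: "V k \<subseteq> U" for k
      using B' from_nat_into[OF ne] by (auto simp: V_def)
    have [measurable]: "V k \<in> sets borel" for k
      unfolding V_def using B' B(2) from_nat_into[OF ne] topological_basis_open
      by (intro sets.finite_UN borel_open) (auto, blast)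
    have [measurable]: "U \<in> sets borel" using U(1) by simp
    have "(\<lambda>k. l2_of (indicat_real (V k))) \<longlonglongrightarrow> l2_of (indicat_real U)"
    proof (rule l2_dominated_convergence(3))
      show "sq_integrable (indicat_real U)"
        using U by (intro sq_integrable_indicator) auto
      show "\<bar>indicat_real (V k) x\<bar> \<le> \<bar>indicat_real U x\<bar>" for k x
        using VU[of k] by (auto simp: indicator_def)
    qed (use Vx in auto)
    moreover have "l2_of (indicat_real (V k)) \<in> K" for k
      using VW by (intro K_I) (simp add: I_def)
    ultimately show ?thesis by (rule K_lim[rotated])
  qed

  have K_ind: "l2_of (indicat_real A) \<in> K"
    if [measurable]: "A \<in> sets borel" and A: "emeasure lborel A < \<infinity>" for A
  proof -
    have "\<exists>T. open T \<and> A \<subseteq> T \<and> emeasure lborel (T - A) < ennreal ((1/2)^k)" for k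
    proof -
      have "A \<in> sets lebesgue" by simp
      then obtain T where T: "open T" "A \<subseteq> T" "emeasure lebesgue (T - A) < ennreal ((1/2)^k)"
        using sets_lebesgue_outer_open[of A "(1/2)^k"] by auto
      then have "emeasure lborel (T - A) < ennreal ((1/2)^k)"
        using T(1) by (subst (asm) emeasure_completion) auto
      with T show ?thesis by blast
    qed
    then obtain T where T: "\<And>k. open (T k)" "\<And>k. A \<subseteq> T k"
      "\<And>k. emeasure lborel (T k - A) < ennreal ((1/2)^k)"
      by metis
    have [measurable]: "T k \<in> sets borel" for k using T(1) by simp
    have TA: "emeasure lborel (T k - A) < \<infinity>" for k
      using less_trans[OF T(3)[of k] ennreal_less_top] by simp
    have Tfin: "emeasure lborel (T k) < \<infinity>" for k
    proof -
      have "T k = A \<union> (T k - A)" using T(2) by blast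
      then have "emeasure lborel (T k) \<le> emeasure lborel A + emeasure lborel (T k - A)"
        using emeasure_subadditive[of A lborel "T k - A"] by simp
      also have "\<dots> < \<infinity>" using A TA[of k] by simp
      finally show ?thesis .
    qed
    have sqs: "sq_integrable (indicat_real (T k))" "sq_integrable (indicat_real A)" for k
      using Tfin A by (auto intro!: sq_integrable_indicator)
    have le: "norm (l2_of (indicat_real (T k)) - l2_of (indicat_real A)) \<le> sqrt ((1/2)^k)" for k
    proof -
      have "(indicat_real (T k) x - indicat_real A x)\<^sup>2 = indicat_real (T k - A) x" for x
        using T(2)[of k] by (auto simp: indicator_def)
      then have "(norm (l2_of (indicat_real (T k)) - l2_of (indicat_real A)))\<^sup>2
          = measure lborel (T k - A)"
        using TA[of k] sqs by (simp add: norm_l2_of flip: l2_of_diff)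
      also have "\<dots> \<le> (1/2)^k"
        unfolding measure_def using T(3)[of k] by (intro enn2real_leI) auto
      finally show ?thesis by (rule real_le_rsqrt)
    qed
    have "(\<lambda>k. sqrt ((1/2)^k)) \<longlonglongrightarrow> sqrt 0"
      by (intro tendsto_real_sqrt LIMSEQ_power_zero) simp
    then have "(\<lambda>k. sqrt ((1/2)^k)) \<longlonglongrightarrow> 0" by simp
    then have "(\<lambda>k. l2_of (indicat_real (T k)) - l2_of (indicat_real A)) \<longlonglongrightarrow> 0"
      by (rule Lim_null_comparison[OF always_eventually[OF allI[OF le]]])
    then have "(\<lambda>k. l2_of (indicat_real (T k))) \<longlonglongrightarrow> l2_of (indicat_real A)"
      by (simp add: LIM_zero_iff)
    moreover have "l2_of (indicat_real (T k)) \<in> K" for k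
      using T(1) Tfin by (intro K_open)
    ultimately show ?thesis by (rule K_lim[rotated])
  qed

  have K_simple: "l2_of f \<in> K" if f: "simple_function lborel f" and sq: "sq_integrable f"
    for f :: "'a \<Rightarrow> real"
  proof -
    have [measurable]: "f \<in> borel_measurable lborel"
      using sq by (simp add: sq_integrable_def)
    define E where "E y = f -` {y}" for y
    have [measurable]: "E y \<in> sets borel" for y
    proof -
      have "f -` {y} \<inter> space lborel \<in> sets lborel" by measurable
      then show ?thesis by (simp add: E_def)
    qed
    have fin: "emeasure lborel (E y) < \<infinity>" if "y \<noteq> 0" for y
    proof -
      have "integrable lborel (indicat_real (E y))"
      proof (rule Bochner_Integration.integrable_bound)
        show "integrable lborel (\<lambda>x. (f x)\<^sup>2 / y\<^sup>2)"
          using sq by (simp add: sq_integrable_def)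
        show "AE x in lborel. norm (indicat_real (E y) x) \<le> norm ((f x)\<^sup>2 / y\<^sup>2)"
          using that by (auto simp: E_def indicator_def)
      qed measurable
      then show ?thesis
        by (subst (asm) integrable_indicator_iff) auto
    qed
    have *: "l2_of (\<lambda>x. y * indicat_real (E y) x) \<in> K \<and> sq_integrable (\<lambda>x. y * indicat_real (E y) x)" for y
    proof (cases "y = 0")
      case True
      then show ?thesis using K_0 by (simp add: zero_l2_def)
    next
      case False
      then have "sq_integrable (indicat_real (E y))"
        using fin by (intro sq_integrable_indicator) auto
      then show ?thesis
        using False fin by (simp add: l2_of_scaleR K_scale K_ind)
    qed
    have **: "f = (\<lambda>x. \<Sum>y\<in>range f. y * indicat_real (E y) x)"
    proof
      fix x
      have "finite (range f)"
        using f by (simp add: simple_function_def)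
      then have "(\<Sum>y\<in>range f. y * indicat_real (E y) x) = (\<Sum>y\<in>{f x}. y * indicat_real (E y) x)"
        by (intro sum.mono_neutral_right) (auto simp: E_def indicator_def)
      then show "f x = (\<Sum>y\<in>range f. y * indicat_real (E y) x)"
        by (simp add: E_def)
    qed
    have "l2_of (\<lambda>x. \<Sum>y\<in>range f. y * indicat_real (E y) x) \<in> K"
      using * by (subst l2_of_sum) (auto intro!: K_sum)
    then show ?thesis by (subst **)
  qed

  have "u \<in> K" for u
  proof -
    obtain F where F: "\<And>i. simple_function lborel (F i)" "\<And>x. (\<lambda>i. F i x) \<longlonglongrightarrow> l2_fun u x"
      "\<And>i x. dist (F i x) 0 \<le> 2 * dist (l2_fun u x) 0"
      using borel_measurable_implies_sequence_metric[OF l2_fun_measurable[of u], of 0] by auto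
    have bd: "\<bar>F i x\<bar> \<le> \<bar>2 * l2_fun u x\<bar>" for i x
      using F(3)[of i x] by (simp add: abs_mult)
    have w: "sq_integrable (\<lambda>x. 2 * l2_fun u x)" by simp
    have m: "F i \<in> borel_measurable lborel" for i
      using F(1) by (rule borel_measurable_simple_function)
    have "sq_integrable (F i)" for i
      by (rule l2_dominated_convergence(1)[OF m l2_fun_measurable w F(2) bd])
    then have FK: "l2_of (F i) \<in> K" for i
      using F(1) by (intro K_simple)
    have "(\<lambda>i. l2_of (F i)) \<longlonglongrightarrow> l2_of (l2_fun u)"
      by (rule l2_dominated_convergence(3)[OF m l2_fun_measurable w F(2) bd])
    then show ?thesis
      using K_lim[OF FK] by simp
  qed
  then show ?thesis
    using \<open>countable D\<close> unfolding K_def by blast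
qed

instance l2 :: (euclidean_space) second_countable_topology
proof
  obtain D :: "'a l2 set" where D: "countable D" "closure D = UNIV"
    using l2_separable by blast
  define B where "B = (\<lambda>(d, q). ball d q) ` (D \<times> (\<rat> :: real set))"
  have "topological_basis B"
  proof (rule topological_basisI)
    show "open b" if "b \<in> B" for b
      using that by (auto simp: B_def)
    fix U :: "'a l2 set" and x
    assume "open U" "x \<in> U"
    then obtain e where e: "e > 0" "ball x e \<subseteq> U"
      by (meson open_contains_ball)
    obtain q where q: "q \<in> \<rat>" "0 < q" "q < e / 2"
      using Rats_dense_in_real[of 0 "e / 2"] e by auto
    obtain d where d: "d \<in> D" "dist d x < q"
      using D(2) q(2) closure_approachable[of x D] by auto
    have "ball d q \<subseteq> U"
    proof
      fix y assume "y \<in> ball d q"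
      then have "dist x y < e"
        using d(2) q(3) dist_triangle[of x y d] by (simp add: dist_commute)
      then show "y \<in> U" using e by auto
    qed
    then show "\<exists>b\<in>B. x \<in> b \<and> b \<subseteq> U"
      using d q by (intro bexI[of _ "ball d q"]) (auto simp: B_def)
  qed
  moreover have "countable B"
    unfolding B_def by (intro countable_image countable_SIGMA D countable_rat)
  ultimately show "\<exists>B :: 'a l2 set set. countable B \<and> open = generate_topology B"
    using topological_basis_imp_subbasis by blast
qed

section \<open>Smooth functions and domains\<close>

primrec Ck_on :: "nat \<Rightarrow> 'a::euclidean_space set \<Rightarrow> ('a \<Rightarrow> real) \<Rightarrow> bool" where
  "Ck_on 0 U f \<longleftrightarrow> continuous_on U f"
| "Ck_on (Suc k) U f \<longleftrightarrow> (\<forall>x\<in>U. f differentiable (at x)) \<and>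
    (\<forall>b\<in>Basis. Ck_on k U (\<lambda>x. frechet_derivative f (at x) b))"

definition smooth_on :: "'a::euclidean_space set \<Rightarrow> ('a \<Rightarrow> real) \<Rightarrow> bool" where
  "smooth_on U f \<longleftrightarrow> (\<forall>k. Ck_on k U f)"

text \<open>Smoothness of the boundary is expressed by local defining functions with nonvanishing
  gradient; in particular the domain lies locally on one side of its boundary.\<close>

definition smooth_bounded_domain :: "'a::euclidean_space set \<Rightarrow> bool" where
  "smooth_bounded_domain \<Omega> \<longleftrightarrow>
     open \<Omega> \<and> connected \<Omega> \<and> \<Omega> \<noteq> {} \<and> bounded \<Omega> \<and>
     (\<forall>x\<in>frontier \<Omega>. \<exists>U \<rho>. open U \<and> x \<in> U \<and> smooth_on U \<rho> \<and>
        (\<forall>y\<in>U. frechet_derivative \<rho> (at y) \<noteq> (\<lambda>_. 0)) \<and>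
        \<Omega> \<inter> U = {y \<in> U. \<rho> y < 0})"

definition test_function :: "'a::euclidean_space set \<Rightarrow> ('a \<Rightarrow> real) \<Rightarrow> bool" where
  "test_function \<Omega> \<phi> \<longleftrightarrow> smooth_on UNIV \<phi> \<and> compact (closure {x. \<phi> x \<noteq> 0}) \<and>
     closure {x. \<phi> x \<noteq> 0} \<subseteq> \<Omega>"


section \<open>Sobolev spaces\<close>

definition L2 :: "'a::euclidean_space set \<Rightarrow> 'a l2 set" where
  "L2 \<Omega> = {u. AE x in lborel. x \<notin> \<Omega> \<longrightarrow> l2_fun u x = 0}"

definition has_weak_partial ::
  "'a::euclidean_space set \<Rightarrow> 'a \<Rightarrow> 'a l2 \<Rightarrow> 'a l2 \<Rightarrow> bool" where
  "has_weak_partial \<Omega> b u v \<longleftrightarrow> u \<in> L2 \<Omega> \<and> v \<in> L2 \<Omega> \<and>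
     (\<forall>\<phi>. test_function \<Omega> \<phi> \<longrightarrow>
        (\<integral>x. l2_fun u x * frechet_derivative \<phi> (at x) b \<partial>lborel)
          = - (\<integral>x. l2_fun v x * \<phi> x \<partial>lborel))"

definition weak_partial :: "'a::euclidean_space set \<Rightarrow> 'a \<Rightarrow> 'a l2 \<Rightarrow> 'a l2" where
  "weak_partial \<Omega> b u = (THE v. has_weak_partial \<Omega> b u v)"

text \<open>\<open>sobolev \<Omega> k\<close> is $H^k(\Omega)$.\<close>

primrec sobolev :: "'a::euclidean_space set \<Rightarrow> nat \<Rightarrow> 'a l2 set" where
  "sobolev \<Omega> 0 = L2 \<Omega>"
| "sobolev \<Omega> (Suc k) =
     {u \<in> L2 \<Omega>. \<forall>b\<in>Basis. \<exists>v. has_weak_partial \<Omega> b u v \<and> v \<in> sobolev \<Omega> k}"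

definition H01_norm :: "'a::euclidean_space set \<Rightarrow> 'a l2 \<Rightarrow> real" where
  "H01_norm \<Omega> u = sqrt (\<Sum>b\<in>Basis. (norm (weak_partial \<Omega> b u))\<^sup>2)"

definition laplace :: "'a::euclidean_space set \<Rightarrow> 'a l2 \<Rightarrow> 'a l2" where
  "laplace \<Omega> u = (\<Sum>b\<in>Basis. weak_partial \<Omega> b (weak_partial \<Omega> b u))"

definition H02_norm :: "'a::euclidean_space set \<Rightarrow> 'a l2 \<Rightarrow> real" where
  "H02_norm \<Omega> u = norm (laplace \<Omega> u)"

text \<open>\<open>H01 \<Omega>\<close> is $H^1_0(\Omega)$, the closure of the test functions in $H^1(\Omega)$.\<close>

definition H01 :: "'a::euclidean_space set \<Rightarrow> 'a l2 set" where
  "H01 \<Omega> = {u \<in> sobolev \<Omega> 1. \<forall>\<epsilon>>0. \<exists>\<phi>. test_function \<Omega> \<phi> \<and>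
     (norm (u - l2_of \<phi>))\<^sup>2 + (H01_norm \<Omega> (u - l2_of \<phi>))\<^sup>2 < \<epsilon>}"

definition V_space :: "'a::euclidean_space set \<Rightarrow> 'a l2 set" where
  "V_space \<Omega> = H01 \<Omega> \<inter> sobolev \<Omega> 2"

definition V_norm :: "'a::euclidean_space set \<Rightarrow> 'a l2 \<Rightarrow> real" where
  "V_norm \<Omega> u = sqrt ((norm u)\<^sup>2 + 2 * (H01_norm \<Omega> u)\<^sup>2 + (H02_norm \<Omega> u)\<^sup>2)"

definition unit_sphere :: "'a::euclidean_space set \<Rightarrow> 'a l2 set" where
  "unit_sphere \<Omega> = {u \<in> L2 \<Omega>. (norm u)\<^sup>2 = 1}"


section \<open>The linear operator and its semigroup\<close>

definition A_op :: "'a::euclidean_space set \<Rightarrow> 'a l2 \<Rightarrow> 'a l2" where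
  "A_op \<Omega> u = laplace \<Omega> (laplace \<Omega> u) - 2 *\<^sub>R laplace \<Omega> u"

text \<open>
  The domain of \<open>A_op\<close>. On all of $H^1_0 \cap H^2 \cap H^4$ the operator $\Delta^2 - 2\Delta$ is not
  symmetric (a fourth-order operator needs a second boundary condition) and $-A$ would generate no
  semigroup. We read $\Delta^2$ as the square of the Dirichlet Laplacian with domain \<open>V_space \<Omega>\<close>, i.e.
  we also require $\Delta u \in H^1_0 \cap H^2$ for elements of $H^1_0 \cap H^2 \cap H^4$. This is the only
  subspace of $H^1_0 \cap H^2 \cap H^4$ on which $A$ is self-adjoint, satisfies
  $\langle Au, u\rangle = \|\Delta u\|^2 + 2 \|\nabla u\|^2$, and whose semigroup maps \<open>V_space \<Omega>\<close>
  continuously into \<open>X_space \<Omega> T\<close> as in \<open>max_regularity\<close> below.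
\<close>

definition E_space :: "'a::euclidean_space set \<Rightarrow> 'a l2 set" where
  "E_space \<Omega> = {u \<in> H01 \<Omega> \<inter> sobolev \<Omega> 2 \<inter> sobolev \<Omega> 4. laplace \<Omega> u \<in> V_space \<Omega>}"

definition E_norm :: "'a::euclidean_space set \<Rightarrow> 'a l2 \<Rightarrow> real" where
  "E_norm \<Omega> u = norm (A_op \<Omega> u)"

definition self_adjoint_in :: "'b::real_inner set \<Rightarrow> 'b set \<Rightarrow> ('b \<Rightarrow> 'b) \<Rightarrow> bool" where
  "self_adjoint_in H D A \<longleftrightarrow> D \<subseteq> H \<and> H \<subseteq> closure D \<and>
     (\<forall>v\<in>H. \<forall>w\<in>H. (\<forall>u\<in>D. inner (A u) v = inner u w) \<longleftrightarrow> v \<in> D \<and> A v = w)"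

text \<open>
  Analytic semigroups in the sense of Henry's ``Geometric Theory of Semilinear Parabolic Equations'':
  strongly continuous semigroups all of whose orbits are real analytic on $(0, \infty)$. (This makes
  sense in a real Hilbert space, without complexification.) The maps \<open>S t\<close> only matter on \<open>H\<close>.
\<close>

definition analytic_semigroup :: "'b::real_normed_vector set \<Rightarrow> (real \<Rightarrow> 'b \<Rightarrow> 'b) \<Rightarrow> bool" where
  "analytic_semigroup H S \<longleftrightarrow>
     (\<forall>t\<ge>0. (\<forall>x\<in>H. S t x \<in> H) \<and>
        (\<forall>x\<in>H. \<forall>y\<in>H. S t (x + y) = S t x + S t y) \<and>
        (\<forall>c. \<forall>x\<in>H. S t (c *\<^sub>R x) = c *\<^sub>R S t x) \<and>
        (\<exists>C. \<forall>x\<in>H. norm (S t x) \<le> C * norm x)) \<and>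
     (\<forall>x\<in>H. S 0 x = x) \<and>
     (\<forall>s\<ge>0. \<forall>t\<ge>0. \<forall>x\<in>H. S (s + t) x = S s (S t x)) \<and>
     (\<forall>x\<in>H. ((\<lambda>t. S t x) \<longlongrightarrow> x) (at_right 0)) \<and>
     (\<forall>x\<in>H. \<forall>t0>0. \<exists>r>0. \<exists>c :: nat \<Rightarrow> 'b.
        \<forall>t. \<bar>t - t0\<bar> < r \<longrightarrow> (\<lambda>k. (t - t0) ^ k *\<^sub>R c k) sums S t x)"

definition is_generator ::
  "'b::real_normed_vector set \<Rightarrow> (real \<Rightarrow> 'b \<Rightarrow> 'b) \<Rightarrow> 'b set \<Rightarrow> ('b \<Rightarrow> 'b) \<Rightarrow> bool" where
  "is_generator H S D G \<longleftrightarrow> D \<subseteq> H \<and>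
     (\<forall>x\<in>H. \<forall>y. ((\<lambda>h. (S h x - x) /\<^sub>R h) \<longlongrightarrow> y) (at_right 0) \<longleftrightarrow> x \<in> D \<and> G x = y)"


section \<open>Function spaces in time\<close>

text \<open>\<open>time_L2 H T\<close> is $L^2(0,T;H)$ for a closed subspace \<open>H\<close> (without passing to classes).\<close>

definition time_L2 ::
  "'b::{banach, second_countable_topology} set \<Rightarrow> real \<Rightarrow> (real \<Rightarrow> 'b) set" where
  "time_L2 H T = {f. f \<in> borel_measurable (lebesgue_on {0..T}) \<and>
     (AE p in lebesgue_on {0..T}. f p \<in> H) \<and>
     integrable (lebesgue_on {0..T}) (\<lambda>p. (norm (f p))\<^sup>2)}"

definition time_L2_norm :: "real \<Rightarrow> (real \<Rightarrow> 'b::{banach, second_countable_topology}) \<Rightarrow> real" where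
  "time_L2_norm T f = sqrt (\<integral>p. (norm (f p))\<^sup>2 \<partial>lebesgue_on {0..T})"

text \<open>Membership in $L^2(0,T;\mathcal{E})$ uses that $A$ is an isometry of $\mathcal{E}$ (with norm
  \<open>E_norm\<close>) into $L^2$; the values of \<open>A_op \<Omega> (u p)\<close> on the null set where \<open>u p \<notin> E_space \<Omega>\<close> are
  irrelevant, the measure being complete.\<close>

definition X_space :: "'a::euclidean_space set \<Rightarrow> real \<Rightarrow> (real \<Rightarrow> 'a l2) set" where
  "X_space \<Omega> T = {u.
     (AE p in lebesgue_on {0..T}. u p \<in> E_space \<Omega>) \<and>
     u \<in> borel_measurable (lebesgue_on {0..T}) \<and>
     (\<lambda>p. A_op \<Omega> (u p)) \<in> time_L2 (L2 \<Omega>) T \<and>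
     (\<forall>p\<in>{0..T}. u p \<in> V_space \<Omega>) \<and>
     (\<forall>s\<in>{0..T}. ((\<lambda>p. V_norm \<Omega> (u p - u s)) \<longlongrightarrow> 0) (at s within {0..T}))}"

definition X_norm :: "'a::euclidean_space set \<Rightarrow> real \<Rightarrow> (real \<Rightarrow> 'a l2) \<Rightarrow> real" where
  "X_norm \<Omega> T u = sqrt ((SUP p\<in>{0..T}. (V_norm \<Omega> (u p))\<^sup>2)
     + (\<integral>p. (E_norm \<Omega> (u p))\<^sup>2 \<partial>lebesgue_on {0..T}))"

definition convol :: "(real \<Rightarrow> 'b \<Rightarrow> 'b) \<Rightarrow> (real \<Rightarrow> 'b) \<Rightarrow> real
    \<Rightarrow> 'b::{banach, second_countable_topology}" where
  "convol S f t = (\<integral>p. S (t - p) (f p) \<partial>lebesgue_on {0..t})"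

definition max_regularity :: "'a::euclidean_space set \<Rightarrow> (real \<Rightarrow> 'a l2 \<Rightarrow> 'a l2) \<Rightarrow> bool" where
  "max_regularity \<Omega> S \<longleftrightarrow> (\<exists>c1 c2. \<forall>T>0.
     (\<forall>f\<in>time_L2 (L2 \<Omega>) T. convol S f \<in> X_space \<Omega> T \<and>
        X_norm \<Omega> T (convol S f) \<le> c1 * time_L2_norm T f) \<and>
     (\<forall>v\<in>V_space \<Omega>. (\<lambda>t. S t v) \<in> X_space \<Omega> T \<and>
        X_norm \<Omega> T (\<lambda>t. S t v) \<le> c2 * V_norm \<Omega> v))"


section \<open>The nonlinearity and mild solutions\<close>

text \<open>$u^{2n-1}$, meaning $|u|^{2n-2}u$.\<close>

definition signed_power :: "real \<Rightarrow> 'a::euclidean_space l2 \<Rightarrow> 'a \<Rightarrow> real" where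
  "signed_power n u x = \<bar>l2_fun u x\<bar> powr (2 * n - 2) * l2_fun u x"

definition F_dom :: "'a::euclidean_space set \<Rightarrow> real \<Rightarrow> 'a l2 set" where
  "F_dom \<Omega> n = {u \<in> V_space \<Omega>. integrable lborel (\<lambda>x. \<bar>l2_fun u x\<bar> powr (2 * n)) \<and>
     sq_integrable (signed_power n u)}"

definition F_op :: "'a::euclidean_space set \<Rightarrow> real \<Rightarrow> 'a l2 \<Rightarrow> 'a l2" where
  "F_op \<Omega> n u = (H02_norm \<Omega> u)\<^sup>2 *\<^sub>R u + (2 * (H01_norm \<Omega> u)\<^sup>2) *\<^sub>R u
     + (\<integral>x. \<bar>l2_fun u x\<bar> powr (2 * n) \<partial>lborel) *\<^sub>R u - l2_of (signed_power n u)"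

text \<open>
  In high dimension $F$ need not be defined on all of \<open>V_space \<Omega>\<close>. For the integral in the mild
  formulation to be meaningful we ask that, on each $[0,t]$, \<open>u p\<close> lies in the domain of $F$ for a.e.
  \<open>p\<close> and that $F \circ u$ is Bochner integrable. (Lebesgue integrals of non-integrable functions
  are 0 in the library, so this has to be stated.)
\<close>

definition mild_solution :: "'a::euclidean_space set \<Rightarrow> real \<Rightarrow> (real \<Rightarrow> 'a l2 \<Rightarrow> 'a l2)
    \<Rightarrow> 'a l2 \<Rightarrow> real \<Rightarrow> (real \<Rightarrow> 'a l2) \<Rightarrow> bool" where
  "mild_solution \<Omega> n S u0 T u \<longleftrightarrow> (\<forall>t\<in>{0..<T}.
     u \<in> X_space \<Omega> t \<and>
     (AE p in lebesgue_on {0..t}. u p \<in> F_dom \<Omega> n) \<and>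
     integrable (lebesgue_on {0..t}) (\<lambda>p. F_op \<Omega> n (u p)) \<and>
     u t = S t u0 + convol S (\<lambda>p. F_op \<Omega> n (u p)) t)"

end

theory Submission
  imports Defs
begin

text \<open>
  Write $\varphi(t) = |u(t)|^2$, $D(u) = \|\Delta u\|^2 + 2 \|\nabla u\|^2$ and
  $L(u) = \int |u|^{2n}$. On the domain of $A$ one has $\langle Au, u\rangle = D(u)$, and
  $\langle F(u), u\rangle = (D(u) + L(u)) |u|^2 - L(u)$. So formally
  $$\tfrac12 \varphi' = \langle -Au + F(u), u\rangle = (D(u) + L(u)) (\varphi - 1) ,$$
  which is a linear homogeneous equation for $\psi = \varphi - 1$. Since $\psi(0) = 0$, Gronwall's
  argument (\<open>linear_integral_equation_zero\<close>) gives $\psi = 0$. Two points need work.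

  The first is the energy identity for a mild solution. The semigroup orbits are differentiable for
  $t > 0$ and take values in the domain of the nonnegative operator $A$, so \<open>S\<close> is a contraction
  semigroup. Testing Duhamel's formula with $e \in D(A)$, and using Fubini and the symmetry of $A$,
  yields $\langle u(t), e\rangle = \langle u_0, e\rangle + \int_0^t \langle F(u) - Au, e\rangle$
  (\<open>mild_imp_weak\<close>). As the domain of $A$ is dense, this holds for all \<open>e\<close> in $L^2(\Omega)$, and
  summing the increments of $|u|^2$ over fine partitions gives the energy identity
  (\<open>energy_identity\<close>).

  The second is that the coefficient $D(u) + L(u)$ must be integrable in time: $\psi(t) = t$ solves
  $\psi' = \psi / t$ with $\psi(0) = 0$. For $D(u) = \langle Au, u\rangle$ this follows from
  $Au \in L^2(0,t;L^2)$, but in high dimensions $L(u)$ is not bounded by the norm of $H^2$, and what is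
  known is only that $F(u)$ is integrable in time. The way out is a Pohozaev identity
  (\<open>pohozaev_identity\<close>): testing $|u|^{2n-2} u$ with $x_b \partial_b u$ gives
  $-L(u) / 2n$. Hence
  $$\langle F(u) - D(u) u, \, u + 2 x_b \partial_b u \rangle = - (1 - 1/n) L(u) ,$$
  where the right factor on the left is bounded in time because $\Omega$ is bounded and $u$ is
  continuous in $H^1$. So for $n \ne 1$ the function $L(u)$ is integrable (and measurable)
  in time; for $n = 1$ it is $|u|^2$.

  All computations with weak derivatives rest on their uniqueness. This comes from the density of the
  domain of $A$ in $L^2(\Omega)$: it lies in $H^1_0(\Omega)$, so the test functions are
  dense in $L^2(\Omega)$ as well.
\<close>

section \<open>Integration by parts for compactly supported functions\<close>

lemma integrable_continuous_compact_support:
  fixes f :: "'a::euclidean_space \<Rightarrow> real"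
  assumes "continuous_on UNIV f" "compact K" "\<And>x. x \<notin> K \<Longrightarrow> f x = 0"
  shows "integrable lborel f"
proof -
  have "integrable lborel (\<lambda>x. indicator K x *\<^sub>R f x)"
    using assms by (intro borel_integrable_compact continuous_on_subset[OF assms(1)]) auto
  moreover have "(\<lambda>x. indicator K x *\<^sub>R f x) = f"
    using assms(3) by (auto simp: indicator_def fun_eq_iff)
  ultimately show ?thesis by simp
qed

text \<open>
  By translation invariance of Lebesgue measure the difference quotients of \<open>f\<close> in the direction \<open>b\<close>
  have integral 0. They converge to \<open>f'\<close> and, by the mean value theorem, are dominated by a
  constant on a fixed ball.
\<close>

lemma integral_directional_derivative_eq_0:
  fixes f f' :: "'a::euclidean_space \<Rightarrow> real"
  assumes cont: "continuous_on UNIV f" and cont': "continuous_on UNIV f'"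
    and K: "compact K" "\<And>x. x \<notin> K \<Longrightarrow> f x = 0"
    and deriv: "\<And>x. ((\<lambda>s. f (x + s *\<^sub>R b)) has_real_derivative f' x) (at 0)"
  shows "integral\<^sup>L lborel f' = 0"
proof -
  have [measurable]: "f \<in> borel_measurable borel" "f' \<in> borel_measurable borel"
    using cont cont' by (auto intro: borel_measurable_continuous_onI)
  have deriv_at: "((\<lambda>s. f (x + s *\<^sub>R b)) has_real_derivative f' (x + t *\<^sub>R b)) (at t)" for x t
  proof -
    have "((\<lambda>s. f ((x + t *\<^sub>R b) + (s - t) *\<^sub>R b)) has_real_derivative f' (x + t *\<^sub>R b) * 1) (at t)"
      by (rule DERIV_chain2[where g="\<lambda>s. s - t" and f="\<lambda>s. f ((x + t *\<^sub>R b) + s *\<^sub>R b)"])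
        (auto intro!: derivative_eq_intros deriv)
    then show ?thesis by (simp add: algebra_simps)
  qed
  obtain R where R: "\<And>x. x \<in> K \<Longrightarrow> norm x \<le> R"
    using compact_imp_bounded[OF K(1)] by (auto simp: bounded_iff)
  \<comment> \<open>For steps \<open>e k \<le> 1\<close> the difference quotients vanish outside \<open>C\<close>, and the intermediate points of
    the mean value theorem at points of \<open>C\<close> lie in \<open>C2\<close>.\<close>
  define C where "C = cball (0::'a) (R + norm b)"
  have "compact C" by (simp add: C_def)
  define C2 where "C2 = cball (0::'a) (R + 2 * norm b)"
  have "compact (f' ` C2)"
    by (intro compact_continuous_image continuous_on_subset[OF cont'])
      (auto simp: C2_def)
  then obtain B where B: "\<And>x. x \<in> C2 \<Longrightarrow> \<bar>f' x\<bar> \<le> B"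
    using compact_imp_bounded by (force simp: bounded_iff)
  define e where "e k = inverse (real (Suc k))" for k
  have e: "0 < e k" "e k \<le> 1" for k
    by (simp_all add: e_def field_simps)
  have ne: "e k \<noteq> 0" for k
    using e(1)[of k] by simp
  have e0: "e \<longlonglongrightarrow> 0"
    unfolding e_def by (rule LIMSEQ_inverse_real_of_nat)
  define q where "q k x = (f (x + e k *\<^sub>R b) - f x) / e k" for k x
  have intf: "integrable lborel f"
    by (rule integrable_continuous_compact_support[OF cont K])
  have shift: "integrable lborel (\<lambda>x. f (x + c)) \<and> (\<integral>x. f (x + c) \<partial>lborel) = integral\<^sup>L lborel f" for c
  proof -
    have "integrable (distr lborel borel ((+) c)) f"
      using intf by (simp add: lborel_distr_plus)
    then have "integrable lborel (\<lambda>x. f (c + x))"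
      by (subst (asm) integrable_distr_eq) auto
    moreover have "integral\<^sup>L (distr lborel borel ((+) c)) f = (\<integral>x. f (c + x) \<partial>lborel)"
      by (subst integral_distr) auto
    ultimately show ?thesis by (simp add: lborel_distr_plus add.commute)
  qed
  have q0: "integral\<^sup>L lborel (q k) = 0" for k
    unfolding q_def using shift[of "e k *\<^sub>R b"] intf by simp
  have "(\<lambda>k. integral\<^sup>L lborel (q k)) \<longlonglongrightarrow> integral\<^sup>L lborel f'"
  proof (rule integral_dominated_convergence)
    show "integrable lborel (\<lambda>x. indicator C x *\<^sub>R B)"
      by (rule borel_integrable_compact[OF \<open>compact C\<close>]) auto
    show "AE x in lborel. (\<lambda>k. q k x) \<longlonglongrightarrow> f' x"
    proof (rule AE_I2)
      fix x
      have "((\<lambda>s. (f (x + s *\<^sub>R b) - f x) / s) \<longlongrightarrow> f' x) (at 0)"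
        using deriv[of x] by (simp add: DERIV_def)
      then show "(\<lambda>k. q k x) \<longlonglongrightarrow> f' x"
        unfolding q_def
        by (rule filterlim_compose) (use e0 ne in \<open>auto simp: filterlim_at\<close>)
    qed
    show "AE x in lborel. norm (q k x) \<le> indicator C x *\<^sub>R B" for k
    proof (rule AE_I2)
      fix x
      have n: "norm (e k *\<^sub>R b) \<le> norm b"
        using e[of k] by (simp add: mult_left_le_one_le)
      show "norm (q k x) \<le> indicator C x *\<^sub>R B"
      proof (cases "x \<in> C")
        case True
        obtain z where z: "0 < z" "z < e k" "f (x + e k *\<^sub>R b) - f (x + 0 *\<^sub>R b) = (e k - 0) * f' (x + z *\<^sub>R b)"
          using MVT2[OF e(1)[of k], of "\<lambda>s. f (x + s *\<^sub>R b)" "\<lambda>s. f' (x + s *\<^sub>R b)"] deriv_at by blast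
        have "norm (x + z *\<^sub>R b) \<le> norm x + norm (z *\<^sub>R b)" by (rule norm_triangle_ineq)
        also have "\<dots> \<le> R + norm b + norm b"
          using True z e(2)[of k] by (intro add_mono) (auto simp: C_def mult_left_le_one_le)
        finally have "x + z *\<^sub>R b \<in> C2" by (simp add: C2_def)
        then show ?thesis
          using True z(3) e(1)[of k] B by (simp add: q_def)
      next
        case False
        have "x \<notin> K" "x + e k *\<^sub>R b \<notin> K"
        proof -
          have "norm x \<le> norm (x + e k *\<^sub>R b) + norm (e k *\<^sub>R b)"
            using norm_triangle_ineq4[of "x + e k *\<^sub>R b" "e k *\<^sub>R b"] by simp
          then show "x + e k *\<^sub>R b \<notin> K"
            using False n R[of "x + e k *\<^sub>R b"] by (auto simp: C_def)
          show "x \<notin> K" using False R[of x] norm_ge_zero[of b] by (force simp: C_def)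
        qed
        then show ?thesis using False K(2) by (simp add: q_def)
      qed
    qed
  qed (auto simp: q_def[abs_def])
  then show ?thesis
    using q0 by (simp add: LIMSEQ_const_iff)
qed

section \<open>Test functions\<close>

lemma sq_integrable_continuous_compact_support:
  fixes f :: "'a::euclidean_space \<Rightarrow> real"
  assumes "continuous_on UNIV f" "compact K" "\<And>x. x \<notin> K \<Longrightarrow> f x = 0"
  shows "sq_integrable f"
  unfolding sq_integrable_def
proof
  show "f \<in> borel_measurable lborel"
    using assms(1) by (auto intro: borel_measurable_continuous_onI)
  show "integrable lborel (\<lambda>x. (f x)\<^sup>2)"
    by (rule integrable_continuous_compact_support[OF _ assms(2)])
      (use assms in \<open>auto intro!: continuous_intros\<close>)
qed

context
  fixes \<Omega> :: "'a::euclidean_space set" and \<phi> :: "'a \<Rightarrow> real"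
  assumes test: "test_function \<Omega> \<phi>"
begin

lemma test_function_continuous: "continuous_on UNIV \<phi>"
  using test unfolding test_function_def smooth_on_def by (metis Ck_on.simps(1))

lemma test_function_differentiable: "\<phi> differentiable (at x)"
  using test unfolding test_function_def smooth_on_def by (metis Ck_on.simps(2) UNIV_I)

lemma test_function_partial_continuous:
  "b \<in> Basis \<Longrightarrow> continuous_on UNIV (\<lambda>x. frechet_derivative \<phi> (at x) b)"
  using test unfolding test_function_def smooth_on_def by (metis Ck_on.simps)

lemma test_function_compact_support: "compact (closure {x. \<phi> x \<noteq> 0})" "closure {x. \<phi> x \<noteq> 0} \<subseteq> \<Omega>"
  using test by (auto simp: test_function_def)

lemma test_function_eq_0: "x \<notin> closure {x. \<phi> x \<noteq> 0} \<Longrightarrow> \<phi> x = 0"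
  using closure_subset[of "{x. \<phi> x \<noteq> 0}"] by blast

lemma test_function_partial_eq_0:
  assumes "x \<notin> closure {x. \<phi> x \<noteq> 0}"
  shows "frechet_derivative \<phi> (at x) b = 0"
proof -
  have "((\<lambda>x. 0) has_derivative (\<lambda>x. 0)) (at x)" by simp
  then have "(\<phi> has_derivative (\<lambda>x. 0)) (at x)"
    by (rule has_derivative_transform_within_open[where s="- closure {x. \<phi> x \<noteq> 0}"])
      (use assms in \<open>auto dest: test_function_eq_0\<close>)
  then have "frechet_derivative \<phi> (at x) = (\<lambda>x. 0)"
    by (rule frechet_derivative_at[symmetric])
  then show ?thesis by simp
qed

lemma test_function_directional_derivative:
  "((\<lambda>s. \<phi> (x + s *\<^sub>R b)) has_real_derivative frechet_derivative \<phi> (at x) b) (at 0)"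
proof -
  have "(\<phi> has_derivative frechet_derivative \<phi> (at x)) (at (x + 0 *\<^sub>R b))"
    using test_function_differentiable by (simp add: frechet_derivative_works)
  then have "((\<lambda>s. \<phi> (x + s *\<^sub>R b)) has_derivative (\<lambda>s. frechet_derivative \<phi> (at x) (s *\<^sub>R b))) (at 0)"
    by (intro has_derivative_compose[where f="\<lambda>s. x + s *\<^sub>R b" and g=\<phi>])
      (auto intro!: derivative_eq_intros)
  moreover have "frechet_derivative \<phi> (at x) (s *\<^sub>R b) = frechet_derivative \<phi> (at x) b * s" for s
    using linear_frechet_derivative[OF test_function_differentiable]
    by (simp add: linear_cmul mult.commute)
  ultimately show ?thesis by (simp add: has_field_derivative_def mult_commute_abs)
qed

lemma test_function_sq_integrable: "sq_integrable \<phi>"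
  by (rule sq_integrable_continuous_compact_support[OF test_function_continuous test_function_compact_support(1)])
    (rule test_function_eq_0)

lemma test_function_partial_sq_integrable:
  "b \<in> Basis \<Longrightarrow> sq_integrable (\<lambda>x. frechet_derivative \<phi> (at x) b)"
  by (rule sq_integrable_continuous_compact_support[OF test_function_partial_continuous
        test_function_compact_support(1)]) (auto intro: test_function_partial_eq_0)

end

lemma l2_of_in_L2:
  assumes "sq_integrable f" "\<And>x. x \<notin> \<Omega> \<Longrightarrow> f x = 0"
  shows "l2_of f \<in> L2 \<Omega>"
  unfolding L2_def mem_Collect_eq using l2_fun_of[OF assms(1)]
  by eventually_elim (use assms(2) in auto)

lemma test_function_in_L2:
  assumes "test_function \<Omega> \<phi>"
  shows "l2_of \<phi> \<in> L2 \<Omega>"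
proof (rule l2_of_in_L2[OF test_function_sq_integrable[OF assms]])
  show "\<phi> x = 0" if "x \<notin> \<Omega>" for x
    using that test_function_compact_support(2)[OF assms] by (intro test_function_eq_0[OF assms]) auto
qed

lemma test_function_partial_in_L2:
  assumes "test_function \<Omega> \<phi>" "b \<in> Basis"
  shows "l2_of (\<lambda>x. frechet_derivative \<phi> (at x) b) \<in> L2 \<Omega>"
proof (rule l2_of_in_L2[OF test_function_partial_sq_integrable[OF assms]])
  show "frechet_derivative \<phi> (at x) b = 0" if "x \<notin> \<Omega>" for x
    using that test_function_compact_support(2)[OF assms(1)]
    by (intro test_function_partial_eq_0[OF assms(1)]) auto
qed

lemma subspace_L2: "subspace (L2 \<Omega>)"
proof (rule subspaceI)
  show "0 \<in> L2 \<Omega>"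
    unfolding L2_def using l2_fun_zero by auto
  fix u v :: "'a l2" and c :: real assume u: "u \<in> L2 \<Omega>" and v: "v \<in> L2 \<Omega>"
  show "u + v \<in> L2 \<Omega>"
    using u v unfolding L2_def mem_Collect_eq
    using l2_fun_add[of u v] by eventually_elim auto
  show "c *\<^sub>R u \<in> L2 \<Omega>"
    using u unfolding L2_def mem_Collect_eq
    using l2_fun_scaleR[of c u] by eventually_elim auto
qed

lemma inner_l2_of:
  assumes "sq_integrable f"
  shows "inner u (l2_of f) = (\<integral>x. l2_fun u x * f x \<partial>lborel)"
  unfolding inner_l2_def
proof (rule integral_cong_AE)
  show "AE x in lborel. l2_fun u x * l2_fun (l2_of f) x = l2_fun u x * f x"
    using l2_fun_of[OF assms] by eventually_elim simp
qed (use assms in measurable)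

lemma inner_l2_of_l2_of:
  assumes "sq_integrable f" "sq_integrable g"
  shows "inner (l2_of f) (l2_of g) = (\<integral>x. f x * g x \<partial>lborel)"
  unfolding inner_l2_of[OF assms(2)]
proof (rule integral_cong_AE)
  show "AE x in lborel. l2_fun (l2_of f) x * g x = f x * g x"
    using l2_fun_of[OF assms(1)] by eventually_elim simp
qed (use assms in measurable)

text \<open>
  The product of the two functions is compactly supported, so its partial derivative has integral 0.
\<close>

lemma test_function_integral_by_parts:
  assumes \<phi>: "test_function \<Omega> \<phi>" and \<eta>: "test_function \<Omega>' \<eta>" and b: "b \<in> Basis"
  shows "(\<integral>x. \<phi> x * frechet_derivative \<eta> (at x) b \<partial>lborel)
    = - (\<integral>x. frechet_derivative \<phi> (at x) b * \<eta> x \<partial>lborel)"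
proof -
  have "(\<integral>x. \<phi> x * frechet_derivative \<eta> (at x) b + frechet_derivative \<phi> (at x) b * \<eta> x \<partial>lborel) = 0"
  proof (rule integral_directional_derivative_eq_0[where f="\<lambda>x. \<phi> x * \<eta> x" and b=b
        and K="closure {x. \<phi> x \<noteq> 0}"])
    fix x show "((\<lambda>s. \<phi> (x + s *\<^sub>R b) * \<eta> (x + s *\<^sub>R b)) has_real_derivative
       \<phi> x * frechet_derivative \<eta> (at x) b + frechet_derivative \<phi> (at x) b * \<eta> x) (at 0)"
      by (rule DERIV_cong[OF DERIV_mult[OF test_function_directional_derivative[OF \<phi>]
            test_function_directional_derivative[OF \<eta>]]]) simp
  next
    show "continuous_on UNIV (\<lambda>x. \<phi> x * \<eta> x)"
      by (intro continuous_intros test_function_continuous[OF \<phi>] test_function_continuous[OF \<eta>])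
    show "continuous_on UNIV (\<lambda>x. \<phi> x * frechet_derivative \<eta> (at x) b + frechet_derivative \<phi> (at x) b * \<eta> x)"
      by (intro continuous_intros test_function_continuous[OF \<phi>] test_function_continuous[OF \<eta>]
          test_function_partial_continuous[OF \<phi> b] test_function_partial_continuous[OF \<eta> b])
    show "compact (closure {x. \<phi> x \<noteq> 0})"
      by (rule test_function_compact_support(1)[OF \<phi>])
    show "\<phi> x * \<eta> x = 0" if "x \<notin> closure {x. \<phi> x \<noteq> 0}" for x
      using test_function_eq_0[OF \<phi> that] by simp
  qed
  moreover have "integrable lborel (\<lambda>x. \<phi> x * frechet_derivative \<eta> (at x) b)"
    by (intro sq_integrable_mult test_function_sq_integrable[OF \<phi>]
        test_function_partial_sq_integrable[OF \<eta> b])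
  moreover have "integrable lborel (\<lambda>x. frechet_derivative \<phi> (at x) b * \<eta> x)"
    by (intro sq_integrable_mult test_function_sq_integrable[OF \<eta>]
        test_function_partial_sq_integrable[OF \<phi> b])
  ultimately show ?thesis by simp
qed

lemma has_weak_partial_iff:
  assumes b: "b \<in> Basis"
  shows "has_weak_partial \<Omega> b u v \<longleftrightarrow> u \<in> L2 \<Omega> \<and> v \<in> L2 \<Omega> \<and> (\<forall>\<phi>. test_function \<Omega> \<phi> \<longrightarrow>
    inner u (l2_of (\<lambda>x. frechet_derivative \<phi> (at x) b)) = - inner v (l2_of \<phi>))"
  unfolding has_weak_partial_def
  using b by (auto simp: inner_l2_of test_function_sq_integrable test_function_partial_sq_integrable)

lemma has_weak_partial_test_function:
  assumes "test_function \<Omega> \<phi>" "b \<in> Basis"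
  shows "has_weak_partial \<Omega> b (l2_of \<phi>) (l2_of (\<lambda>x. frechet_derivative \<phi> (at x) b))"
  unfolding has_weak_partial_iff[OF assms(2)]
proof (intro conjI allI impI)
  show "l2_of \<phi> \<in> L2 \<Omega>" "l2_of (\<lambda>x. frechet_derivative \<phi> (at x) b) \<in> L2 \<Omega>"
    using assms by (simp_all add: test_function_in_L2 test_function_partial_in_L2)
  fix \<eta> assume \<eta>: "test_function \<Omega> \<eta>"
  note sq = test_function_sq_integrable test_function_partial_sq_integrable[OF _ assms(2)]
  show "inner (l2_of \<phi>) (l2_of (\<lambda>x. frechet_derivative \<eta> (at x) b)) =
         - inner (l2_of (\<lambda>x. frechet_derivative \<phi> (at x) b)) (l2_of \<eta>)"
    using test_function_integral_by_parts[OF assms(1) \<eta> assms(2)] assms \<eta>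
    by (simp add: inner_l2_of_l2_of test_function_sq_integrable test_function_partial_sq_integrable)
qed

section \<open>Weak derivatives\<close>

lemma H01_sobolev: "u \<in> H01 \<Omega> \<Longrightarrow> u \<in> sobolev \<Omega> (Suc 0)"
  by (simp add: H01_def)

lemma sobolev_L2: "u \<in> sobolev \<Omega> k \<Longrightarrow> u \<in> L2 \<Omega>"
  by (cases k) auto

lemma V_space_L2: "u \<in> V_space \<Omega> \<Longrightarrow> u \<in> L2 \<Omega>"
  by (auto simp: V_space_def dest: sobolev_L2)

lemma V_space_sobolev1: "u \<in> V_space \<Omega> \<Longrightarrow> u \<in> sobolev \<Omega> (Suc 0)"
  by (auto simp: V_space_def dest: H01_sobolev)

lemma H01_test_function_approximation:
  assumes "u \<in> H01 \<Omega>"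
  obtains \<Phi> where "\<And>k. test_function \<Omega> (\<Phi> k)" "(\<lambda>k. l2_of (\<Phi> k)) \<longlonglongrightarrow> u"
    "(\<lambda>k. H01_norm \<Omega> (u - l2_of (\<Phi> k))) \<longlonglongrightarrow> 0"
proof -
  have "\<exists>\<phi>. test_function \<Omega> \<phi> \<and>
     (norm (u - l2_of \<phi>))\<^sup>2 + (H01_norm \<Omega> (u - l2_of \<phi>))\<^sup>2 < ((1/2)^k)\<^sup>2" for k :: nat
    using assms unfolding H01_def by auto
  then obtain \<Phi> where \<Phi>: "\<And>k. test_function \<Omega> (\<Phi> k)"
    "\<And>k. (norm (u - l2_of (\<Phi> k)))\<^sup>2 + (H01_norm \<Omega> (u - l2_of (\<Phi> k)))\<^sup>2 < ((1/2)^k)\<^sup>2"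
    by metis
  have lim: "(\<lambda>k. (1/2::real) ^ k) \<longlonglongrightarrow> 0" by (rule LIMSEQ_power_zero) simp
  have sq: "(norm (u - l2_of (\<Phi> k)))\<^sup>2 \<le> ((1/2)^k)\<^sup>2" "(H01_norm \<Omega> (u - l2_of (\<Phi> k)))\<^sup>2 \<le> ((1/2)^k)\<^sup>2" for k
    using \<Phi>(2)[of k] zero_le_power2[of "norm (u - l2_of (\<Phi> k))"]
      zero_le_power2[of "H01_norm \<Omega> (u - l2_of (\<Phi> k))"] by linarith+
  have le: "norm (u - l2_of (\<Phi> k)) \<le> (1/2)^k" "H01_norm \<Omega> (u - l2_of (\<Phi> k)) \<le> (1/2)^k" for k
    using sq[of k] by (auto intro: power2_le_imp_le)
  have "(\<lambda>k. l2_of (\<Phi> k) - u) \<longlonglongrightarrow> 0"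
    by (rule Lim_null_comparison[OF always_eventually lim]) (simp add: le norm_minus_commute)
  then have "(\<lambda>k. l2_of (\<Phi> k)) \<longlonglongrightarrow> u"
    by (rule LIM_zero_cancel)
  moreover have "(\<lambda>k. H01_norm \<Omega> (u - l2_of (\<Phi> k))) \<longlonglongrightarrow> 0"
    by (rule Lim_null_comparison[OF always_eventually lim])
      (use le in \<open>auto simp: H01_norm_def sum_nonneg\<close>)
  ultimately show ?thesis
    by (rule that[OF \<Phi>(1)])
qed

lemma norm_weak_partial_le_H01_norm:
  assumes "b \<in> Basis" shows "norm (weak_partial \<Omega> b u) \<le> H01_norm \<Omega> u"
proof -
  have "(norm (weak_partial \<Omega> b u))\<^sup>2 \<le> (\<Sum>b\<in>Basis. (norm (weak_partial \<Omega> b u))\<^sup>2)"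
    using assms by (intro member_le_sum) auto
  then show ?thesis unfolding H01_norm_def by (rule real_le_rsqrt)
qed

lemma has_weak_partial_diff:
  assumes b: "b \<in> Basis" and u: "has_weak_partial \<Omega> b u v" and u': "has_weak_partial \<Omega> b u' v'"
  shows "has_weak_partial \<Omega> b (u - u') (v - v')"
  using u u' unfolding has_weak_partial_iff[OF b]
  by (auto simp: inner_diff_left subspace_diff subspace_L2)

text \<open>
  The density of $H^1_0(\Omega)$ makes the test functions total in $L^2(\Omega)$, which is what makes
  weak derivatives unique, so that the definite description \<open>weak_partial\<close> can be computed.
\<close>

locale dense_H01 =
  fixes \<Omega> :: "'a::euclidean_space set"
  assumes L2_subset_closure: "L2 \<Omega> \<subseteq> closure (H01 \<Omega>)"
begin

lemma L2_orthogonal_test_functions: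
  assumes v: "v \<in> L2 \<Omega>" and orth: "\<And>\<phi>. test_function \<Omega> \<phi> \<Longrightarrow> inner v (l2_of \<phi>) = 0"
  shows "v = 0"
proof -
  have "inner v e = 0" if "e \<in> H01 \<Omega>" for e
  proof -
    obtain \<Phi> where \<Phi>: "\<And>k. test_function \<Omega> (\<Phi> k)" "(\<lambda>k. l2_of (\<Phi> k)) \<longlonglongrightarrow> e"
      using H01_test_function_approximation[OF \<open>e \<in> H01 \<Omega>\<close>] by blast
    have "(\<lambda>k. inner v (l2_of (\<Phi> k))) \<longlonglongrightarrow> inner v e"
      by (intro tendsto_intros \<Phi>)
    then show ?thesis using orth[OF \<Phi>(1)] by (simp add: LIMSEQ_const_iff)
  qed
  moreover obtain e where "\<And>k. e k \<in> H01 \<Omega>" "e \<longlonglongrightarrow> v"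
    using v L2_subset_closure closure_sequential[of v "H01 \<Omega>"] by blast
  then have "(\<lambda>k. inner v (e k)) \<longlonglongrightarrow> inner v v"
    by (intro tendsto_intros)
  ultimately have "inner v v = 0"
    using \<open>\<And>k. e k \<in> H01 \<Omega>\<close> by (simp add: LIMSEQ_const_iff)
  then show ?thesis by simp
qed

lemma weak_partial_eqI:
  assumes b: "b \<in> Basis" and v: "has_weak_partial \<Omega> b u v"
  shows "weak_partial \<Omega> b u = v"
  unfolding weak_partial_def
proof (rule the_equality)
  show "has_weak_partial \<Omega> b u v" by (rule v)
next
  fix v' assume "has_weak_partial \<Omega> b u v'"
  with v have "v' - v = 0"
    unfolding has_weak_partial_iff[OF b]
    by (intro L2_orthogonal_test_functions) (auto simp: subspace_diff subspace_L2 inner_diff_left)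
  then show "v' = v" by simp
qed

lemma
  assumes "u \<in> sobolev \<Omega> (Suc k)" "b \<in> Basis"
  shows has_weak_partial_weak_partial: "has_weak_partial \<Omega> b u (weak_partial \<Omega> b u)"
    and weak_partial_in_sobolev: "weak_partial \<Omega> b u \<in> sobolev \<Omega> k"
proof -
  obtain v where "has_weak_partial \<Omega> b u v" "v \<in> sobolev \<Omega> k"
    using assms by auto
  then show "has_weak_partial \<Omega> b u (weak_partial \<Omega> b u)" "weak_partial \<Omega> b u \<in> sobolev \<Omega> k"
    using weak_partial_eqI[OF assms(2)] by auto
qed

lemma weak_partial_diff:
  assumes "u \<in> sobolev \<Omega> (Suc 0)" "v \<in> sobolev \<Omega> (Suc 0)" "b \<in> Basis"
  shows "weak_partial \<Omega> b (u - v) = weak_partial \<Omega> b u - weak_partial \<Omega> b v"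
  using has_weak_partial_diff[OF assms(3) has_weak_partial_weak_partial[OF assms(1,3)]
      has_weak_partial_weak_partial[OF assms(2,3)]]
  by (rule weak_partial_eqI[OF assms(3)])

lemma laplace_in_L2:
  assumes "u \<in> sobolev \<Omega> 2" shows "laplace \<Omega> u \<in> L2 \<Omega>"
  unfolding laplace_def
proof (rule subspace_sum[OF subspace_L2])
  fix b :: 'a assume b: "b \<in> Basis"
  have "u \<in> sobolev \<Omega> (Suc (Suc 0))" using assms by (simp only: numeral_2_eq_2)
  from weak_partial_in_sobolev[OF this b]
  have "weak_partial \<Omega> b (weak_partial \<Omega> b u) \<in> sobolev \<Omega> 0"
    by (rule weak_partial_in_sobolev) (rule b)
  then show "weak_partial \<Omega> b (weak_partial \<Omega> b u) \<in> L2 \<Omega>" by simp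
qed

lemma H01_test_function_approximation_partial:
  assumes v: "v \<in> H01 \<Omega>" and b: "b \<in> Basis"
  obtains \<Phi> where "\<And>k. test_function \<Omega> (\<Phi> k)" "(\<lambda>k. l2_of (\<Phi> k)) \<longlonglongrightarrow> v"
    "(\<lambda>k. l2_of (\<lambda>x. frechet_derivative (\<Phi> k) (at x) b)) \<longlonglongrightarrow> weak_partial \<Omega> b v"
proof -
  obtain \<Phi> where \<Phi>: "\<And>k. test_function \<Omega> (\<Phi> k)" "(\<lambda>k. l2_of (\<Phi> k)) \<longlonglongrightarrow> v"
    and lim: "(\<lambda>k. H01_norm \<Omega> (v - l2_of (\<Phi> k))) \<longlonglongrightarrow> 0"
    using H01_test_function_approximation[OF v] by blast
  have "weak_partial \<Omega> b (v - l2_of (\<Phi> k))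
    = weak_partial \<Omega> b v - l2_of (\<lambda>x. frechet_derivative (\<Phi> k) (at x) b)" for k
    by (intro weak_partial_eqI has_weak_partial_diff has_weak_partial_test_function \<Phi> b
        has_weak_partial_weak_partial[OF H01_sobolev[OF v]])
  then have le: "norm (weak_partial \<Omega> b v - l2_of (\<lambda>x. frechet_derivative (\<Phi> k) (at x) b))
      \<le> H01_norm \<Omega> (v - l2_of (\<Phi> k))" for k
    by (metis norm_weak_partial_le_H01_norm[OF b])
  have "(\<lambda>k. l2_of (\<lambda>x. frechet_derivative (\<Phi> k) (at x) b) - weak_partial \<Omega> b v) \<longlonglongrightarrow> 0"
    by (rule Lim_null_comparison[OF always_eventually lim]) (simp add: le norm_minus_commute)
  then show ?thesis
    by (rule that[OF \<Phi> LIM_zero_cancel])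
qed

text \<open>
  For test functions this is the definition of the weak derivative; both sides are continuous in \<open>v\<close>
  with respect to the norm of $H^1$.
\<close>

lemma integral_by_parts_H01:
  assumes y: "has_weak_partial \<Omega> b y z" and v: "v \<in> H01 \<Omega>" and b: "b \<in> Basis"
  shows "inner z v = - inner y (weak_partial \<Omega> b v)"
proof -
  obtain \<Phi> where \<Phi>: "\<And>k. test_function \<Omega> (\<Phi> k)" "(\<lambda>k. l2_of (\<Phi> k)) \<longlonglongrightarrow> v"
    and \<Phi>': "(\<lambda>k. l2_of (\<lambda>x. frechet_derivative (\<Phi> k) (at x) b)) \<longlonglongrightarrow> weak_partial \<Omega> b v"
    using H01_test_function_approximation_partial[OF v b] by blast
  have "(\<lambda>k. inner z (l2_of (\<Phi> k))) \<longlonglongrightarrow> inner z v"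
    by (intro tendsto_intros \<Phi>)
  moreover have "inner z (l2_of (\<Phi> k)) = - inner y (l2_of (\<lambda>x. frechet_derivative (\<Phi> k) (at x) b))" for k
    using y \<Phi>(1) by (simp add: has_weak_partial_iff[OF b])
  then have "(\<lambda>k. inner z (l2_of (\<Phi> k))) \<longlonglongrightarrow> - inner y (weak_partial \<Omega> b v)"
    by (auto intro!: tendsto_intros \<Phi>')
  ultimately show ?thesis by (rule LIMSEQ_unique)
qed

text \<open>
  Green's formula without boundary term. Only \<open>v\<close> has to vanish on the boundary, so for two elements of
  \<open>V_space \<Omega>\<close> the Laplacian can be moved from one factor to the other.
\<close>

lemma laplace_green:
  assumes u: "u \<in> sobolev \<Omega> 2" and v: "v \<in> H01 \<Omega>"
  shows "inner (laplace \<Omega> u) v = - (\<Sum>b\<in>Basis. inner (weak_partial \<Omega> b u) (weak_partial \<Omega> b v))"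
proof -
  have "u \<in> sobolev \<Omega> (Suc (Suc 0))" using u by (simp only: numeral_2_eq_2)
  then have "has_weak_partial \<Omega> b (weak_partial \<Omega> b u) (weak_partial \<Omega> b (weak_partial \<Omega> b u))"
    if "b \<in> Basis" for b
    using that by (blast intro: has_weak_partial_weak_partial weak_partial_in_sobolev)
  then show ?thesis
    unfolding laplace_def inner_sum_left sum_negf[symmetric]
    by (intro sum.cong refl integral_by_parts_H01 v)
qed

lemma A_op_in_L2:
  assumes "u \<in> E_space \<Omega>" shows "A_op \<Omega> u \<in> L2 \<Omega>"
  using assms unfolding A_op_def E_space_def V_space_def
  by (auto intro!: subspace_diff subspace_scale subspace_L2 laplace_in_L2)

lemma inner_A_op_self:
  assumes u: "u \<in> E_space \<Omega>"
  shows "inner (A_op \<Omega> u) u = (H02_norm \<Omega> u)\<^sup>2 + 2 * (H01_norm \<Omega> u)\<^sup>2"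
proof -
  from u have u1: "u \<in> H01 \<Omega>" and u2: "u \<in> sobolev \<Omega> 2"
    and l1: "laplace \<Omega> u \<in> H01 \<Omega>" and l2: "laplace \<Omega> u \<in> sobolev \<Omega> 2"
    by (auto simp: E_space_def V_space_def)
  have "inner (laplace \<Omega> (laplace \<Omega> u)) u = inner (laplace \<Omega> u) (laplace \<Omega> u)"
    unfolding laplace_green[OF l2 u1] laplace_green[OF u2 l1] by (simp add: inner_commute)
  moreover have "inner (laplace \<Omega> u) u = - (H01_norm \<Omega> u)\<^sup>2"
    unfolding laplace_green[OF u2 u1] by (simp add: H01_norm_def sum_nonneg power2_norm_eq_inner)
  ultimately show ?thesis
    by (simp add: A_op_def H02_norm_def inner_diff_left power2_norm_eq_inner)
qed

end

section \<open>Auxiliary facts on the space of square-integrable functions\<close>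

lemma l2_of_cong_AE:
  "sq_integrable f \<Longrightarrow> sq_integrable g \<Longrightarrow> (AE x in lborel. f x = g x) \<Longrightarrow> l2_of f = l2_of g"
  by (simp add: l2_of_eq_iff)

lemma sq_integrable_bound:
  assumes "f \<in> borel_measurable lborel" "sq_integrable g" "AE x in lborel. \<bar>f x\<bar> \<le> \<bar>g x\<bar>"
  shows "sq_integrable f"
  unfolding sq_integrable_def
proof (intro conjI assms(1))
  show "integrable lborel (\<lambda>x. (f x)\<^sup>2)"
  proof (rule Bochner_Integration.integrable_bound)
    show "integrable lborel (\<lambda>x. (g x)\<^sup>2)" using assms(2) by (simp add: sq_integrable_def)
    show "AE x in lborel. norm ((f x)\<^sup>2) \<le> norm ((g x)\<^sup>2)"
      using assms(3) by eventually_elim (simp add: abs_le_square_iff)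
  qed (use assms(1) in measurable)
qed

lemma norm_l2_of_mono:
  assumes "sq_integrable f" "sq_integrable g" "AE x in lborel. \<bar>f x\<bar> \<le> \<bar>g x\<bar>"
  shows "norm (l2_of f) \<le> norm (l2_of g)"
proof (rule power2_le_imp_le)
  show "(norm (l2_of f))\<^sup>2 \<le> (norm (l2_of g))\<^sup>2"
    unfolding norm_l2_of[OF assms(1)] norm_l2_of[OF assms(2)]
  proof (rule integral_mono_AE)
    show "AE x in lborel. (f x)\<^sup>2 \<le> (g x)\<^sup>2"
      using assms(3) by eventually_elim (simp add: abs_le_square_iff)
  qed (use assms in \<open>auto simp: sq_integrable_def\<close>)
qed simp

text \<open>
  Dominated convergence in the norm of $L^2$, with pointwise assumptions almost everywhere only.
\<close>

lemma l2_of_tendsto_dominated: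
  fixes f :: "'a::euclidean_space \<Rightarrow> real"
  assumes s: "\<And>i. s i \<in> borel_measurable lborel" and f: "sq_integrable f" and w: "sq_integrable w"
    and lim: "AE x in lborel. (\<lambda>i. s i x) \<longlonglongrightarrow> f x"
    and bound: "\<And>i. AE x in lborel. \<bar>s i x\<bar> \<le> \<bar>w x\<bar>"
  shows "(\<lambda>i. l2_of (s i)) \<longlonglongrightarrow> l2_of f"
proof -
  have [measurable]: "s i \<in> borel_measurable lborel" "f \<in> borel_measurable lborel" for i
    using s f by (auto simp: sq_integrable_def)
  have s: "sq_integrable (s i)" for i
    by (rule sq_integrable_bound[OF s w bound])
  have dom: "sq_integrable (\<lambda>x. \<bar>w x\<bar> + \<bar>f x\<bar>)" using w f by simp
  have "(\<lambda>i. \<integral>x. (s i x - f x)\<^sup>2 \<partial>lborel) \<longlonglongrightarrow> (\<integral>x. (0 :: real) \<partial>(lborel :: 'a measure))"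
  proof (rule integral_dominated_convergence)
    show "integrable lborel (\<lambda>x. (\<bar>w x\<bar> + \<bar>f x\<bar>)\<^sup>2)"
      using dom unfolding sq_integrable_def by blast
    show "AE x in lborel. (\<lambda>i. (s i x - f x)\<^sup>2) \<longlonglongrightarrow> 0"
      using lim
    proof eventually_elim
      case (elim x)
      have "(\<lambda>i. (s i x - f x)\<^sup>2) \<longlonglongrightarrow> (f x - f x)\<^sup>2"
        by (intro tendsto_intros elim)
      then show ?case by simp
    qed
    show "AE x in lborel. norm ((s i x - f x)\<^sup>2) \<le> (\<bar>w x\<bar> + \<bar>f x\<bar>)\<^sup>2" for i
      using bound[of i]
    proof eventually_elim
      case (elim x)
      then have "\<bar>s i x - f x\<bar> \<le> \<bar>\<bar>w x\<bar> + \<bar>f x\<bar>\<bar>" by linarith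
      then show ?case by (simp only: abs_le_square_iff) simp
    qed
  qed measurable
  then have "(\<lambda>i. (norm (l2_of (s i) - l2_of f))\<^sup>2) \<longlonglongrightarrow> 0"
    by (simp add: s f flip: norm_l2_of l2_of_diff)
  then have "(\<lambda>i. sqrt ((norm (l2_of (s i) - l2_of f))\<^sup>2)) \<longlonglongrightarrow> sqrt 0"
    by (rule tendsto_real_sqrt)
  then show "(\<lambda>i. l2_of (s i)) \<longlonglongrightarrow> l2_of f"
    by (simp add: LIM_zero_iff tendsto_norm_zero_iff)
qed

definition l2_mult :: "('a::euclidean_space \<Rightarrow> real) \<Rightarrow> 'a l2 \<Rightarrow> 'a l2" where
  "l2_mult h u = l2_of (\<lambda>x. h x * l2_fun u x)"

lemma sq_integrable_mult_bounded:
  assumes "h \<in> borel_measurable lborel" "\<And>x. \<bar>h x\<bar> \<le> C" "sq_integrable f"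
  shows "sq_integrable (\<lambda>x. h x * f x)"
proof (rule sq_integrable_bound)
  show "sq_integrable (\<lambda>x. C * f x)" using assms(3) by simp
  show "AE x in lborel. \<bar>h x * f x\<bar> \<le> \<bar>C * f x\<bar>"
    unfolding abs_mult
    by (intro AE_I2 mult_right_mono order_trans[OF assms(2) abs_ge_self]) auto
qed (use assms in measurable)

lemma bounded_linear_l2_mult:
  assumes h: "h \<in> borel_measurable lborel" "\<And>x. \<bar>h x\<bar> \<le> C"
  shows "bounded_linear (l2_mult h)"
proof (rule bounded_linear_intro)
  note sq = sq_integrable_mult_bounded[OF h]
  fix u v :: "'a l2" and c :: real
  show "l2_mult h (u + v) = l2_mult h u + l2_mult h v"
    unfolding l2_mult_def l2_of_add[OF sq[OF l2_fun_sq_integrable] sq[OF l2_fun_sq_integrable], symmetric]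
    by (intro l2_of_cong_AE sq sq_integrable_add l2_fun_sq_integrable
        eventually_mono[OF l2_fun_add[of u v]]) (simp add: algebra_simps)
  show "l2_mult h (c *\<^sub>R u) = c *\<^sub>R l2_mult h u"
    unfolding l2_mult_def l2_of_scaleR[OF sq[OF l2_fun_sq_integrable], symmetric]
    by (intro l2_of_cong_AE sq sq_integrable_scale l2_fun_sq_integrable
        eventually_mono[OF l2_fun_scaleR[of c u]]) (simp add: algebra_simps)
  show "norm (l2_mult h u) \<le> norm u * \<bar>C\<bar>"
  proof -
    have "norm (l2_mult h u) \<le> norm (l2_of (\<lambda>x. C * l2_fun u x))"
      unfolding l2_mult_def
    proof (rule norm_l2_of_mono)
      show "AE x in lborel. \<bar>h x * l2_fun u x\<bar> \<le> \<bar>C * l2_fun u x\<bar>"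
        unfolding abs_mult
        by (intro AE_I2 mult_right_mono order_trans[OF h(2) abs_ge_self]) auto
    qed (simp_all add: sq)
    then show ?thesis by (simp add: l2_of_scaleR mult.commute)
  qed
qed

section \<open>Signed powers\<close>

lemma has_real_derivative_abs_powr:
  fixes n :: real assumes "n > 1 / 2"
  shows "((\<lambda>s. \<bar>s\<bar> powr (2 * n) / (2 * n)) has_real_derivative \<bar>s\<bar> powr (2 * n - 2) * s) (at s)"
proof -
  have split: "t powr (2 * n - 1) = t powr (2 * n - 2) * t" if "t > 0" for t :: real
    using powr_add[of t "2 * n - 2" 1] that by simp
  consider "s > 0" | "s < 0" | "s = 0" by linarith
  then show ?thesis
  proof cases
    case 1
    have "((\<lambda>s. s powr (2 * n) / (2 * n)) has_real_derivative \<bar>s\<bar> powr (2 * n - 2) * s) (at s)"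
      using 1 assms by (auto intro!: derivative_eq_intros simp: split)
    then show ?thesis
      by (rule has_field_derivative_transform_within_open[of _ _ _ "{0<..}"]) (use 1 in auto)
  next
    case 2
    have "((\<lambda>s. (- s) powr (2 * n) / (2 * n)) has_real_derivative \<bar>s\<bar> powr (2 * n - 2) * s) (at s)"
      using 2 assms split[of "- s"] by (auto intro!: derivative_eq_intros)
    then show ?thesis
      by (rule has_field_derivative_transform_within_open[of _ _ _ "{..<0}"]) (use 2 in auto)
  next
    case 3
    have "((\<lambda>h::real. \<bar>h\<bar> powr (2 * n - 1)) \<longlongrightarrow> 0) (at 0)"
    proof -
      have "((\<lambda>h::real. \<bar>h\<bar> powr (2 * n - 1)) \<longlongrightarrow> 0 powr (2 * n - 1)) (at 0)"
        using assms by (intro tendsto_powr' tendsto_eq_intros) auto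
      then show ?thesis by simp
    qed
    then have "((\<lambda>h. (\<bar>h\<bar> powr (2 * n) / (2 * n)) / h) \<longlongrightarrow> 0) (at 0)"
    proof (rule Lim_null_comparison[rotated])
      show "\<forall>\<^sub>F h in at 0. norm (\<bar>h\<bar> powr (2 * n) / (2 * n) / h) \<le> \<bar>h\<bar> powr (2 * n - 1)"
        unfolding eventually_at_filter
      proof (intro always_eventually allI impI)
        fix h :: real assume "h \<noteq> 0"
        then have "\<bar>h\<bar> powr (2 * n) = \<bar>h\<bar> powr (2 * n - 1) * \<bar>h\<bar>"
          using powr_add[of "\<bar>h\<bar>" "2 * n - 1" 1] by simp
        then show "norm (\<bar>h\<bar> powr (2 * n) / (2 * n) / h) \<le> \<bar>h\<bar> powr (2 * n - 1)"
          using assms \<open>h \<noteq> 0\<close> by (simp add: abs_mult divide_le_eq mult_le_cancel_left1)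
      qed
    qed
    then show ?thesis
      using 3 assms by (simp add: DERIV_def)
  qed
qed

lemma abs_signed_power: "\<bar>\<bar>s\<bar> powr (2 * n - 2) * s\<bar> = \<bar>s\<bar> powr (2 * n - 1)" for s n :: real
  using powr_add[of "\<bar>s\<bar>" "2 * n - 2" 1] by (cases "s = 0") (auto simp: abs_mult)

lemma continuous_signed_power:
  fixes n :: real assumes "n > 1 / 2"
  shows "continuous_on UNIV (\<lambda>s::real. \<bar>s\<bar> powr (2 * n - 2) * s)"
proof -
  have "isCont (\<lambda>s. \<bar>s\<bar> powr (2 * n - 2) * s) s" for s :: real
  proof (cases "s = 0")
    case False
    then show ?thesis by (intro continuous_intros) auto
  next
    case True
    have "((\<lambda>h::real. \<bar>h\<bar> powr (2 * n - 1)) \<longlongrightarrow> 0 powr (2 * n - 1)) (at 0)"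
      using assms by (intro tendsto_powr' tendsto_eq_intros) auto
    then have "((\<lambda>h::real. \<bar>h\<bar> powr (2 * n - 2) * h) \<longlongrightarrow> 0) (at 0)"
      by (intro tendsto_rabs_zero_cancel[of "\<lambda>h. \<bar>h\<bar> powr (2 * n - 2) * h"])
        (simp add: abs_signed_power)
    then show ?thesis using True by (simp add: isCont_def)
  qed
  then show ?thesis by (simp add: continuous_on_eq_continuous_at)
qed

lemma continuous_antiderivative:
  fixes g :: "real \<Rightarrow> real"
  assumes "continuous_on UNIV g"
  obtains G where "G 0 = 0" "\<And>s. (G has_real_derivative g s) (at s)"
proof -
  obtain F where F: "\<forall>x :: real. (-\<infinity>::ereal) < x \<longrightarrow> x < (\<infinity>::ereal) \<longrightarrow> (F has_vector_derivative g x) (at x)"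
    using einterval_antiderivative[of "-\<infinity>" "\<infinity>" g] assms by (auto simp: continuous_on_eq_continuous_at)
  show ?thesis
  proof
    show "((\<lambda>s. F s - F 0) has_real_derivative g s) (at s)" for s
      using F by (auto intro!: derivative_eq_intros simp: has_real_derivative_iff_has_vector_derivative)
  qed simp
qed

text \<open>
  \<open>G\<close> is the antiderivative of the truncated power. It has linear growth, so that it maps $L^2$ to
  $L^2$. The two parts are the bound and the pointwise convergence, as \<open>k\<close> grows, for the
  removal of the truncation by dominated convergence.
\<close>

lemma signed_power_antiderivative_truncation:
  fixes n :: real and k :: nat
  assumes n: "n > 1 / 2" and G0: "G 0 = 0"
    and G: "\<And>s. (G has_real_derivative max (- real k) (min (real k) (\<bar>s\<bar> powr (2 * n - 2) * s))) (at s)"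
  shows "\<bar>G s\<bar> \<le> \<bar>s\<bar> powr (2 * n)"
    and "\<bar>s\<bar> powr (2 * n - 1) \<le> k \<Longrightarrow> G s = \<bar>s\<bar> powr (2 * n) / (2 * n)"
proof -
  define p where "p s = \<bar>s\<bar> powr (2 * n - 2) * s" for s :: real
  define g where "g s = max (- real k) (min (real k) (p s))" for s
  \<comment> \<open>The mean value theorem from 0 to \<open>s\<close>, for either sign of \<open>s\<close>.\<close>
  have mvt: "\<exists>\<xi>. \<bar>\<xi>\<bar> \<le> \<bar>s\<bar> \<and> H s = s * h \<xi>"
    if "H 0 = 0" "\<And>s. (H has_real_derivative h s) (at s)" for H h :: "real \<Rightarrow> real" and s
  proof -
    consider "s > 0" | "s < 0" | "s = 0" by linarith
    then show ?thesis
    proof cases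
      case 1
      from MVT2[OF this, of H h] that show ?thesis by force
    next
      case 2
      from MVT2[OF this, of H h] that obtain z where "s < z" "z < 0" "- H s = (0 - s) * h z"
        by auto
      then show ?thesis by (intro exI[of _ z]) auto
    qed (use that in auto)
  qed
  have pm: "\<bar>p \<xi>\<bar> \<le> \<bar>s\<bar> powr (2 * n - 1)" if "\<bar>\<xi>\<bar> \<le> \<bar>s\<bar>" for \<xi>
    unfolding p_def abs_signed_power using that n by (intro powr_mono2) auto
  show "\<bar>G s\<bar> \<le> \<bar>s\<bar> powr (2 * n)"
  proof -
    obtain \<xi> where \<xi>: "\<bar>\<xi>\<bar> \<le> \<bar>s\<bar>" "G s = s * g \<xi>"
      using mvt[of G g s] G0 G unfolding g_def p_def by blast
    have "\<bar>g \<xi>\<bar> \<le> \<bar>p \<xi>\<bar>" unfolding g_def by auto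
    then have "\<bar>G s\<bar> \<le> \<bar>s\<bar> * \<bar>s\<bar> powr (2 * n - 1)"
      using pm[OF \<xi>(1)] \<xi>(2) by (auto simp: abs_mult intro!: mult_left_mono)
    also have "\<dots> = \<bar>s\<bar> powr (2 * n)"
      using powr_add[of "\<bar>s\<bar>" "2 * n - 1" 1] by (cases "s = 0") auto
    finally show ?thesis .
  qed
  show "G s = \<bar>s\<bar> powr (2 * n) / (2 * n)" if s: "\<bar>s\<bar> powr (2 * n - 1) \<le> k"
  proof -
    have "((\<lambda>s. G s - \<bar>s\<bar> powr (2 * n) / (2 * n)) has_real_derivative g s - p s) (at s)" for s
      using G[of s] has_real_derivative_abs_powr[OF n, of s] unfolding g_def p_def
      by (rule DERIV_diff)
    then obtain \<xi> where \<xi>: "\<bar>\<xi>\<bar> \<le> \<bar>s\<bar>" "G s - \<bar>s\<bar> powr (2 * n) / (2 * n) = s * (g \<xi> - p \<xi>)"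
      using mvt[of "\<lambda>s. G s - \<bar>s\<bar> powr (2 * n) / (2 * n)" "\<lambda>s. g s - p s" s] G0 by auto
    have "\<bar>p \<xi>\<bar> \<le> k" using pm[OF \<xi>(1)] s by linarith
    then have "g \<xi> = p \<xi>" unfolding g_def by auto
    then show ?thesis using \<xi>(2) by simp
  qed
qed

section \<open>A Pohozaev identity\<close>

text \<open>
  The integrand on the left plus \<open>G (\<phi> x)\<close> is the derivative of \<open>G (\<phi> x) * inner x b\<close> in the
  direction \<open>b\<close>. The second term arises because \<open>inner x b\<close> has derivative 1 for \<open>b\<close> in \<open>Basis\<close>.
\<close>

lemma test_function_dilation_identity:
  fixes \<phi> :: "'a::euclidean_space \<Rightarrow> real"
  assumes \<phi>: "test_function \<Omega> \<phi>" and b: "b \<in> Basis"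
    and g: "continuous_on UNIV g" and G0: "G 0 = 0"
    and G: "\<And>s. (G has_real_derivative g s) (at s)"
  shows "(\<integral>x. g (\<phi> x) * inner x b * frechet_derivative \<phi> (at x) b \<partial>lborel) = - (\<integral>x. G (\<phi> x) \<partial>lborel)"
proof -
  define K where "K = closure {x. \<phi> x \<noteq> 0}"
  have K: "compact K" "\<And>x. x \<notin> K \<Longrightarrow> \<phi> x = 0" "\<And>x. x \<notin> K \<Longrightarrow> frechet_derivative \<phi> (at x) b = 0"
    unfolding K_def by (rule test_function_compact_support(1)[OF \<phi>], rule test_function_eq_0[OF \<phi>],
        assumption, rule test_function_partial_eq_0[OF \<phi>], assumption)
  have c1: "continuous_on UNIV (\<lambda>x. G (\<phi> x))"
    using continuous_on_compose2[of UNIV G UNIV \<phi>] test_function_continuous[OF \<phi>]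
      DERIV_isCont[OF G] by (auto simp: continuous_on_eq_continuous_at)
  have c2: "continuous_on UNIV (\<lambda>x. g (\<phi> x) * inner x b * frechet_derivative \<phi> (at x) b)"
    using continuous_on_compose2[OF g test_function_continuous[OF \<phi>]]
      test_function_partial_continuous[OF \<phi> b]
    by (intro continuous_intros) auto
  have "(\<integral>x. g (\<phi> x) * inner x b * frechet_derivative \<phi> (at x) b + G (\<phi> x) \<partial>lborel) = 0"
  proof (rule integral_directional_derivative_eq_0[where f="\<lambda>x. G (\<phi> x) * inner x b" and b=b and K=K])
    fix x
    have "((\<lambda>s. inner (x + s *\<^sub>R b) b) has_real_derivative 1) (at 0)"
      using b by (auto intro!: derivative_eq_intros simp: inner_add_left)
    moreover have "((\<lambda>s. G (\<phi> (x + s *\<^sub>R b))) has_real_derivative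
        g (\<phi> x) * frechet_derivative \<phi> (at x) b) (at 0)"
      using DERIV_chain2[of G "g (\<phi> x)" "\<lambda>s. \<phi> (x + s *\<^sub>R b)" 0, OF _ test_function_directional_derivative[OF \<phi>]] G
      by simp
    ultimately show "((\<lambda>s. G (\<phi> (x + s *\<^sub>R b)) * inner (x + s *\<^sub>R b) b) has_real_derivative
        g (\<phi> x) * inner x b * frechet_derivative \<phi> (at x) b + G (\<phi> x)) (at 0)"
      by (intro DERIV_cong[OF DERIV_mult]) auto
  next
    show "continuous_on UNIV (\<lambda>x. G (\<phi> x) * inner x b)"
      using c1 by (intro continuous_intros)
    show "continuous_on UNIV (\<lambda>x. g (\<phi> x) * inner x b * frechet_derivative \<phi> (at x) b + G (\<phi> x))"
      using c1 c2 by (rule continuous_on_add[rotated])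
    show "G (\<phi> x) * inner x b = 0" if "x \<notin> K" for x
      using K(2)[OF that] G0 by simp
  qed (rule K(1))
  moreover have "integrable lborel (\<lambda>x. g (\<phi> x) * inner x b * frechet_derivative \<phi> (at x) b)"
    by (rule integrable_continuous_compact_support[OF c2 K(1)]) (simp add: K)
  moreover have "integrable lborel (\<lambda>x. G (\<phi> x))"
    by (rule integrable_continuous_compact_support[OF c1 K(1)]) (simp add: K G0)
  ultimately show ?thesis by simp
qed

lemma l2_of_AE_convergent_subseq:
  fixes u :: "'a::euclidean_space l2"
  assumes f: "\<And>k. sq_integrable (f k)" and lim: "(\<lambda>k. l2_of (f k)) \<longlonglongrightarrow> u"
  obtains r where "strict_mono r" "AE x in lborel. (\<lambda>k. f (r k) x) \<longlonglongrightarrow> l2_fun u x"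
proof -
  have sq: "sq_integrable (\<lambda>x. f k x - l2_fun u x)" for k
    using f by simp
  have "(norm (l2_of (f k) - u))\<^sup>2 = (\<integral>x. norm ((f k x - l2_fun u x)\<^sup>2) \<partial>lborel)" for k
    using norm_l2_of[OF sq[of k]] l2_of_diff[OF f[of k] l2_fun_sq_integrable[of u]] by simp
  moreover have "(\<lambda>k. (norm (l2_of (f k) - u))\<^sup>2) \<longlonglongrightarrow> 0\<^sup>2"
    by (intro tendsto_power tendsto_norm_zero LIM_zero lim)
  ultimately have "(\<lambda>k. \<integral>x. norm ((f k x - l2_fun u x)\<^sup>2) \<partial>lborel) \<longlonglongrightarrow> 0"
    by simp
  then obtain r where r: "strict_mono r" "AE x in lborel. (\<lambda>k. (f (r k) x - l2_fun u x)\<^sup>2) \<longlonglongrightarrow> 0"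
    using tendsto_L1_AE_subseq[of lborel "\<lambda>k x. (f k x - l2_fun u x)\<^sup>2"] sq
    unfolding sq_integrable_def by blast
  have "AE x in lborel. (\<lambda>k. f (r k) x) \<longlonglongrightarrow> l2_fun u x"
    using r(2)
  proof eventually_elim
    case (elim x)
    then have "(\<lambda>k. sqrt ((f (r k) x - l2_fun u x)\<^sup>2)) \<longlonglongrightarrow> sqrt 0"
      by (rule tendsto_real_sqrt)
    then have "(\<lambda>k. f (r k) x - l2_fun u x) \<longlonglongrightarrow> 0"
      by (simp add: tendsto_rabs_zero_iff)
    then show ?case by (rule LIM_zero_cancel)
  qed
  with r(1) that show ?thesis by blast
qed

locale bounded_dense_H01 = dense_H01 \<Omega> for \<Omega> :: "'a::euclidean_space set" +
  assumes open_domain: "open \<Omega>" and bounded_domain: "bounded \<Omega>"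
begin

text \<open>
  A coordinate function cut off outside the domain. As the domain is bounded, so is this function, and
  it acts on $L^2$ by multiplication.
\<close>

definition coord :: "'a \<Rightarrow> 'a \<Rightarrow> real" where
  "coord b x = indicator \<Omega> x * inner x b"

lemma measurable_domain [measurable]: "\<Omega> \<in> sets borel"
  using open_domain by simp

lemma sq_integrable_indicator_domain: "sq_integrable (indicat_real \<Omega>)"
  by (rule sq_integrable_indicator) (use emeasure_bounded_finite[OF bounded_domain] in auto)

lemma coord_measurable [measurable]: "coord b \<in> borel_measurable borel"
  unfolding coord_def by measurable

lemma coord_bounded: obtains R where "\<And>x. \<bar>coord b x\<bar> \<le> R"
proof -
  obtain R where R: "\<And>x. x \<in> \<Omega> \<Longrightarrow> norm x \<le> R" "R > 0"
    using bounded_domain by (auto simp: bounded_pos)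
  have "\<bar>coord b x\<bar> \<le> R * norm b" for x
    using order_trans[OF Cauchy_Schwarz_ineq2[of x b] mult_right_mono[OF R(1)[of x] norm_ge_zero[of b]]] R(2)
    by (auto simp: coord_def indicator_def)
  then show ?thesis by (rule that)
qed

text \<open>
  Approximation in $H^1$ by test functions. Along a subsequence the test functions converge almost
  everywhere. As \<open>g\<close> is bounded and the domain has finite measure, \<open>coord b x * g (u x)\<close> converges in
  $L^2$; and \<open>G\<close>, being Lipschitz, acts continuously on $L^2$.
\<close>

lemma dilation_identity:
  assumes u: "u \<in> H01 \<Omega>" and b: "b \<in> Basis"
    and g: "continuous_on UNIV g" "\<And>s. \<bar>g s\<bar> \<le> M" and G0: "G 0 = 0"
    and G: "\<And>s. (G has_real_derivative g s) (at s)"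
  shows "inner (l2_of (\<lambda>x. coord b x * g (l2_fun u x))) (weak_partial \<Omega> b u)
    = - (\<integral>x. indicator \<Omega> x * G (l2_fun u x) \<partial>lborel)"
proof -
  have G_lip: "\<bar>G s - G t\<bar> \<le> M * \<bar>s - t\<bar>" for s t
    using field_differentiable_bound[of UNIV G g M s t] G g(2) by auto
  have Gc: "continuous_on UNIV G"
    using DERIV_isCont[OF G] by (simp add: continuous_on_eq_continuous_at)
  have [measurable]: "G \<in> borel_measurable borel" "g \<in> borel_measurable borel"
    using Gc g(1) by (auto intro: borel_measurable_continuous_onI)
  obtain R where R: "\<And>x. \<bar>coord b x\<bar> \<le> R" using coord_bounded by blast
  obtain \<Phi>0 where \<Phi>0: "\<And>k. test_function \<Omega> (\<Phi>0 k)" "(\<lambda>k. l2_of (\<Phi>0 k)) \<longlonglongrightarrow> u"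
    "(\<lambda>k. l2_of (\<lambda>x. frechet_derivative (\<Phi>0 k) (at x) b)) \<longlonglongrightarrow> weak_partial \<Omega> b u"
    using H01_test_function_approximation_partial[OF u b] by blast
  obtain r where r: "strict_mono r" "AE x in lborel. (\<lambda>k. \<Phi>0 (r k) x) \<longlonglongrightarrow> l2_fun u x"
    using l2_of_AE_convergent_subseq[OF test_function_sq_integrable[OF \<Phi>0(1)] \<Phi>0(2)] by blast
  define \<Phi> where "\<Phi> k = \<Phi>0 (r k)" for k
  define \<Phi>' where "\<Phi>' k x = frechet_derivative (\<Phi> k) (at x) b" for k x
  have \<Phi>: "test_function \<Omega> (\<Phi> k)" for k by (simp add: \<Phi>_def \<Phi>0)
  have \<Phi>_lim: "(\<lambda>k. l2_of (\<Phi> k)) \<longlonglongrightarrow> u" "(\<lambda>k. l2_of (\<Phi>' k)) \<longlonglongrightarrow> weak_partial \<Omega> b u"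
    using LIMSEQ_subseq_LIMSEQ[OF \<Phi>0(2) r(1)] LIMSEQ_subseq_LIMSEQ[OF \<Phi>0(3) r(1)]
    by (simp_all add: o_def \<Phi>_def \<Phi>'_def[abs_def])
  note sq = test_function_sq_integrable[OF \<Phi>] test_function_partial_sq_integrable[OF \<Phi> b, folded \<Phi>'_def]
  have [measurable]: "\<Phi> k \<in> borel_measurable borel" "\<Phi>' k \<in> borel_measurable borel" for k
    using sq[of k] by (auto simp: sq_integrable_def)
  have zero: "\<Phi> k x = 0" "\<Phi>' k x = 0" if "x \<notin> \<Omega>" for k x
  proof -
    have "x \<notin> closure {x. \<Phi> k x \<noteq> 0}" using that test_function_compact_support(2)[OF \<Phi>[of k]] by auto
    then show "\<Phi> k x = 0" "\<Phi>' k x = 0"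
      unfolding \<Phi>'_def by (rule test_function_eq_0[OF \<Phi>], rule test_function_partial_eq_0[OF \<Phi>])
  qed
  have dom: "\<bar>coord b x * g t\<bar> \<le> \<bar>R * M * indicat_real \<Omega> x\<bar>" for x t
  proof (cases "x \<in> \<Omega>")
    case True
    have "\<bar>coord b x\<bar> * \<bar>g t\<bar> \<le> R * M"
      by (intro mult_mono R g(2)) (use R[of x] in auto)
    then have "\<bar>coord b x * g t\<bar> \<le> \<bar>R * M\<bar>"
      unfolding abs_mult[of "coord b x"] by (rule order_trans[OF _ abs_ge_self])
    then show ?thesis using True by simp
  qed (simp add: coord_def)
  have dom_sq: "sq_integrable (\<lambda>x. R * M * indicat_real \<Omega> x)"
    using sq_integrable_indicator_domain by simp
  have sq_a: "sq_integrable (\<lambda>x. coord b x * g (h x))" if "h \<in> borel_measurable borel" for h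
    by (rule sq_integrable_bound[OF _ dom_sq AE_I2[OF dom]]) (use that in measurable)
  have Gsq: "sq_integrable (\<lambda>x. indicat_real \<Omega> x * G (h x))" if "sq_integrable h" for h
  proof (rule sq_integrable_bound)
    have [measurable]: "h \<in> borel_measurable borel" using that by (simp add: sq_integrable_def)
    show "sq_integrable (\<lambda>x. M * h x)" using that by simp
    show "AE x in lborel. \<bar>indicat_real \<Omega> x * G (h x)\<bar> \<le> \<bar>M * h x\<bar>"
      using G_lip[of _ 0] G0 by (auto simp: indicator_def abs_mult intro!: order_trans[OF _ mult_right_mono[OF abs_ge_self]])
    show "(\<lambda>x. indicat_real \<Omega> x * G (h x)) \<in> borel_measurable lborel" by measurable
  qed
  have "(\<lambda>k. l2_of (\<lambda>x. coord b x * g (\<Phi> k x))) \<longlonglongrightarrow> l2_of (\<lambda>x. coord b x * g (l2_fun u x))"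
  proof (rule l2_of_tendsto_dominated[OF _ sq_a dom_sq _ AE_I2[OF dom]])
    show "AE x in lborel. (\<lambda>k. coord b x * g (\<Phi> k x)) \<longlonglongrightarrow> coord b x * g (l2_fun u x)"
      using r(2) unfolding \<Phi>_def[symmetric]
    proof eventually_elim
      case (elim x)
      have "isCont g (l2_fun u x)" using g(1) by (simp add: continuous_on_eq_continuous_at)
      then show ?case by (intro tendsto_mult_left isCont_tendsto_compose[OF _ elim])
    qed
    show "(\<lambda>x. coord b x * g (\<Phi> k x)) \<in> borel_measurable lborel" for k by measurable
    show "l2_fun u \<in> borel_measurable borel" using l2_fun_measurable[of u] by simp
  qed
  then have "(\<lambda>k. inner (l2_of (\<lambda>x. coord b x * g (\<Phi> k x))) (l2_of (\<Phi>' k)))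
     \<longlonglongrightarrow> inner (l2_of (\<lambda>x. coord b x * g (l2_fun u x))) (weak_partial \<Omega> b u)"
    by (intro tendsto_inner \<Phi>_lim)
  moreover have "inner (l2_of (\<lambda>x. coord b x * g (\<Phi> k x))) (l2_of (\<Phi>' k))
      = - inner (l2_of (indicat_real \<Omega>)) (l2_of (\<lambda>x. indicator \<Omega> x * G (\<Phi> k x)))" for k
  proof -
    have "inner (l2_of (\<lambda>x. coord b x * g (\<Phi> k x))) (l2_of (\<Phi>' k))
        = (\<integral>x. coord b x * g (\<Phi> k x) * \<Phi>' k x \<partial>lborel)"
      by (rule inner_l2_of_l2_of[OF sq_a sq(2)]) measurable
    also have "\<dots> = (\<integral>x. g (\<Phi> k x) * inner x b * \<Phi>' k x \<partial>lborel)"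
      using zero(2) by (intro Bochner_Integration.integral_cong) (auto simp: coord_def indicator_def)
    also have "\<dots> = - (\<integral>x. G (\<Phi> k x) \<partial>lborel)"
      unfolding \<Phi>'_def by (rule test_function_dilation_identity[OF \<Phi> b g(1) G0 G])
    also have "(\<integral>x. G (\<Phi> k x) \<partial>lborel) = (\<integral>x. indicator \<Omega> x * (indicator \<Omega> x * G (\<Phi> k x)) \<partial>lborel)"
      using zero(1) G0 by (intro Bochner_Integration.integral_cong) (auto simp: indicator_def)
    also have "\<dots> = inner (l2_of (indicat_real \<Omega>)) (l2_of (\<lambda>x. indicator \<Omega> x * G (\<Phi> k x)))"
      by (rule inner_l2_of_l2_of[symmetric, OF sq_integrable_indicator_domain Gsq[OF sq(1)]])
    finally show ?thesis .
  qed
  moreover have "(\<lambda>k. - inner (l2_of (indicat_real \<Omega>)) (l2_of (\<lambda>x. indicator \<Omega> x * G (\<Phi> k x))))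
     \<longlonglongrightarrow> - (\<integral>x. indicator \<Omega> x * G (l2_fun u x) \<partial>lborel)"
  proof -
    have le: "norm (l2_of (\<lambda>x. indicator \<Omega> x * G (\<Phi> k x)) - l2_of (\<lambda>x. indicator \<Omega> x * G (l2_fun u x)))
      \<le> \<bar>M\<bar> * norm (l2_of (\<Phi> k) - u)" for k
    proof -
      have "norm (l2_of (\<lambda>x. indicator \<Omega> x * G (\<Phi> k x) - indicator \<Omega> x * G (l2_fun u x)))
         \<le> norm (l2_of (\<lambda>x. M * (\<Phi> k x - l2_fun u x)))"
      proof (rule norm_l2_of_mono)
        show "AE x in lborel. \<bar>indicator \<Omega> x * G (\<Phi> k x) - indicator \<Omega> x * G (l2_fun u x)\<bar>
            \<le> \<bar>M * (\<Phi> k x - l2_fun u x)\<bar>"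
          using G_lip by (auto simp: indicator_def abs_mult intro!: order_trans[OF _ mult_right_mono[OF abs_ge_self]])
      qed (use Gsq sq in simp_all)
      also have "\<dots> = \<bar>M\<bar> * norm (l2_of (\<Phi> k) - u)"
        using sq by (simp add: l2_of_scaleR l2_of_diff)
      finally show ?thesis using Gsq sq by (simp add: l2_of_diff)
    qed
    have lim: "(\<lambda>k. \<bar>M\<bar> * norm (l2_of (\<Phi> k) - u)) \<longlonglongrightarrow> 0"
      using \<Phi>_lim(1) by (intro tendsto_mult_right_zero tendsto_norm_zero LIM_zero)
    have "(\<lambda>k. l2_of (\<lambda>x. indicator \<Omega> x * G (\<Phi> k x)) - l2_of (\<lambda>x. indicator \<Omega> x * G (l2_fun u x))) \<longlonglongrightarrow> 0"
      by (rule Lim_null_comparison[OF always_eventually lim]) (use le in blast)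
    then have "(\<lambda>k. l2_of (\<lambda>x. indicator \<Omega> x * G (\<Phi> k x))) \<longlonglongrightarrow> l2_of (\<lambda>x. indicator \<Omega> x * G (l2_fun u x))"
      by (rule LIM_zero_cancel)
    then have "(\<lambda>k. - inner (l2_of (indicat_real \<Omega>)) (l2_of (\<lambda>x. indicator \<Omega> x * G (\<Phi> k x))))
     \<longlonglongrightarrow> - inner (l2_of (indicat_real \<Omega>)) (l2_of (\<lambda>x. indicator \<Omega> x * G (l2_fun u x)))"
      by (intro tendsto_intros)
    moreover have "inner (l2_of (indicat_real \<Omega>)) (l2_of (\<lambda>x. indicator \<Omega> x * G (l2_fun u x)))
      = (\<integral>x. indicator \<Omega> x * (indicator \<Omega> x * G (l2_fun u x)) \<partial>lborel)"
      by (rule inner_l2_of_l2_of[OF sq_integrable_indicator_domain Gsq]) simp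
    moreover have "\<dots> = (\<integral>x. indicator \<Omega> x * G (l2_fun u x) \<partial>lborel)"
      by (intro Bochner_Integration.integral_cong) (auto simp: indicator_def)
    ultimately show ?thesis by simp
  qed
  ultimately show ?thesis
    by (simp add: LIMSEQ_unique)
qed

text \<open>
  The dilation identity for the truncations of $s \mapsto |s|^{2n-2} s$, whose limit is taken by
  dominated convergence: the two integrability assumptions provide the majorants.
\<close>

lemma pohozaev_identity:
  assumes u: "u \<in> H01 \<Omega>" and b: "b \<in> Basis" and n: "n > 1 / 2"
    and int: "integrable lborel (\<lambda>x. \<bar>l2_fun u x\<bar> powr (2 * n))"
    and sq: "sq_integrable (signed_power n u)"
  shows "inner (l2_of (signed_power n u)) (l2_mult (coord b) (weak_partial \<Omega> b u))
    = - (\<integral>x. \<bar>l2_fun u x\<bar> powr (2 * n) \<partial>lborel) / (2 * n)"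
proof -
  define p where "p s = \<bar>s\<bar> powr (2 * n - 2) * s" for s :: real
  define g where "g k s = max (- real k) (min (real k) (p s))" for k s
  define v where "v = l2_fun (weak_partial \<Omega> b u)"
  have pc: "continuous_on UNIV p"
    unfolding p_def by (rule continuous_signed_power[OF n])
  have gc: "continuous_on UNIV (g k)" for k
    unfolding g_def by (intro continuous_intros pc)
  have "\<forall>k. \<exists>G. G 0 = 0 \<and> (\<forall>s. (G has_real_derivative g k s) (at s))"
    using continuous_antiderivative[OF gc] by metis
  then obtain G where G0: "\<And>k. G k 0 = 0" and G: "\<And>k s. (G k has_real_derivative g k s) (at s)"
    by metis
  have [measurable]: "G k \<in> borel_measurable borel" "g k \<in> borel_measurable borel" for k
    using gc DERIV_isCont[OF G]
    by (auto intro!: borel_measurable_continuous_onI simp: continuous_on_eq_continuous_at)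
  have [measurable]: "p \<in> borel_measurable borel"
    using pc by (rule borel_measurable_continuous_onI)
  have [measurable]: "l2_fun u \<in> borel_measurable borel" "v \<in> borel_measurable borel"
    using l2_fun_measurable[of u] l2_fun_measurable[of "weak_partial \<Omega> b u"] by (simp_all add: v_def)
  have sp: "signed_power n u x = p (l2_fun u x)" for x
    by (simp add: signed_power_def p_def)
  have vsq: "sq_integrable v" by (simp add: v_def)
  obtain R where R: "\<And>x. \<bar>coord b x\<bar> \<le> R" using coord_bounded by blast
  have "R \<ge> 0" using R[of 0] by linarith
  have gk: "\<bar>g k s\<bar> \<le> k" "\<bar>g k s\<bar> \<le> \<bar>p s\<bar>" for k s
    unfolding g_def by auto
  have g_lim: "(\<lambda>k. g k s) \<longlonglongrightarrow> p s" for s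
  proof (rule tendsto_eventually)
    obtain k0 where "\<bar>p s\<bar> \<le> real k0" using real_arch_simple by blast
    then show "\<forall>\<^sub>F k in sequentially. g k s = p s"
      unfolding eventually_sequentially g_def by (intro exI[of _ k0]) (auto simp: max_def min_def)
  qed
  have G_lim: "(\<lambda>k. G k s) \<longlonglongrightarrow> \<bar>s\<bar> powr (2 * n) / (2 * n)" for s
  proof (rule tendsto_eventually)
    obtain k0 where "\<bar>s\<bar> powr (2 * n - 1) \<le> real k0" using real_arch_simple by blast
    then show "\<forall>\<^sub>F k in sequentially. G k s = \<bar>s\<bar> powr (2 * n) / (2 * n)"
      unfolding eventually_sequentially
      using signed_power_antiderivative_truncation(2)[OF n G0 G[unfolded g_def p_def]]
      by (intro exI[of _ k0]) force
  qed
  have gsq: "sq_integrable (\<lambda>x. coord b x * g k (l2_fun u x))" for k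
  proof (rule sq_integrable_bound)
    show "sq_integrable (\<lambda>x. R * signed_power n u x)" using sq by simp
    show "AE x in lborel. \<bar>coord b x * g k (l2_fun u x)\<bar> \<le> \<bar>R * signed_power n u x\<bar>"
      unfolding sp abs_mult using \<open>R \<ge> 0\<close> R gk by (intro AE_I2 mult_mono) auto
  qed measurable
  have id: "(\<integral>x. coord b x * g k (l2_fun u x) * v x \<partial>lborel) = - (\<integral>x. indicator \<Omega> x * G k (l2_fun u x) \<partial>lborel)" for k
    using dilation_identity[OF u b gc[of k] gk(1)[of k] G0 G]
    unfolding inner_l2_of_l2_of[OF gsq vsq, symmetric] by (simp add: v_def)
  have "(\<lambda>k. \<integral>x. coord b x * g k (l2_fun u x) * v x \<partial>lborel)
     \<longlonglongrightarrow> (\<integral>x. coord b x * p (l2_fun u x) * v x \<partial>lborel)"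
  proof (rule integral_dominated_convergence)
    show "integrable lborel (\<lambda>x. R * (\<bar>signed_power n u x\<bar> * \<bar>v x\<bar>))"
      using sq vsq by (intro integrable_mult_right sq_integrable_mult) auto
    show "AE x in lborel. (\<lambda>k. coord b x * g k (l2_fun u x) * v x) \<longlonglongrightarrow> coord b x * p (l2_fun u x) * v x"
      by (intro AE_I2 tendsto_intros g_lim)
    show "AE x in lborel. norm (coord b x * g k (l2_fun u x) * v x) \<le> R * (\<bar>signed_power n u x\<bar> * \<bar>v x\<bar>)" for k
    proof (rule AE_I2)
      fix x
      have "\<bar>coord b x\<bar> * (\<bar>g k (l2_fun u x)\<bar> * \<bar>v x\<bar>) \<le> R * (\<bar>p (l2_fun u x)\<bar> * \<bar>v x\<bar>)"
        using R[of x] gk(2) \<open>R \<ge> 0\<close> by (intro mult_mono) auto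
      then show "norm (coord b x * g k (l2_fun u x) * v x) \<le> R * (\<bar>signed_power n u x\<bar> * \<bar>v x\<bar>)"
        by (simp add: abs_mult sp mult.assoc)
    qed
  qed measurable
  moreover have "(\<lambda>k. - (\<integral>x. indicator \<Omega> x * G k (l2_fun u x) \<partial>lborel))
      \<longlonglongrightarrow> - (\<integral>x. \<bar>l2_fun u x\<bar> powr (2 * n) / (2 * n) \<partial>lborel)"
  proof (intro tendsto_minus integral_dominated_convergence)
    show "integrable lborel (\<lambda>x. \<bar>l2_fun u x\<bar> powr (2 * n))" by (rule int)
    have "AE x in lborel. x \<notin> \<Omega> \<longrightarrow> l2_fun u x = 0"
      using sobolev_L2[OF H01_sobolev[OF u]] by (simp add: L2_def)
    then show "AE x in lborel. (\<lambda>k. indicator \<Omega> x * G k (l2_fun u x)) \<longlonglongrightarrow> \<bar>l2_fun u x\<bar> powr (2 * n) / (2 * n)"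
      by eventually_elim (auto simp: indicator_def G_lim G0)
    show "AE x in lborel. norm (indicator \<Omega> x * G k (l2_fun u x)) \<le> \<bar>l2_fun u x\<bar> powr (2 * n)" for k
      using signed_power_antiderivative_truncation(1)[OF n G0 G[unfolded g_def p_def]]
      by (auto simp: indicator_def)
  qed measurable
  ultimately have "(\<integral>x. coord b x * p (l2_fun u x) * v x \<partial>lborel)
      = - (\<integral>x. \<bar>l2_fun u x\<bar> powr (2 * n) / (2 * n) \<partial>lborel)"
    unfolding id by (rule LIMSEQ_unique)
  moreover have "inner (l2_of (signed_power n u)) (l2_mult (coord b) (weak_partial \<Omega> b u))
     = (\<integral>x. signed_power n u x * (coord b x * v x) \<partial>lborel)"
    unfolding l2_mult_def v_def
    by (intro inner_l2_of_l2_of sq sq_integrable_mult_bounded[OF _ R]) auto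
  ultimately show ?thesis
    by (simp add: sp ac_simps)
qed

end

section \<open>Semigroups generated by dissipative symmetric operators\<close>

lemma has_vector_derivative_iff_quotient:
  fixes f :: "real \<Rightarrow> 'b::real_normed_vector"
  shows "(f has_vector_derivative D) (at t) \<longleftrightarrow> ((\<lambda>h. (f (t + h) - f t) /\<^sub>R h) \<longlongrightarrow> D) (at 0)"
proof -
  have "(f has_vector_derivative D) (at t)
      \<longleftrightarrow> ((\<lambda>h. norm (f (t + h) - f t - h *\<^sub>R D) / norm h) \<longlongrightarrow> 0) (at 0)"
    by (simp add: has_vector_derivative_def has_derivative_at bounded_linear_scaleR_left)
  also have "\<dots> \<longleftrightarrow> ((\<lambda>h. norm ((f (t + h) - f t) /\<^sub>R h - D)) \<longlongrightarrow> 0) (at 0)"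
  proof (rule filterlim_cong[OF refl refl], unfold eventually_at_filter, intro always_eventually allI impI)
    fix h :: real assume h: "h \<noteq> 0"
    then have "(f (t + h) - f t) /\<^sub>R h - D = (f (t + h) - f t - h *\<^sub>R D) /\<^sub>R h"
      by (simp add: scaleR_diff_right)
    then show "norm (f (t + h) - f t - h *\<^sub>R D) / norm h = norm ((f (t + h) - f t) /\<^sub>R h - D)"
      by (simp add: divide_inverse_commute)
  qed
  finally show ?thesis
    by (simp add: tendsto_norm_zero_iff LIM_zero_iff)
qed

text \<open>
  The coefficients grow at most geometrically, so the remainder of the difference quotient is bounded by a geometric series times
  the step.
\<close>

lemma power_series_has_vector_derivative:
  fixes f :: "real \<Rightarrow> 'b::banach"
  assumes r: "r > 0" and sums: "\<And>t. \<bar>t - t0\<bar> < r \<Longrightarrow> (\<lambda>k. (t - t0) ^ k *\<^sub>R c k) sums f t"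
  shows "(f has_vector_derivative c 1) (at t0)"
proof -
  define \<rho> where "\<rho> = r / 2"
  have \<rho>: "\<rho> > 0" "\<bar>(t0 + \<rho>) - t0\<bar> < r" using r by (auto simp: \<rho>_def)
  have "(\<lambda>k. norm (\<rho> ^ k *\<^sub>R c k)) \<longlonglongrightarrow> 0"
    using sums_summable[OF sums[OF \<rho>(2)]] by (intro tendsto_norm_zero summable_LIMSEQ_zero) simp
  then have "Bseq (\<lambda>k. norm (\<rho> ^ k *\<^sub>R c k))"
    by (intro convergent_imp_Bseq) (auto simp: convergent_def)
  then obtain B where B: "B > 0" "\<And>k. norm (\<rho> ^ k *\<^sub>R c k) \<le> B"
    by (auto simp: Bseq_def)
  have ck: "norm (c k) \<le> B / \<rho> ^ k" for k
    using B(2)[of k] \<rho>(1) by (simp add: field_simps)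
  have f0: "f t0 = c 0"
  proof -
    have "(\<lambda>k. 0 ^ k *\<^sub>R c k) sums f t0" using sums[of t0] r by simp
    moreover have "(\<lambda>k. 0 ^ k *\<^sub>R c k) sums (\<Sum>k\<in>{0}. 0 ^ k *\<^sub>R c k)"
      by (rule sums_finite) auto
    ultimately show ?thesis by (simp add: sums_unique2)
  qed
  have est: "norm ((f (t0 + h) - f t0) /\<^sub>R h - c 1) \<le> 2 * B / \<rho>\<^sup>2 * \<bar>h\<bar>" if h: "h \<noteq> 0" "\<bar>h\<bar> < \<rho> / 2" for h
  proof -
    define q where "q = \<bar>h\<bar> / \<rho>"
    have q: "0 \<le> q" "q < 1/2" using h \<rho>(1) by (auto simp: q_def field_simps)
    have "(\<lambda>k. h ^ k *\<^sub>R c k) sums f (t0 + h)"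
      using sums[of "t0 + h"] h \<rho>(1) by (simp add: \<rho>_def)
    from sums_split_initial_segment[OF this, of 2]
    have "(\<lambda>k. h ^ Suc (Suc k) *\<^sub>R c (Suc (Suc k))) sums (f (t0 + h) - (c 0 + h *\<^sub>R c 1))"
      unfolding add_2_eq_Suc' by (simp add: numeral_2_eq_2 lessThan_Suc add.commute)
    then have "(\<lambda>k. inverse h *\<^sub>R (h ^ Suc (Suc k) *\<^sub>R c (Suc (Suc k)))) sums (inverse h *\<^sub>R (f (t0 + h) - (c 0 + h *\<^sub>R c 1)))"
      by (rule sums_scaleR_right)
    then have s: "(\<lambda>k. h ^ Suc k *\<^sub>R c (Suc (Suc k))) sums ((f (t0 + h) - f t0) /\<^sub>R h - c 1)"
      using h(1) by (simp add: f0 scaleR_diff_right scaleR_add_right mult.assoc[symmetric] diff_diff_eq[symmetric])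
    have bd: "norm (h ^ Suc k *\<^sub>R c (Suc (Suc k))) \<le> (B / \<rho>\<^sup>2 * \<bar>h\<bar>) * q ^ k" for k
    proof -
      have "norm (h ^ Suc k *\<^sub>R c (Suc (Suc k))) \<le> \<bar>h\<bar> ^ Suc k * (B / \<rho> ^ Suc (Suc k))"
        unfolding norm_scaleR by (intro mult_mono ck) (auto simp: power_abs abs_mult)
      also have "\<dots> = (B / \<rho>\<^sup>2 * \<bar>h\<bar>) * q ^ k"
        using \<rho>(1) by (simp add: q_def power_divide power2_eq_square field_simps)
      finally show ?thesis .
    qed
    have sg: "summable (\<lambda>k. (B / \<rho>\<^sup>2 * \<bar>h\<bar>) * q ^ k)"
      using q by (intro summable_mult summable_geometric) auto
    have "norm (\<Sum>k. h ^ Suc k *\<^sub>R c (Suc (Suc k))) \<le> (\<Sum>k. (B / \<rho>\<^sup>2 * \<bar>h\<bar>) * q ^ k)"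
      by (rule norm_suminf_le[OF bd sg])
    also have "\<dots> = (B / \<rho>\<^sup>2 * \<bar>h\<bar>) * (1 / (1 - q))"
      using q by (subst suminf_mult) (auto simp: suminf_geometric summable_geometric)
    also have "\<dots> \<le> (B / \<rho>\<^sup>2 * \<bar>h\<bar>) * 2"
      using q B(1) by (intro mult_left_mono) (auto simp: field_simps)
    finally show ?thesis using sums_unique[OF s] by (simp add: mult_ac)
  qed
  have "((\<lambda>h. (f (t0 + h) - f t0) /\<^sub>R h - c 1) \<longlongrightarrow> 0) (at 0)"
  proof (rule Lim_null_comparison)
    have "((\<lambda>h. 2 * B / \<rho>\<^sup>2 * \<bar>h\<bar>) \<longlongrightarrow> 2 * B / \<rho>\<^sup>2 * \<bar>0\<bar>) (at 0)"
      by (intro tendsto_intros)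
    then show "((\<lambda>h. 2 * B / \<rho>\<^sup>2 * \<bar>h\<bar>) \<longlongrightarrow> 0) (at 0)" by simp
    show "\<forall>\<^sub>F h in at 0. norm ((f (t0 + h) - f t0) /\<^sub>R h - c 1) \<le> 2 * B / \<rho>\<^sup>2 * \<bar>h\<bar>"
      unfolding eventually_at using \<rho>(1) est by (intro exI[of _ "\<rho> / 2"]) auto
  qed
  then show ?thesis
    unfolding has_vector_derivative_iff_quotient by (rule LIM_zero_cancel)
qed

text \<open>
  \<open>P\<close> is a retraction onto \<open>H\<close>. It serves to extend the semigroup to a jointly continuous map on the
  whole space, see \<open>extended\<close> below.
\<close>

locale dissipative_semigroup =
  fixes H D :: "'b::{real_inner, banach, second_countable_topology} set"
    and S :: "real \<Rightarrow> 'b \<Rightarrow> 'b" and A P :: "'b \<Rightarrow> 'b"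
  assumes subspace_H: "subspace H"
    and semigroup: "analytic_semigroup H S"
    and generator: "is_generator H S D (\<lambda>v. - A v)"
    and symmetric: "\<And>v w. v \<in> D \<Longrightarrow> w \<in> D \<Longrightarrow> inner (A v) w = inner v (A w)"
    and nonneg: "\<And>v. v \<in> D \<Longrightarrow> 0 \<le> inner (A v) v"
    and continuous_projection: "continuous_on UNIV P"
    and projection_in: "\<And>x. P x \<in> H" and projection_id: "\<And>x. x \<in> H \<Longrightarrow> P x = x"
begin

lemma semigroup_in: "0 \<le> t \<Longrightarrow> x \<in> H \<Longrightarrow> S t x \<in> H"
  using semigroup by (simp add: analytic_semigroup_def)

lemma semigroup_0: "x \<in> H \<Longrightarrow> S 0 x = x"
  using semigroup by (simp add: analytic_semigroup_def)

lemma semigroup_diff: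
  assumes "0 \<le> t" "x \<in> H" "y \<in> H" shows "S t (x - y) = S t x - S t y"
proof -
  have "S t (x + (-1) *\<^sub>R y) = S t x + S t ((-1) *\<^sub>R y)"
    using assms semigroup subspace_scale[OF subspace_H] unfolding analytic_semigroup_def by blast
  also have "S t ((-1) *\<^sub>R y) = (-1) *\<^sub>R S t y"
    using assms semigroup unfolding analytic_semigroup_def by blast
  finally show ?thesis by simp
qed

text \<open>
  An analytic orbit is differentiable at every positive time, and by the semigroup law its derivative
  is a limit of difference quotients at time 0 of the orbit of \<open>S t x\<close>. So \<open>S t x\<close> is in the domain of
  the generator.
\<close>

lemma orbit_derivative:
  assumes t: "t > 0" and x: "x \<in> H"
  shows "S t x \<in> D" "((\<lambda>t. S t x) has_vector_derivative - A (S t x)) (at t)"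
proof -
  have "\<forall>x\<in>H. \<forall>t0>0. \<exists>r>0. \<exists>c :: nat \<Rightarrow> 'b.
      \<forall>t. \<bar>t - t0\<bar> < r \<longrightarrow> (\<lambda>k. (t - t0) ^ k *\<^sub>R c k) sums S t x"
    using semigroup unfolding analytic_semigroup_def by (elim conjE) assumption
  from this[rule_format, OF x t] obtain r c
    where rc: "r > 0" "\<And>s. \<bar>s - t\<bar> < r \<Longrightarrow> (\<lambda>k. (s - t) ^ k *\<^sub>R c k) sums S s x"
    by blast
  have deriv: "((\<lambda>t. S t x) has_vector_derivative c 1) (at t)"
    using power_series_has_vector_derivative[of r t c "\<lambda>s. S s x"] rc by blast
  then have "((\<lambda>h. (S (t + h) x - S t x) /\<^sub>R h) \<longlongrightarrow> c 1) (at 0)"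
    by (simp add: has_vector_derivative_iff_quotient)
  then have "((\<lambda>h. (S (t + h) x - S t x) /\<^sub>R h) \<longlongrightarrow> c 1) (at_right 0)"
    by (rule filterlim_mono) (auto simp: at_le)
  moreover have "\<forall>\<^sub>F h in at_right 0. (S (t + h) x - S t x) /\<^sub>R h = (S h (S t x) - S t x) /\<^sub>R h"
    using eventually_at_right_less
  proof eventually_elim
    case (elim h)
    have "\<forall>s\<ge>0. \<forall>t\<ge>0. \<forall>x\<in>H. S (s + t) x = S s (S t x)"
      using semigroup unfolding analytic_semigroup_def by (elim conjE) assumption
    then have "S (h + t) x = S h (S t x)"
      using x t elim by simp
    then show ?case by (simp add: add.commute)
  qed
  ultimately have "((\<lambda>h. (S h (S t x) - S t x) /\<^sub>R h) \<longlongrightarrow> c 1) (at_right 0)"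
    by (rule Lim_transform_eventually)
  moreover have "S t x \<in> H" using semigroup_in t x by simp
  ultimately have "S t x \<in> D \<and> - A (S t x) = c 1"
    using generator unfolding is_generator_def by blast
  with deriv show "S t x \<in> D" "((\<lambda>t. S t x) has_vector_derivative - A (S t x)) (at t)"
    by auto
qed

lemma orbit_continuous:
  assumes x: "x \<in> H" shows "continuous_on {0..} (\<lambda>t. S t x)"
  unfolding continuous_on_eq_continuous_within
proof
  fix t :: real assume "t \<in> {0..}"
  then consider "t = 0" | "t > 0" by force
  then show "continuous (at t within {0..}) (\<lambda>t. S t x)"
  proof cases
    case 1
    have "((\<lambda>t. S t x) \<longlongrightarrow> x) (at_right 0)"
      using semigroup x by (simp add: analytic_semigroup_def)
    moreover have "at 0 within {0..} = at_right (0::real)"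
      by (rule at_within_nhd[of _ UNIV]) auto
    ultimately show ?thesis using 1 x by (simp add: continuous_within semigroup_0)
  next
    case 2
    show ?thesis
      using has_vector_derivative_continuous[OF orbit_derivative(2)[OF 2 x]]
      by (rule continuous_at_imp_continuous_at_within)
  qed
qed

text \<open>
  The derivative of $|S(t)x|^2$ for positive times is $-2 \langle A S(t)x, S(t)x \rangle \le 0$.
\<close>

lemma contraction:
  assumes t: "0 \<le> t" and x: "x \<in> H" shows "norm (S t x) \<le> norm x"
proof -
  have "inner (S t x) (S t x) \<le> inner (S 0 x) (S 0 x)"
  proof (rule DERIV_nonpos_imp_decreasing_open[OF t])
    show "continuous_on {0..t} (\<lambda>s. inner (S s x) (S s x))"
      by (intro continuous_intros continuous_on_subset[OF orbit_continuous[OF x]]) auto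
    fix s assume s: "0 < s" "s < t"
    have "((\<lambda>s. inner (S s x) (S s x)) has_vector_derivative
        inner (S s x) (- A (S s x)) + inner (- A (S s x)) (S s x)) (at s)"
      by (rule bounded_bilinear.has_vector_derivative[OF bounded_bilinear_inner]) (rule orbit_derivative(2)[OF s(1) x])+
    moreover have "inner (S s x) (- A (S s x)) + inner (- A (S s x)) (S s x) \<le> 0"
      using nonneg[OF orbit_derivative(1)[OF s(1) x]] by (simp add: inner_commute)
    ultimately show "\<exists>y. ((\<lambda>s. inner (S s x) (S s x)) has_real_derivative y) (at s) \<and> y \<le> 0"
      by (auto simp: has_real_derivative_iff_has_vector_derivative)
  qed
  then show ?thesis
    using x by (simp add: semigroup_0 norm_le)
qed

text \<open>
  The fundamental theorem of calculus for $q \mapsto \langle S(q-p)x, e\rangle$. Moving $A$ to \<open>e\<close> makes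
  the integrand continuous up to $q = p$, where the orbit need not be differentiable.
\<close>

lemma orbit_weak_equation:
  assumes x: "x \<in> H" and e: "e \<in> D" and pt: "p \<le> t"
  shows "integrable (lebesgue_on {p..t}) (\<lambda>q. inner (S (q - p) x) (A e))"
    and "inner (S (t - p) x) e = inner x e - (\<integral>q. inner (S (q - p) x) (A e) \<partial>lebesgue_on {p..t})"
proof -
  have cont: "continuous_on {p..t} (\<lambda>q. S (q - p) x)"
    by (rule continuous_on_compose2[OF orbit_continuous[OF x]]) (auto intro!: continuous_intros)
  show int: "integrable (lebesgue_on {p..t}) (\<lambda>q. inner (S (q - p) x) (A e))"
    by (intro continuous_imp_integrable_real continuous_intros cont)
  have "((\<lambda>q. - inner (S (q - p) x) (A e)) has_integral (inner (S (t - p) x) e - inner (S (p - p) x) e)) {p..t}"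
  proof (rule fundamental_theorem_of_calculus_interior[OF pt])
    show "continuous_on {p..t} (\<lambda>q. inner (S (q - p) x) e)"
      by (intro continuous_intros cont)
    fix q assume q: "q \<in> {p<..<t}"
    have "((\<lambda>q. S (q - p) x) has_vector_derivative - A (S (q - p) x)) (at q)"
    proof -
      have shift: "((\<lambda>q. q - p) has_vector_derivative 1) (at q)"
        by (auto intro!: derivative_eq_intros)
      show ?thesis
        using vector_diff_chain_at[OF shift orbit_derivative(2)[of "q - p" x]] q x by (simp add: o_def)
    qed
    then have "((\<lambda>q. inner (S (q - p) x) e) has_vector_derivative inner (- A (S (q - p) x)) e) (at q)"
      by (rule bounded_linear.has_vector_derivative[OF bounded_linear_inner_left])
    then show "((\<lambda>q. inner (S (q - p) x) e) has_vector_derivative - inner (S (q - p) x) (A e)) (at q)"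
      using symmetric[OF orbit_derivative(1) e, of "q - p" x] q x by simp
  qed
  from has_integral_neg[OF this]
  have "((\<lambda>q. inner (S (q - p) x) (A e)) has_integral (inner x e - inner (S (t - p) x) e)) {p..t}"
    using x by (simp add: semigroup_0)
  then show "inner (S (t - p) x) e = inner x e - (\<integral>q. inner (S (q - p) x) (A e) \<partial>lebesgue_on {p..t})"
    using lebesgue_integral_eq_integral[OF int] by (simp add: integral_unique)
qed

text \<open>
  The integrand of Duhamel's formula is measurable as a function of two variables because it is the
  composition of measurable functions with this continuous map.
\<close>

definition extended :: "real \<times> 'b \<Rightarrow> 'b" where
  "extended z = S (max 0 (fst z)) (P (snd z))"

text \<open>
  Strong continuity of the orbits, together with the contraction property to vary the initial value.
\<close>

lemma extended_continuous: "continuous_on UNIV extended"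
proof -
  have "isCont extended (r, x)" for r x
  proof -
    have a: "((\<lambda>z. P (snd z)) \<longlongrightarrow> P x) (at (r, x))"
      using continuous_projection
      by (intro isCont_tendsto_compose[where g=P] tendsto_eq_intros) (auto simp: continuous_on_eq_continuous_at)
    have "continuous_on UNIV (\<lambda>s. S (max 0 s) (P x))"
      by (rule continuous_on_compose2[OF orbit_continuous[OF projection_in]]) (auto intro!: continuous_intros)
    then have b: "((\<lambda>z. S (max 0 (fst z)) (P x)) \<longlongrightarrow> S (max 0 r) (P x)) (at (r, x))"
      by (intro isCont_tendsto_compose[where g="\<lambda>s. S (max 0 s) (P x)"] tendsto_eq_intros) (auto simp: continuous_on_eq_continuous_at)
    have "((\<lambda>z. extended z - S (max 0 (fst z)) (P x)) \<longlongrightarrow> 0) (at (r, x))"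
    proof (rule Lim_null_comparison)
      show "((\<lambda>z. norm (P (snd z) - P x)) \<longlongrightarrow> 0) (at (r, x))"
        by (intro tendsto_norm_zero LIM_zero a)
      show "\<forall>\<^sub>F z in at (r, x). norm (extended z - S (max 0 (fst z)) (P x)) \<le> norm (P (snd z) - P x)"
        using contraction[OF _ subspace_diff[OF subspace_H projection_in projection_in]]
        by (intro always_eventually allI)
          (simp add: extended_def projection_in flip: semigroup_diff)
    qed
    from tendsto_add[OF this b] show ?thesis
      by (simp add: isCont_def extended_def[abs_def])
  qed
  then show ?thesis by (simp add: continuous_on_eq_continuous_at)
qed

lemma extended_measurable [measurable]: "extended \<in> borel_measurable borel"
  using extended_continuous by (rule borel_measurable_continuous_onI)

end

section \<open>From the mild to the weak formulation\<close>

lemma integrable_lebesgue_on_subset: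
  fixes f :: "'a::euclidean_space \<Rightarrow> 'b::{banach, second_countable_topology}"
  assumes "integrable (lebesgue_on X) f" "Y \<subseteq> X" "X \<in> sets lebesgue" "Y \<in> sets lebesgue"
  shows "integrable (lebesgue_on Y) f"
proof -
  have "integrable lebesgue (\<lambda>x. indicator Y x *\<^sub>R (indicator X x *\<^sub>R f x))"
    using assms(1,3) by (intro integrable_mult_indicator[OF assms(4)]) (simp add: integrable_restrict_space)
  moreover have "(\<lambda>x. indicator Y x *\<^sub>R (indicator X x *\<^sub>R f x)) = (\<lambda>x. indicator Y x *\<^sub>R f x)"
    using assms(2) by (auto simp: indicator_def fun_eq_iff)
  ultimately show ?thesis
    using assms(4) by (simp add: integrable_restrict_space)
qed

lemma integral_lebesgue_on_subset:
  fixes f :: "'a::euclidean_space \<Rightarrow> 'b::{banach, second_countable_topology}"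
  assumes "Y \<subseteq> X" "X \<in> sets lebesgue" "Y \<in> sets lebesgue"
  shows "integral\<^sup>L (lebesgue_on Y) f = (\<integral>x. indicator Y x *\<^sub>R f x \<partial>lebesgue_on X)"
proof -
  have "(\<lambda>x. indicator X x *\<^sub>R (indicator Y x *\<^sub>R f x)) = (\<lambda>x. indicator Y x *\<^sub>R f x)"
    using assms(1) by (auto simp: indicator_def fun_eq_iff)
  then show ?thesis
    using assms(2,3) by (simp add: integral_restrict_space)
qed

context dissipative_semigroup
begin

lemma convol_integrand_integrable:
  assumes f: "integrable (lebesgue_on {0..t}) f" and fH: "\<And>p. f p \<in> H" and q: "q \<in> {0..t}"
  shows "integrable (lebesgue_on {0..q}) (\<lambda>p. S (q - p) (f p))"
proof -
  have f': "integrable (lebesgue_on {0..q}) f"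
    by (rule integrable_lebesgue_on_subset[OF f]) (use q in auto)
  then have [measurable]: "f \<in> borel_measurable (lebesgue_on {0..q})" by simp
  have id [measurable]: "(\<lambda>p::real. p) \<in> borel_measurable (lebesgue_on {0..q})"
    by (intro measurable_restrict_space1 measurable_completion) measurable
  have "integrable (lebesgue_on {0..q}) (\<lambda>p. extended (q - p, f p))"
  proof (rule Bochner_Integration.integrable_bound[OF f'])
    show "(\<lambda>p. extended (q - p, f p)) \<in> borel_measurable (lebesgue_on {0..q})"
      by measurable
    show "AE p in lebesgue_on {0..q}. norm (extended (q - p, f p)) \<le> norm (f p)"
      using contraction fH by (auto simp: extended_def projection_id)
  qed
  then show ?thesis
    by (rule Bochner_Integration.integrable_cong[THEN iffD1, rotated 2])
      (auto simp: extended_def projection_id fH)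
qed

text \<open>
  Apply \<open>orbit_weak_equation\<close> to $S(t-p) f(p)$ and integrate over \<open>p\<close>. The double integral of
  $\langle S(q-p) f(p), Ae \rangle$ over $0 \le p \le q \le t$, integrated over \<open>p\<close> first, is
  $\int_0^t \langle (S*f)(q), Ae\rangle \, dq$.
\<close>

lemma mild_imp_weak:
  assumes x0: "x0 \<in> H" and f: "integrable (lebesgue_on {0..t}) f" and fH: "\<And>p. f p \<in> H"
    and e: "e \<in> D" and t: "0 \<le> t"
    and v: "\<And>q. q \<in> {0..t} \<Longrightarrow> v q = S q x0 + convol S f q"
  shows "integrable (lebesgue_on {0..t}) (\<lambda>q. inner (v q) (A e))"
    and "inner (v t) e = inner x0 e + (\<integral>p. inner (f p) e \<partial>lebesgue_on {0..t})
      - (\<integral>q. inner (v q) (A e) \<partial>lebesgue_on {0..t})"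
proof -
  define M where "M = lebesgue_on {0..t}"
  interpret M: finite_measure M
    unfolding M_def by (rule finite_measure_lebesgue_on) simp
  interpret MM: pair_sigma_finite M M ..
  have space_M: "space M = {0..t}" by (simp add: M_def)
  define K where "K p q = (if p \<le> q then inner (extended (q - p, f p)) (A e) else 0)" for p q
  have [measurable]: "f \<in> borel_measurable M" and fM: "integrable M f" using f by (auto simp: M_def)
  have id [measurable]: "(\<lambda>p::real. p) \<in> borel_measurable M"
    unfolding M_def by (intro measurable_restrict_space1 measurable_completion) measurable
  have K_meas [measurable]: "(\<lambda>(p, q). K p q) \<in> borel_measurable (M \<Otimes>\<^sub>M M)"
  proof -
    have a: "(\<lambda>z. f (fst z)) \<in> borel_measurable (M \<Otimes>\<^sub>M M)" by measurable
    have b: "(\<lambda>z. fst z) \<in> borel_measurable (M \<Otimes>\<^sub>M M)" "(\<lambda>z. snd z) \<in> borel_measurable (M \<Otimes>\<^sub>M M)"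
      using measurable_compose[OF measurable_fst id] measurable_compose[OF measurable_snd id] by auto
    have "(\<lambda>z. if fst z \<le> snd z then inner (extended (snd z - fst z, f (fst z))) (A e) else 0)
        \<in> borel_measurable (M \<Otimes>\<^sub>M M)"
      using a b by measurable
    then show ?thesis by (simp add: K_def split_beta)
  qed
  have K_bound: "norm (K p q) \<le> norm (f p) * norm (A e)" for p q
  proof (cases "p \<le> q")
    case True
    have "norm (extended (q - p, f p)) \<le> norm (f p)"
      using contraction[of "max 0 (q - p)" "f p"] fH by (simp add: extended_def projection_id)
    then have "norm (extended (q - p, f p)) * norm (A e) \<le> norm (f p) * norm (A e)"
      by (rule mult_right_mono) simp
    with Cauchy_Schwarz_ineq2[of "extended (q - p, f p)" "A e"] True show ?thesis
      by (simp add: K_def)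
  qed (simp add: K_def)
  have K_int: "integrable (M \<Otimes>\<^sub>M M) (\<lambda>(p, q). K p q)"
  proof (rule Bochner_Integration.integrable_bound)
    show "integrable (M \<Otimes>\<^sub>M M) (\<lambda>(p, q). norm (f p) * norm (A e))"
      using fM by (intro MM.Fubini_integrable) auto
    show "AE z in M \<Otimes>\<^sub>M M. norm (case z of (p, q) \<Rightarrow> K p q) \<le> norm (case z of (p, q) \<Rightarrow> norm (f p) * norm (A e))"
      using K_bound by (auto simp: abs_mult)
  qed (rule K_meas)
  have convol: "inner (convol S f q) (A e) = (\<integral>p. K p q \<partial>M)" if q: "q \<in> {0..t}" for q
  proof -
    have "inner (convol S f q) (A e) = (\<integral>p. inner (S (q - p) (f p)) (A e) \<partial>lebesgue_on {0..q})"
      unfolding convol_def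
      by (rule integral_inner_left[symmetric]) (rule convol_integrand_integrable[OF f fH q])
    also have "\<dots> = (\<integral>p. indicator {0..q} p *\<^sub>R inner (S (q - p) (f p)) (A e) \<partial>M)"
      unfolding M_def using q by (intro integral_lebesgue_on_subset) auto
    also have "\<dots> = (\<integral>p. K p q \<partial>M)"
      by (rule Bochner_Integration.integral_cong)
        (auto simp: K_def indicator_def space_M extended_def projection_id fH)
    finally show ?thesis .
  qed
  have convol_int: "integrable M (\<lambda>q. inner (convol S f q) (A e))"
  proof -
    have "integrable M (\<lambda>q. \<integral>p. K p q \<partial>M)"
      by (rule MM.integrable_snd[OF K_int])
    then show ?thesis
      by (rule Bochner_Integration.integrable_cong[THEN iffD2, rotated 2]) (auto simp: space_M convol)
  qed
  have orbit_int: "integrable M (\<lambda>q. inner (S q x0) (A e))"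
    using orbit_weak_equation(1)[OF x0 e t] by (simp add: M_def)
  show "integrable (lebesgue_on {0..t}) (\<lambda>q. inner (v q) (A e))"
    unfolding M_def[symmetric]
    by (rule Bochner_Integration.integrable_cong[THEN iffD2, rotated 2, OF Bochner_Integration.integrable_add[OF orbit_int convol_int]])
      (auto simp: space_M v inner_add_left)
  have v_int: "(\<integral>q. inner (v q) (A e) \<partial>M)
      = (\<integral>q. inner (S q x0) (A e) \<partial>M) + (\<integral>q. inner (convol S f q) (A e) \<partial>M)"
    unfolding Bochner_Integration.integral_add[OF orbit_int convol_int, symmetric]
    by (rule Bochner_Integration.integral_cong) (auto simp: space_M v inner_add_left)
  have "inner (convol S f t) e = (\<integral>p. inner (S (t - p) (f p)) e \<partial>M)"
    unfolding convol_def M_def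
    by (rule integral_inner_left[symmetric]) (rule convol_integrand_integrable[OF f fH], use t in auto)
  also have "\<dots> = (\<integral>p. inner (f p) e - (\<integral>q. K p q \<partial>M) \<partial>M)"
  proof (rule Bochner_Integration.integral_cong[OF refl])
    fix p assume "p \<in> space M"
    then have p: "0 \<le> p" "p \<le> t" by (auto simp: space_M)
    have "(\<integral>q. inner (S (q - p) (f p)) (A e) \<partial>lebesgue_on {p..t})
        = (\<integral>q. indicator {p..t} q *\<^sub>R inner (S (q - p) (f p)) (A e) \<partial>M)"
      unfolding M_def using p by (intro integral_lebesgue_on_subset) auto
    also have "\<dots> = (\<integral>q. K p q \<partial>M)"
      by (rule Bochner_Integration.integral_cong)
        (auto simp: K_def indicator_def space_M extended_def projection_id fH)
    finally show "inner (S (t - p) (f p)) e = inner (f p) e - (\<integral>q. K p q \<partial>M)"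
      using orbit_weak_equation(2)[OF fH e p(2)] by simp
  qed
  also have "\<dots> = (\<integral>p. inner (f p) e \<partial>M) - (\<integral>p. (\<integral>q. K p q \<partial>M) \<partial>M)"
    using fM MM.integrable_fst[OF K_int] by (intro Bochner_Integration.integral_diff) auto
  also have "(\<integral>p. (\<integral>q. K p q \<partial>M) \<partial>M) = (\<integral>q. (\<integral>p. K p q \<partial>M) \<partial>M)"
    by (rule MM.Fubini_integral[OF K_int, symmetric])
  also have "\<dots> = (\<integral>q. inner (convol S f q) (A e) \<partial>M)"
    by (rule Bochner_Integration.integral_cong) (auto simp: space_M convol)
  finally have "inner (convol S f t) e = (\<integral>p. inner (f p) e \<partial>M) - (\<integral>q. inner (convol S f q) (A e) \<partial>M)" .
  moreover have "inner (S t x0) e = inner x0 e - (\<integral>q. inner (S q x0) (A e) \<partial>M)"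
    using orbit_weak_equation(2)[OF x0 e t] by (simp add: M_def)
  ultimately show "inner (v t) e = inner x0 e + (\<integral>p. inner (f p) e \<partial>lebesgue_on {0..t})
      - (\<integral>q. inner (v q) (A e) \<partial>lebesgue_on {0..t})"
    using v[of t] t v_int by (simp add: inner_add_left M_def)
qed

end

section \<open>Energy identity and uniqueness for a linear integral equation\<close>

text \<open>
  Summing the increments over a partition of mesh at most \<open>\<delta>\<close> gives
  \<open>\<bar>K t - K 0\<bar> \<le> \<epsilon> * (N t - N 0)\<close> for every \<open>\<epsilon>\<close>.
\<close>

lemma constant_by_small_increments:
  fixes K N :: "real \<Rightarrow> real"
  assumes small: "\<And>\<epsilon>. \<epsilon> > 0 \<Longrightarrow> \<exists>\<delta>>0. \<forall>s t. 0 \<le> s \<and> s \<le> t \<and> t \<le> \<tau> \<and> t - s \<le> \<delta> \<longrightarrow>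
      \<bar>K t - K s\<bar> \<le> \<epsilon> * (N t - N s)"
    and t: "0 \<le> t" "t \<le> \<tau>"
  shows "K t = K 0"
proof -
  have bound: "\<bar>K t - K 0\<bar> \<le> \<epsilon> * (N t - N 0)" if \<epsilon>: "\<epsilon> > 0" for \<epsilon>
  proof -
    obtain \<delta> where \<delta>: "\<delta> > 0" and inc: "\<And>s t. 0 \<le> s \<Longrightarrow> s \<le> t \<Longrightarrow> t \<le> \<tau> \<Longrightarrow> t - s \<le> \<delta> \<Longrightarrow>
      \<bar>K t - K s\<bar> \<le> \<epsilon> * (N t - N s)"
      using small[OF \<epsilon>] by blast
    have steps: "0 \<le> t \<Longrightarrow> t \<le> \<tau> \<Longrightarrow> t \<le> real m * \<delta> \<Longrightarrow> \<bar>K t - K 0\<bar> \<le> \<epsilon> * (N t - N 0)" for m t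
    proof (induction m arbitrary: t)
      case (Suc m)
      define s where "s = max 0 (t - \<delta>)"
      have s: "0 \<le> s" "s \<le> t" "s \<le> \<tau>" "t - s \<le> \<delta>" "s \<le> real m * \<delta>"
        using Suc.prems \<delta> by (auto simp: s_def algebra_simps)
      have "\<bar>K s - K 0\<bar> \<le> \<epsilon> * (N s - N 0)" by (rule Suc.IH[OF s(1,3,5)])
      moreover have "\<bar>K t - K s\<bar> \<le> \<epsilon> * (N t - N s)" by (rule inc[OF s(1,2) Suc.prems(2) s(4)])
      ultimately show ?case by (simp add: right_diff_distrib)
    qed simp
    obtain m where "t / \<delta> \<le> real m" using real_arch_simple by blast
    then show ?thesis using steps[of t m] t \<delta> by (simp add: field_simps)
  qed
  show ?thesis
  proof (rule ccontr)
    assume "K t \<noteq> K 0"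
    define c where "c = \<bar>N t - N 0\<bar> + 1"
    have c: "c > 0" "N t - N 0 < c" by (auto simp: c_def)
    have e: "\<bar>K t - K 0\<bar> / c > 0" using c \<open>K t \<noteq> K 0\<close> by simp
    have "\<bar>K t - K 0\<bar> / c * (N t - N 0) < \<bar>K t - K 0\<bar> / c * c"
      by (rule mult_strict_left_mono[OF c(2) e])
    with bound[OF e] c(1) show False by simp
  qed
qed

text \<open>
  Gronwall's argument with an integrable coefficient: on an interval over which \<open>k\<close> has integral at
  most 1/2, the maximum of \<open>\<bar>\<psi>\<bar>\<close> is at most half of itself if \<open>\<psi>\<close> vanishes at the left end.
\<close>

lemma linear_integral_equation_zero:
  fixes \<psi> k :: "real \<Rightarrow> real"
  assumes cont: "continuous_on {0..\<tau>} \<psi>" and k: "integrable (lebesgue_on {0..\<tau>}) k"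
    and k0: "\<And>p. 0 \<le> k p" and k\<psi>: "integrable (lebesgue_on {0..\<tau>}) (\<lambda>p. k p * \<psi> p)"
    and eq: "\<And>t. t \<in> {0..\<tau>} \<Longrightarrow> \<psi> t = (\<integral>p. k p * \<psi> p \<partial>lebesgue_on {0..t})"
    and t: "t \<in> {0..\<tau>}"
  shows "\<psi> t = 0"
proof -
  have hk: "k integrable_on {a..b}" "(\<lambda>p. k p * \<psi> p) integrable_on {a..b}" if "0 \<le> a" "b \<le> \<tau>" for a b
    using that integrable_on_lebesgue_on[OF integrable_subinterval[OF k, of a b]]
      integrable_on_lebesgue_on[OF integrable_subinterval[OF k\<psi>, of a b]] by auto
  have eq': "\<psi> t = integral {0..t} (\<lambda>p. k p * \<psi> p)" if "t \<in> {0..\<tau>}" for t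
    using that eq[OF that] integrable_subinterval[OF k\<psi>, of 0 t]
    by (simp add: lebesgue_integral_eq_integral)
  define N where "N t = integral {0..t} k" for t
  have "continuous_on {0..\<tau>} N"
    unfolding N_def by (rule indefinite_integral_continuous_1) (use hk in auto)
  then have "uniformly_continuous_on {0..\<tau>} N"
    by (rule compact_uniformly_continuous) simp
  then obtain \<delta>' where \<delta>': "\<delta>' > 0" "\<And>s t. s \<in> {0..\<tau>} \<Longrightarrow> t \<in> {0..\<tau>} \<Longrightarrow> dist t s < \<delta>' \<Longrightarrow> dist (N t) (N s) < 1/2"
    unfolding uniformly_continuous_on_def by (metis half_gt_zero zero_less_one)
  define \<delta> where "\<delta> = \<delta>' / 2"
  have \<delta>: "\<delta> > 0" using \<delta>' by (simp add: \<delta>_def)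
  have zero: "0 \<le> t \<Longrightarrow> t \<le> \<tau> \<Longrightarrow> t \<le> real m * \<delta> \<Longrightarrow> \<psi> t = 0" for m t
  proof (induction m arbitrary: t)
    case 0
    then have "t = 0" by simp
    then show ?case using eq'[of 0] 0 by simp
  next
    case (Suc m)
    show ?case
    proof (cases "t \<le> real m * \<delta>")
      case True
      then show ?thesis using Suc by blast
    next
      case False
      define a where "a = real m * \<delta>"
      have a: "0 \<le> a" "a \<le> t" "t - a \<le> \<delta>" "a \<le> \<tau>" using False Suc.prems \<delta> by (auto simp: a_def algebra_simps)
      have \<psi>a: "\<psi> a = 0" by (rule Suc.IH) (use a in \<open>auto simp: a_def\<close>)
      have "continuous_on {a..t} (\<lambda>s. \<bar>\<psi> s\<bar>)"
        using a Suc.prems by (intro continuous_intros continuous_on_subset[OF cont]) auto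
      from continuous_attains_sup[OF compact_Icc _ this] a
      obtain s where s: "s \<in> {a..t}" "\<And>p. p \<in> {a..t} \<Longrightarrow> \<bar>\<psi> p\<bar> \<le> \<bar>\<psi> s\<bar>" by auto
      have s\<tau>: "s \<in> {0..\<tau>}" "a \<in> {0..\<tau>}" using s(1) a Suc.prems by auto
      have "integral {0..a} (\<lambda>p. k p * \<psi> p) + integral {a..s} (\<lambda>p. k p * \<psi> p) = integral {0..s} (\<lambda>p. k p * \<psi> p)"
        by (rule Henstock_Kurzweil_Integration.integral_combine) (use a s(1) s\<tau> hk in auto)
      then have "\<psi> s = integral {a..s} (\<lambda>p. k p * \<psi> p)"
        using eq'[OF s\<tau>(1)] eq'[OF s\<tau>(2)] \<psi>a by simp
      also have "\<bar>\<dots>\<bar> \<le> integral {a..s} (\<lambda>p. k p * \<bar>\<psi> s\<bar>)"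
        unfolding real_norm_def[symmetric]
      proof (rule integral_norm_bound_integral)
        show "(\<lambda>p. k p * \<psi> p) integrable_on {a..s}" "(\<lambda>p. k p * norm (\<psi> s)) integrable_on {a..s}"
          using hk[of a s] a s\<tau> by (auto intro: integrable_on_mult_left)
        show "norm (k p * \<psi> p) \<le> k p * norm (\<psi> s)" if "p \<in> {a..s}" for p
          using that s k0[of p] by (auto simp: abs_mult intro!: mult_left_mono)
      qed
      also have "\<dots> = integral {a..s} k * \<bar>\<psi> s\<bar>" by simp
      also have "integral {a..s} k = N s - N a"
        using Henstock_Kurzweil_Integration.integral_combine[of 0 a s k] a s(1) s\<tau> hk
        by (auto simp: N_def)
      also have "(N s - N a) * \<bar>\<psi> s\<bar> \<le> 1/2 * \<bar>\<psi> s\<bar>"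
      proof (rule mult_right_mono)
        have "dist (N s) (N a) < 1/2"
          by (rule \<delta>'(2)[OF s\<tau>(2,1)]) (use a s(1) \<delta> in \<open>auto simp: dist_real_def \<delta>_def\<close>)
        then show "N s - N a \<le> 1/2" unfolding dist_real_def by linarith
      qed simp
      finally have "\<psi> s = 0" by simp
      then show ?thesis using s(2)[of t] a by auto
    qed
  qed
  obtain m where "t / \<delta> \<le> real m" using real_arch_simple by blast
  then show ?thesis using zero[of t m] t \<delta> by (simp add: field_simps)
qed

text \<open>
  Testing the increment of \<open>u\<close> from \<open>s\<close> to \<open>t\<close> with \<open>u t + u s\<close> gives
  $|u(t)|^2 - |u(s)|^2 = \int_s^t \langle g, u(t) + u(s)\rangle$. This differs from
  $2 \int_s^t \langle g, u \rangle$ by little compared with $\int_s^t |g|$ if \<open>t - s\<close> is small, because \<open>u\<close> is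
  uniformly continuous.
\<close>

lemma energy_identity:
  fixes u g :: "real \<Rightarrow> 'b::{real_inner, banach, second_countable_topology}"
  assumes H: "subspace H" and x0: "x0 \<in> H" and uH: "\<And>t. t \<in> {0..\<tau>} \<Longrightarrow> u t \<in> H"
    and g: "integrable (lebesgue_on {0..\<tau>}) g"
    and u_meas: "u \<in> borel_measurable (lebesgue_on {0..\<tau>})" and u_cont: "continuous_on {0..\<tau>} u"
    and weak: "\<And>t e. t \<in> {0..\<tau>} \<Longrightarrow> e \<in> H \<Longrightarrow>
      inner (u t) e = inner x0 e + (\<integral>p. inner (g p) e \<partial>lebesgue_on {0..t})"
  shows "integrable (lebesgue_on {0..\<tau>}) (\<lambda>p. inner (g p) (u p))"
    and "t \<in> {0..\<tau>} \<Longrightarrow> (norm (u t))\<^sup>2 = (norm x0)\<^sup>2 + 2 * (\<integral>p. inner (g p) (u p) \<partial>lebesgue_on {0..t})"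
proof -
  obtain B where "\<forall>p\<in>{0..\<tau>}. norm (u p) \<le> B"
    using compact_imp_bounded[OF compact_continuous_image[OF u_cont compact_Icc]]
    by (auto simp: bounded_iff)
  then have B: "norm (u p) \<le> B" if "p \<in> {0..\<tau>}" for p using that by blast
  have ge: "integrable (lebesgue_on {0..\<tau>}) (\<lambda>p. inner (g p) e)" for e
    using g by simp
  show gu: "integrable (lebesgue_on {0..\<tau>}) (\<lambda>p. inner (g p) (u p))"
  proof (rule Bochner_Integration.integrable_bound)
    show "integrable (lebesgue_on {0..\<tau>}) (\<lambda>p. norm (g p) * B)" using g by simp
    show "(\<lambda>p. inner (g p) (u p)) \<in> borel_measurable (lebesgue_on {0..\<tau>})"
      using g u_meas by measurable
    show "AE p in lebesgue_on {0..\<tau>}. norm (inner (g p) (u p)) \<le> norm (norm (g p) * B)"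
    proof (rule AE_I2)
      fix p assume "p \<in> space (lebesgue_on {0..\<tau>})"
      then have p: "norm (u p) \<le> B" using B by simp
      have "norm (inner (g p) (u p)) \<le> norm (g p) * norm (u p)"
        by (simp add: Cauchy_Schwarz_ineq2)
      also have "\<dots> \<le> norm (g p) * B" by (intro mult_left_mono p) simp
      finally show "norm (inner (g p) (u p)) \<le> norm (norm (g p) * B)" by simp
    qed
  qed
  have HK: "h integrable_on {a..b}" "a = 0 \<Longrightarrow> integral\<^sup>L (lebesgue_on {0..b}) h = integral {0..b} h"
    if "integrable (lebesgue_on {0..\<tau>}) h" "0 \<le> a" "b \<le> \<tau>" for h :: "real \<Rightarrow> real" and a b
    using that integrable_subinterval[OF that(1), of a b]
    by (auto simp: integrable_on_lebesgue_on lebesgue_integral_eq_integral)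
  have comb: "integral {0..s} h + integral {s..t} h = integral {0..t} h"
    if "integrable (lebesgue_on {0..\<tau>}) h" "0 \<le> s" "s \<le> t" "t \<le> \<tau>" for h :: "real \<Rightarrow> real" and s t
    using that HK(1)[OF that(1), of 0 t] by (intro Henstock_Kurzweil_Integration.integral_combine) auto
  define N where "N t = integral {0..t} (\<lambda>p. norm (g p))" for t
  define K where "K t = (norm (u t))\<^sup>2 - 2 * integral {0..t} (\<lambda>p. inner (g p) (u p))" for t
  have ng: "integrable (lebesgue_on {0..\<tau>}) (\<lambda>p. norm (g p))" using g by simp
  have small: "\<exists>\<delta>>0. \<forall>s t. 0 \<le> s \<and> s \<le> t \<and> t \<le> \<tau> \<and> t - s \<le> \<delta> \<longrightarrow>
      \<bar>K t - K s\<bar> \<le> \<epsilon> * (N t - N s)" if \<epsilon>: "\<epsilon> > 0" for \<epsilon>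
  proof -
    have "uniformly_continuous_on {0..\<tau>} u"
      using u_cont by (rule compact_uniformly_continuous) simp
    then obtain \<delta> where \<delta>: "\<delta> > 0" "\<And>p q. p \<in> {0..\<tau>} \<Longrightarrow> q \<in> {0..\<tau>} \<Longrightarrow> dist q p < \<delta> \<Longrightarrow> dist (u q) (u p) < \<epsilon> / 2"
      unfolding uniformly_continuous_on_def using \<epsilon> by (metis half_gt_zero)
    have "\<bar>K t - K s\<bar> \<le> \<epsilon> * (N t - N s)" if st: "0 \<le> s" "s \<le> t" "t \<le> \<tau>" "t - s \<le> \<delta> / 2" for s t
    proof -
      define e where "e = u t + u s"
      have eH: "e \<in> H" unfolding e_def using H uH st by (intro subspace_add) auto
      have diff: "inner (u t) e - inner (u s) e = integral {s..t} (\<lambda>p. inner (g p) e)"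
        using weak[OF _ eH, of t] weak[OF _ eH, of s] st comb[OF ge[of e] st(1-3)]
          HK(2)[OF ge[of e], of 0 t] HK(2)[OF ge[of e], of 0 s] by simp
      have "K t - K s = inner (u t) e - inner (u s) e - 2 * integral {s..t} (\<lambda>p. inner (g p) (u p))"
        unfolding K_def comb[OF gu st(1-3), symmetric]
        by (simp add: e_def power2_norm_eq_inner inner_add_right inner_commute algebra_simps)
      also have "\<dots> = integral {s..t} (\<lambda>p. inner (g p) e - 2 * inner (g p) (u p))"
        unfolding diff using HK(1)[OF ge[of e], of s t] HK(1)[OF gu, of s t] st
        by (subst integral_diff) (auto intro: integrable_on_mult_right)
      finally have "\<bar>K t - K s\<bar> = norm (integral {s..t} (\<lambda>p. inner (g p) e - 2 * inner (g p) (u p)))"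
        by simp
      also have "\<dots> \<le> integral {s..t} (\<lambda>p. norm (g p) * \<epsilon>)"
      proof (rule integral_norm_bound_integral)
        show "(\<lambda>p. inner (g p) e - 2 * inner (g p) (u p)) integrable_on {s..t}"
          using HK(1)[OF ge[of e], of s t] HK(1)[OF gu, of s t] st
          by (auto intro!: integrable_diff integrable_on_mult_right)
        show "(\<lambda>p. norm (g p) * \<epsilon>) integrable_on {s..t}"
          using HK(1)[OF ng, of s t] st by (auto intro: integrable_on_mult_left)
        fix p assume p: "p \<in> {s..t}"
        have "norm (e - 2 *\<^sub>R u p) \<le> dist (u t) (u p) + dist (u s) (u p)"
          unfolding e_def dist_norm using norm_triangle_ineq[of "u t - u p" "u s - u p"]
          by (simp add: scaleR_2 algebra_simps)
        also have "\<dots> \<le> \<epsilon>"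
          using \<delta>(2)[of p t] \<delta>(2)[of p s] p st \<delta>(1) by (force simp: dist_real_def)
        finally have "norm (g p) * norm (e - 2 *\<^sub>R u p) \<le> norm (g p) * \<epsilon>"
          by (intro mult_left_mono) auto
        moreover have "inner (g p) e - 2 * inner (g p) (u p) = inner (g p) (e - 2 *\<^sub>R u p)"
          by (simp add: inner_diff_right)
        ultimately show "norm (inner (g p) e - 2 * inner (g p) (u p)) \<le> norm (g p) * \<epsilon>"
          using Cauchy_Schwarz_ineq2[of "g p" "e - 2 *\<^sub>R u p"] by simp
      qed
      also have "\<dots> = \<epsilon> * (N t - N s)"
        using comb[OF ng st(1-3)] by (simp add: N_def)
      finally show ?thesis .
    qed
    then show ?thesis using \<delta>(1) by (intro exI[of _ "\<delta> / 2"]) auto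
  qed
  show "(norm (u t))\<^sup>2 = (norm x0)\<^sup>2 + 2 * (\<integral>p. inner (g p) (u p) \<partial>lebesgue_on {0..t})"
    if t: "t \<in> {0..\<tau>}"
  proof -
    have "K t = K 0" by (rule constant_by_small_increments[OF small]) (use t in auto)
    moreover have "u 0 = x0"
    proof -
      have 0: "0 \<in> {0..\<tau>}" using t by auto
      have "u 0 - x0 \<in> H" by (intro subspace_diff H uH 0 x0)
      from weak[OF 0 this] have "inner (u 0 - x0) (u 0 - x0) = 0"
        using HK(2)[OF ge, of 0 0] 0 by (simp add: inner_diff_left)
      then show ?thesis by simp
    qed
    ultimately show ?thesis
      using HK(2)[OF gu, of 0 t] t by (simp add: K_def)
  qed
qed

section \<open>The evolution equation\<close>

lemma complete_measure_lebesgue_on: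
  assumes "X \<in> sets lebesgue" shows "complete_measure (lebesgue_on X)"
proof
  fix A B assume "B \<subseteq> A" "A \<in> null_sets (lebesgue_on X)"
  then have "A \<subseteq> X" "A \<in> null_sets lebesgue"
    using assms by (auto simp: null_sets_restrict_space)
  then have "B \<in> null_sets lebesgue" using \<open>B \<subseteq> A\<close> completion.complete2 by blast
  then show "B \<in> sets (lebesgue_on X)"
    using \<open>A \<subseteq> X\<close> \<open>B \<subseteq> A\<close> assms by (auto simp: sets_restrict_space_iff)
qed

text \<open>
  The Duhamel integrand for $F(u)$ is changed on a null set below to take values in $L^2(\Omega)$
  everywhere. Completeness of Lebesgue measure makes this harmless.
\<close>

lemma borel_measurable_lebesgue_on_cong_AE:
  fixes f g :: "'a::euclidean_space \<Rightarrow> 'b::topological_space"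
  assumes f: "f \<in> borel_measurable (lebesgue_on X)" and X: "X \<in> sets lebesgue"
    and ae: "AE x in lebesgue_on X. f x = g x"
  shows "g \<in> borel_measurable (lebesgue_on X)"
proof (rule measurableI)
  fix B :: "'b set" assume B: "B \<in> sets borel"
  show "g -` B \<inter> space (lebesgue_on X) \<in> sets (lebesgue_on X)"
  proof (rule complete_measure.in_sets_AE[OF complete_measure_lebesgue_on[OF X]])
    show "AE x in lebesgue_on X. (x \<in> f -` B \<inter> space (lebesgue_on X)) = (x \<in> g -` B \<inter> space (lebesgue_on X))"
      using ae by eventually_elim auto
    show "f -` B \<inter> space (lebesgue_on X) \<in> sets (lebesgue_on X)"
      using f B by (rule measurable_sets)
  qed simp
qed simp

lemma borel_measurable_lebesgue_on_continuous:
  fixes f :: "'a::euclidean_space \<Rightarrow> 'b::real_normed_vector"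
  assumes "continuous_on X f" "X \<in> sets borel"
  shows "f \<in> borel_measurable (lebesgue_on X)"
proof -
  have "(\<lambda>x. indicator X x *\<^sub>R f x) \<in> borel_measurable borel"
    by (rule borel_measurable_continuous_on_indicator[OF assms(2,1)])
  then have "(\<lambda>x. indicator X x *\<^sub>R f x) \<in> borel_measurable (lebesgue_on X)"
    by (intro measurable_restrict_space1 measurable_completion) simp
  then show ?thesis
    by (rule measurable_cong[THEN iffD1, rotated]) simp
qed

lemma integrable_inner_bounded:
  fixes f g :: "'c \<Rightarrow> 'b::{real_inner, banach, second_countable_topology}"
  assumes f: "integrable M f" and g: "g \<in> borel_measurable M" "\<And>x. x \<in> space M \<Longrightarrow> norm (g x) \<le> B"
  shows "integrable M (\<lambda>x. inner (f x) (g x))"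
proof (rule Bochner_Integration.integrable_bound)
  show "integrable M (\<lambda>x. norm (f x) * B)" using f by simp
  show "(\<lambda>x. inner (f x) (g x)) \<in> borel_measurable M"
    using f g(1) by measurable
  show "AE x in M. norm (inner (f x) (g x)) \<le> norm (norm (f x) * B)"
  proof (rule AE_I2)
    fix x assume "x \<in> space M"
    then have "norm (f x) * norm (g x) \<le> norm (f x) * B" by (intro mult_left_mono g(2)) auto
    with Cauchy_Schwarz_ineq2[of "f x" "g x"] show "norm (inner (f x) (g x)) \<le> norm (norm (f x) * B)"
      by simp
  qed
qed

lemma l2_mult_indicator_in_L2:
  assumes "\<Omega> \<in> sets borel" shows "l2_mult (indicator \<Omega>) u \<in> L2 \<Omega>"
  unfolding l2_mult_def
proof (rule l2_of_in_L2)
  show "sq_integrable (\<lambda>x. indicat_real \<Omega> x * l2_fun u x)"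
    using assms by (intro sq_integrable_mult_bounded[where C=1]) (auto simp: indicator_def)
qed simp

lemma l2_mult_indicator_id:
  assumes "\<Omega> \<in> sets borel" "u \<in> L2 \<Omega>" shows "l2_mult (indicator \<Omega>) u = u"
proof -
  have "l2_of (\<lambda>x. indicat_real \<Omega> x * l2_fun u x) = l2_of (l2_fun u)"
  proof (rule l2_of_cong_AE)
    show "sq_integrable (\<lambda>x. indicat_real \<Omega> x * l2_fun u x)"
      using assms by (intro sq_integrable_mult_bounded[where C=1]) (auto simp: indicator_def)
    have "AE x in lborel. x \<notin> \<Omega> \<longrightarrow> l2_fun u x = 0" using assms(2) by (simp add: L2_def)
    then show "AE x in lborel. indicat_real \<Omega> x * l2_fun u x = l2_fun u x"
      by eventually_elim (auto simp: indicator_def)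
  qed simp
  then show ?thesis by (simp add: l2_mult_def)
qed

lemma F_op_in_L2:
  assumes "u \<in> F_dom \<Omega> n" shows "F_op \<Omega> n u \<in> L2 \<Omega>"
proof -
  have u: "u \<in> L2 \<Omega>" and sq: "sq_integrable (signed_power n u)"
    using assms by (auto simp: F_dom_def V_space_L2)
  have "AE x in lborel. x \<notin> \<Omega> \<longrightarrow> l2_fun u x = 0" using u by (simp add: L2_def)
  then have "l2_of (signed_power n u) \<in> L2 \<Omega>"
    unfolding L2_def mem_Collect_eq using l2_fun_of[OF sq]
    by eventually_elim (auto simp: signed_power_def)
  then show ?thesis
    unfolding F_op_def by (intro subspace_diff subspace_add subspace_scale subspace_L2 u)
qed

lemma inner_signed_power_self:
  assumes "sq_integrable (signed_power n u)"
  shows "inner (l2_of (signed_power n u)) u = (\<integral>x. \<bar>l2_fun u x\<bar> powr (2 * n) \<partial>lborel)"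
proof -
  have "\<bar>s\<bar> powr (2 * n - 2) * s * s = \<bar>s\<bar> powr (2 * n)" for s :: real
  proof (cases "s = 0")
    case False
    then have "\<bar>s\<bar> powr (2 * n) = \<bar>s\<bar> powr (2 * n - 2) * \<bar>s\<bar> powr 2"
      using powr_add[of "\<bar>s\<bar>" "2 * n - 2" 2] by simp
    then show ?thesis using False by (simp add: power2_eq_square mult.assoc)
  qed simp
  then show ?thesis
    using inner_l2_of[OF assms, of u] by (simp add: inner_commute signed_power_def mult.commute)
qed

lemma signed_power_1: "signed_power 1 u = l2_fun u"
  by (auto simp: signed_power_def fun_eq_iff)

lemma H01_norm_le_V_norm: "H01_norm \<Omega> u \<le> V_norm \<Omega> u"
  and norm_le_V_norm: "norm u \<le> V_norm \<Omega> u"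
  unfolding V_norm_def by (rule real_le_rsqrt, simp add: add_increasing2)+

context bounded_dense_H01
begin

text \<open>
  In the pairing of $Lu - |u|^{2n-2} u$ with $u + 2 x_b \partial_b u$, the contributions
  $L |u|^2$ of the two summands cancel.
\<close>

definition dilation_multiplier :: "'a \<Rightarrow> 'a l2 \<Rightarrow> 'a l2" where
  "dilation_multiplier b u = u + 2 *\<^sub>R l2_mult (coord b) (weak_partial \<Omega> b u)"

text \<open>
  By the Pohozaev identity for $n$ and for $n = 1$, the inner product on the right is
  $(L |u|^2 - L) - (L |u|^2 - L/n) = L/n - L$.
\<close>

lemma integral_powr_via_multiplier:
  assumes u: "u \<in> F_dom \<Omega> n" and b: "b \<in> Basis" and n: "n > 1 / 2" and n1: "n \<noteq> 1"
  defines "L \<equiv> \<integral>x. \<bar>l2_fun u x\<bar> powr (2 * n) \<partial>lborel"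
  shows "L = n / (1 - n) * inner (L *\<^sub>R u - l2_of (signed_power n u)) (dilation_multiplier b u)"
proof -
  from u have uH: "u \<in> H01 \<Omega>" and int: "integrable lborel (\<lambda>x. \<bar>l2_fun u x\<bar> powr (2 * n))"
    and sq: "sq_integrable (signed_power n u)"
    by (auto simp: F_dom_def V_space_def)
  define X where "X = l2_mult (coord b) (weak_partial \<Omega> b u)"
  have w: "inner (l2_of (signed_power n u)) X = - L / (2 * n)"
    unfolding X_def L_def by (rule pohozaev_identity[OF uH b n int sq])
  have "inner u X = - (norm u)\<^sup>2 / 2"
    using pohozaev_identity[OF uH b, of 1]
      l2_fun_sq_integrable[of u] norm_l2_of[OF l2_fun_sq_integrable[of u]]
    by (simp add: X_def signed_power_1 sq_integrable_def)
  moreover have "inner (l2_of (signed_power n u)) u = L"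
    unfolding L_def by (rule inner_signed_power_self[OF sq])
  ultimately have "inner (L *\<^sub>R u - l2_of (signed_power n u)) (dilation_multiplier b u) = L / n - L"
    using n by (simp add: dilation_multiplier_def X_def[symmetric] inner_diff_left inner_add_right w
        power2_norm_eq_inner algebra_simps)
  then show ?thesis using n n1 by (simp add: field_simps)
qed

text \<open>
  Continuity in the norm of \<open>V_space \<Omega>\<close> is stronger than continuity in $H^1$.
\<close>

lemma continuous_weak_partial:
  assumes u: "u \<in> X_space \<Omega> \<tau>" and b: "b \<in> Basis"
  shows "continuous_on {0..\<tau>} u" "continuous_on {0..\<tau>} (\<lambda>p. weak_partial \<Omega> b (u p))"
proof -
  have V: "u p \<in> V_space \<Omega>" if "p \<in> {0..\<tau>}" for p using u that by (auto simp: X_space_def)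
  have lim: "((\<lambda>p. V_norm \<Omega> (u p - u s)) \<longlongrightarrow> 0) (at s within {0..\<tau>})" if "s \<in> {0..\<tau>}" for s
    using u that by (auto simp: X_space_def)
  show "continuous_on {0..\<tau>} u"
    unfolding continuous_on_def
  proof
    fix s assume s: "s \<in> {0..\<tau>}"
    have "((\<lambda>p. u p - u s) \<longlongrightarrow> 0) (at s within {0..\<tau>})"
      by (rule Lim_null_comparison[OF always_eventually lim[OF s]]) (simp add: norm_le_V_norm)
    then show "(u \<longlongrightarrow> u s) (at s within {0..\<tau>})" by (rule LIM_zero_cancel)
  qed
  show "continuous_on {0..\<tau>} (\<lambda>p. weak_partial \<Omega> b (u p))"
    unfolding continuous_on_def
  proof
    fix s assume s: "s \<in> {0..\<tau>}"
    have "((\<lambda>p. weak_partial \<Omega> b (u p) - weak_partial \<Omega> b (u s)) \<longlongrightarrow> 0) (at s within {0..\<tau>})"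
    proof (rule Lim_null_comparison[OF _ lim[OF s]])
      have "norm (weak_partial \<Omega> b (u p) - weak_partial \<Omega> b (u s)) \<le> V_norm \<Omega> (u p - u s)"
        if "p \<in> {0..\<tau>}" for p
        using norm_weak_partial_le_H01_norm[OF b, of \<Omega> "u p - u s"] H01_norm_le_V_norm[of \<Omega> "u p - u s"]
          weak_partial_diff[OF V_space_sobolev1[OF V[OF that]] V_space_sobolev1[OF V[OF s]] b] by simp
      then show "\<forall>\<^sub>F p in at s within {0..\<tau>}.
          norm (weak_partial \<Omega> b (u p) - weak_partial \<Omega> b (u s)) \<le> V_norm \<Omega> (u p - u s)"
        by (auto simp: eventually_at_filter)
    qed
    then show "((\<lambda>p. weak_partial \<Omega> b (u p)) \<longlongrightarrow> weak_partial \<Omega> b (u s)) (at s within {0..\<tau>})"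
      by (rule LIM_zero_cancel)
  qed
qed

text \<open>
  The function $|u(t)|^2 - 1$ solves a linear homogeneous integral equation on the interval from 0 to
  \<open>\<tau>\<close>, with coefficient \<open>2 * (D p + L p)\<close>. One coordinate direction \<open>b\<close> is enough for the
  multiplier.
\<close>

lemma mild_solution_unit_sphere:
  assumes n: "n > 1 / 2"
    and E_dense: "L2 \<Omega> \<subseteq> closure (E_space \<Omega>)"
    and dissipative: "dissipative_semigroup (L2 \<Omega>) (E_space \<Omega>) S (A_op \<Omega>) (l2_mult (indicator \<Omega>))"
    and u0: "u0 \<in> L2 \<Omega>" "(norm u0)\<^sup>2 = 1"
    and mild: "mild_solution \<Omega> n S u0 T u" and \<tau>: "\<tau> \<in> {0..<T}"
  shows "u \<tau> \<in> unit_sphere \<Omega>"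
proof -
  interpret dissipative_semigroup "L2 \<Omega>" "E_space \<Omega>" S "A_op \<Omega>" "l2_mult (indicator \<Omega>)"
    by (rule dissipative)
  define M where "M = lebesgue_on {0..\<tau>}"
  have space_M: "space M = {0..\<tau>}" by (simp add: M_def)
  interpret M: finite_measure M
    unfolding M_def by (rule finite_measure_lebesgue_on) simp
  define b :: 'a where "b = (SOME b. b \<in> Basis)"
  have b: "b \<in> Basis" unfolding b_def by (rule someI_ex) (simp add: ex_in_conv)
  have P: "bounded_linear (l2_mult (indicat_real \<Omega>))"
    by (rule bounded_linear_l2_mult[where C=1]) (auto simp: indicator_def)
  have Xu: "u \<in> X_space \<Omega> \<tau>" and F_dom: "AE p in M. u p \<in> F_dom \<Omega> n"
    and F_int: "integrable M (\<lambda>p. F_op \<Omega> n (u p))"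
    using mild[unfolded mild_solution_def, THEN bspec, OF \<tau>] unfolding M_def by blast+
  have u_meas [measurable]: "u \<in> borel_measurable M" and E: "AE p in M. u p \<in> E_space \<Omega>"
    and Au_meas [measurable]: "(\<lambda>p. A_op \<Omega> (u p)) \<in> borel_measurable M"
    and Au_sq: "integrable M (\<lambda>p. (norm (A_op \<Omega> (u p)))\<^sup>2)"
    and uV: "\<And>p. p \<in> {0..\<tau>} \<Longrightarrow> u p \<in> V_space \<Omega>"
    using Xu unfolding X_space_def time_L2_def M_def by blast+
  have uL2: "u p \<in> L2 \<Omega>" if "p \<in> {0..\<tau>}" for p using uV[OF that] by (rule V_space_L2)

  \<comment> \<open>\<open>F_op \<Omega> n (u p)\<close> is known to be in \<open>L2 \<Omega>\<close> only for almost every \<open>p\<close>.\<close>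
  define f where "f p = l2_mult (indicator \<Omega>) (F_op \<Omega> n (u p))" for p
  have f_in: "f p \<in> L2 \<Omega>" for p
    unfolding f_def by (rule projection_in)
  have f_int: "integrable M f"
    unfolding f_def by (rule integrable_bounded_linear[OF P F_int])
  have f_eq: "AE p in M. f p = F_op \<Omega> n (u p)"
    using F_dom by eventually_elim (simp add: f_def projection_id F_op_in_L2)
  have Au_int: "integrable M (\<lambda>p. A_op \<Omega> (u p))"
  proof (rule Bochner_Integration.integrable_bound)
    show "integrable M (\<lambda>p. 1 + (norm (A_op \<Omega> (u p)))\<^sup>2)" using Au_sq by simp
    show "AE p in M. norm (A_op \<Omega> (u p)) \<le> norm (1 + (norm (A_op \<Omega> (u p)))\<^sup>2)"
    proof (rule AE_I2)
      fix p
      have "0 \<le> (norm (A_op \<Omega> (u p)) - 1 / 2)\<^sup>2" by simp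
      then show "norm (A_op \<Omega> (u p)) \<le> norm (1 + (norm (A_op \<Omega> (u p)))\<^sup>2)"
        by (simp add: power2_eq_square algebra_simps)
    qed
  qed (rule Au_meas)
  have sub: "integrable (lebesgue_on {0..t}) h" if "integrable M h" "t \<in> {0..\<tau>}"
    for h :: "real \<Rightarrow> 'a l2" and t
    by (rule integrable_lebesgue_on_subset[OF that(1)[unfolded M_def]]) (use that in auto)
  have sub_AE: "AE p in lebesgue_on {0..t}. Q p" if "AE p in M. Q p" "t \<in> {0..\<tau>}" for Q t
  proof -
    have "AE p in lebesgue. p \<in> {0..\<tau>} \<longrightarrow> Q p"
      using that(1) AE_restrict_space_iff[of "{0..\<tau>}" lebesgue Q] unfolding M_def by simp
    then have "AE p in lebesgue. p \<in> {0..t} \<longrightarrow> Q p"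
      by eventually_elim (use that(2) in auto)
    then show ?thesis by (simp add: AE_restrict_space_iff)
  qed
  have mild_f: "u q = S q u0 + convol S f q" if q: "q \<in> {0..\<tau>}" for q
  proof -
    have "u q = S q u0 + convol S (\<lambda>p. F_op \<Omega> n (u p)) q"
      using mild \<tau> q by (auto simp: mild_solution_def)
    also have "convol S (\<lambda>p. F_op \<Omega> n (u p)) q = convol S f q"
    proof -
      have int: "integrable (lebesgue_on {0..q}) (\<lambda>p. S (q - p) (f p))"
        by (rule convol_integrand_integrable[OF f_int[unfolded M_def] f_in q])
      have ae: "AE p in lebesgue_on {0..q}. S (q - p) (f p) = S (q - p) (F_op \<Omega> n (u p))"
        using sub_AE[OF f_eq q] by eventually_elim simp
      have "(\<lambda>p. S (q - p) (F_op \<Omega> n (u p))) \<in> borel_measurable (lebesgue_on {0..q})"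
        by (rule borel_measurable_lebesgue_on_cong_AE[OF borel_measurable_integrable[OF int] _ ae]) simp
      then show ?thesis
        unfolding convol_def using int ae by (intro integral_cong_AE) (auto elim: eventually_mono)
    qed
    finally show ?thesis .
  qed

  define g where "g p = f p - A_op \<Omega> (u p)" for p
  have g_int: "integrable M g" unfolding g_def using f_int Au_int by simp
  have weak: "inner (u t) e = inner u0 e + (\<integral>p. inner (g p) e \<partial>lebesgue_on {0..t})"
    if t: "t \<in> {0..\<tau>}" and e: "e \<in> L2 \<Omega>" for t e
  proof -
    \<comment> \<open>The weak formulation says that \<open>d\<close> is orthogonal to the domain of \<open>A_op \<Omega>\<close>.\<close>
    define d where "d = u t - u0 - (\<integral>p. g p \<partial>lebesgue_on {0..t})"
    have d: "inner d e = inner (u t) e - inner u0 e - (\<integral>p. inner (g p) e \<partial>lebesgue_on {0..t})" for e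
      unfolding d_def inner_diff_left using sub[OF g_int t] by (simp add: integral_inner_left)
    have "inner d e = 0" if e: "e \<in> E_space \<Omega>" for e
    proof -
      have f_t: "integrable (lebesgue_on {0..t}) f" by (rule sub[OF f_int t])
      have Au_t: "integrable (lebesgue_on {0..t}) (\<lambda>p. A_op \<Omega> (u p))" by (rule sub[OF Au_int t])
      have v: "u q = S q u0 + convol S f q" if "q \<in> {0..t}" for q
        using mild_f that t by simp
      have t0: "0 \<le> t" using t by simp
      have "(\<integral>q. inner (u q) (A_op \<Omega> e) \<partial>lebesgue_on {0..t})
          = (\<integral>q. inner (A_op \<Omega> (u q)) e \<partial>lebesgue_on {0..t})"
      proof (rule integral_cong_AE)
        show "(\<lambda>q. inner (u q) (A_op \<Omega> e)) \<in> borel_measurable (lebesgue_on {0..t})"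
          using mild_imp_weak(1)[OF u0(1) f_t f_in e t0 v] by simp
        show "(\<lambda>q. inner (A_op \<Omega> (u q)) e) \<in> borel_measurable (lebesgue_on {0..t})"
          using Au_t by measurable
        show "AE q in lebesgue_on {0..t}. inner (u q) (A_op \<Omega> e) = inner (A_op \<Omega> (u q)) e"
          using sub_AE[OF E t] by eventually_elim (simp add: symmetric e)
      qed
      then have "inner (u t) e = inner u0 e + (\<integral>p. inner (f p) e \<partial>lebesgue_on {0..t})
          - (\<integral>q. inner (A_op \<Omega> (u q)) e \<partial>lebesgue_on {0..t})"
        using mild_imp_weak(2)[OF u0(1) f_t f_in e t0 v] by simp
      then show ?thesis
        unfolding d g_def inner_diff_left using f_t Au_t by simp
    qed
    moreover obtain e' where e': "\<And>k. e' k \<in> E_space \<Omega>" "e' \<longlonglongrightarrow> e"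
      using e E_dense closure_sequential[of e "E_space \<Omega>"] by blast
    moreover have "(\<lambda>k. inner d (e' k)) \<longlonglongrightarrow> inner d e"
      by (intro tendsto_intros e')
    ultimately have "inner d e = 0" by (simp add: LIMSEQ_const_iff)
    then show ?thesis unfolding d by simp
  qed

  note cont = continuous_weak_partial[OF Xu b]
  have energy: "integrable (lebesgue_on {0..\<tau>}) (\<lambda>p. inner (g p) (u p))"
    "\<And>t. t \<in> {0..\<tau>} \<Longrightarrow>
      (norm (u t))\<^sup>2 = (norm u0)\<^sup>2 + 2 * (\<integral>p. inner (g p) (u p) \<partial>lebesgue_on {0..t})"
    by (rule energy_identity[OF subspace_L2 u0(1) uL2 g_int[unfolded M_def] u_meas[unfolded M_def]
          cont(1) weak]; assumption)+

  define m where "m p = dilation_multiplier b (u p)" for p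
  obtain R where R: "\<And>x. \<bar>coord b x\<bar> \<le> R" using coord_bounded by blast
  have m_cont: "continuous_on {0..\<tau>} m"
    unfolding m_def dilation_multiplier_def
    by (intro continuous_intros cont bounded_linear.continuous_on[OF bounded_linear_l2_mult[OF _ R]]) simp
  have m_meas: "m \<in> borel_measurable M"
    unfolding M_def by (rule borel_measurable_lebesgue_on_continuous[OF m_cont]) simp
  have bounded_on: "\<exists>B. \<forall>p\<in>space M. norm (h p) \<le> B" if "continuous_on {0..\<tau>} h" for h :: "real \<Rightarrow> 'a l2"
    using compact_imp_bounded[OF compact_continuous_image[OF that compact_Icc]]
    by (auto simp: bounded_iff space_M)
  obtain Bm where Bm: "\<And>p. p \<in> space M \<Longrightarrow> norm (m p) \<le> Bm" using bounded_on[OF m_cont] by blast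
  obtain Bu where Bu: "\<And>p. p \<in> space M \<Longrightarrow> norm (u p) \<le> Bu" using bounded_on[OF cont(1)] by blast

  define D where "D p = inner (A_op \<Omega> (u p)) (u p)" for p
  define L where "L p = (\<integral>x. \<bar>l2_fun (u p) x\<bar> powr (2 * n) \<partial>lborel)" for p
  define G where "G p = f p - D p *\<^sub>R u p" for p
  have D_int: "integrable M D"
    unfolding D_def by (rule integrable_inner_bounded[OF Au_int u_meas Bu])
  have G_int: "integrable M G"
    unfolding G_def
  proof (intro Bochner_Integration.integrable_diff f_int)
    show "integrable M (\<lambda>p. D p *\<^sub>R u p)"
    proof (rule Bochner_Integration.integrable_bound)
      show "integrable M (\<lambda>p. D p * Bu)" using D_int by simp
      show "(\<lambda>p. D p *\<^sub>R u p) \<in> borel_measurable M" using D_int by measurable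
      show "AE p in M. norm (D p *\<^sub>R u p) \<le> norm (D p * Bu)"
      proof (rule AE_I2)
        fix p assume "p \<in> space M"
        from Bu[OF this] have "norm (u p) \<le> \<bar>Bu\<bar>" by linarith
        then show "norm (D p *\<^sub>R u p) \<le> norm (D p * Bu)"
          by (simp add: abs_mult mult_left_mono)
      qed
    qed
  qed
  have G_eq: "AE p in M. G p = L p *\<^sub>R u p - l2_of (signed_power n (u p))"
    using f_eq E
    by eventually_elim (simp add: G_def D_def L_def F_op_def inner_A_op_self scaleR_add_left)
  \<comment> \<open>\<open>\<Lambda>\<close> equals \<open>L\<close> almost everywhere; its formula makes it measurable and integrable in time.\<close>
  define \<Lambda> where "\<Lambda> p = (if n = 1 then (norm (u p))\<^sup>2 else n / (1 - n) * inner (G p) (m p))" for p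
  have \<Lambda>_int: "integrable M \<Lambda>"
  proof (cases "n = 1")
    case True
    have "integrable M (\<lambda>p. (norm (u p))\<^sup>2)"
    proof (rule M.integrable_const_bound)
      show "AE p in M. norm ((norm (u p))\<^sup>2) \<le> Bu\<^sup>2"
        using Bu by (intro AE_I2) (simp add: power_mono)
    qed measurable
    then show ?thesis using True by (simp add: \<Lambda>_def[abs_def])
  next
    case False
    then show ?thesis
      using integrable_inner_bounded[OF G_int m_meas Bm] by (simp add: \<Lambda>_def[abs_def])
  qed
  have \<Lambda>_eq: "AE p in M. \<Lambda> p = L p"
    using F_dom G_eq
  proof eventually_elim
    case (elim p)
    show ?case
    proof (cases "n = 1")
      case True
      then show ?thesis
        using norm_l2_of[OF l2_fun_sq_integrable[of "u p"]] by (simp add: \<Lambda>_def L_def)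
    next
      case False
      then show ?thesis
        using integral_powr_via_multiplier[OF elim(1) b n False]
        by (simp add: \<Lambda>_def elim(2) m_def L_def)
    qed
  qed

  \<comment> \<open>The absolute value changes nothing almost everywhere, and makes \<open>k\<close> nonnegative at every time.\<close>
  define k where "k p = \<bar>2 * (D p + \<Lambda> p)\<bar>" for p
  define \<psi> where "\<psi> t = (norm (u t))\<^sup>2 - 1" for t
  have k_int: "integrable M k" unfolding k_def using D_int \<Lambda>_int by simp
  have rate: "AE p in M. 2 * inner (g p) (u p) = k p * \<psi> p"
    using F_dom E \<Lambda>_eq G_eq
  proof eventually_elim
    case (elim p)
    have "L p \<ge> 0" by (simp add: L_def)
    moreover have "D p \<ge> 0" unfolding D_def by (rule nonneg[OF elim(2)])
    ultimately have "k p = 2 * (D p + L p)" by (simp add: k_def elim(3))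
    moreover have "sq_integrable (signed_power n (u p))" using elim(1) by (simp add: F_dom_def)
    then have "inner (G p) (u p) = L p * (norm (u p))\<^sup>2 - L p"
      by (simp add: elim(4) inner_diff_left inner_signed_power_self L_def power2_norm_eq_inner)
    moreover have "inner (g p) (u p) = inner (G p) (u p) + D p * (norm (u p))\<^sup>2 - D p"
      by (simp add: g_def G_def D_def inner_diff_left power2_norm_eq_inner)
    ultimately show ?case by (simp add: \<psi>_def algebra_simps)
  qed
  have gu_int: "integrable M (\<lambda>p. 2 * inner (g p) (u p))"
    using energy(1) by (simp add: M_def)
  have \<psi>_meas [measurable]: "\<psi> \<in> borel_measurable M" unfolding \<psi>_def by measurable
  have k\<psi>_meas: "(\<lambda>p. k p * \<psi> p) \<in> borel_measurable M" using k_int by measurable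
  have k\<psi>_int: "integrable M (\<lambda>p. k p * \<psi> p)"
    by (rule Bochner_Integration.integrable_cong_AE_imp[OF gu_int k\<psi>_meas rate])
  have "\<psi> \<tau> = 0"
  proof (rule linear_integral_equation_zero[where k=k and \<psi>=\<psi> and t=\<tau> and \<tau>=\<tau>])
    show "continuous_on {0..\<tau>} \<psi>" unfolding \<psi>_def by (intro continuous_intros cont)
    show "integrable (lebesgue_on {0..\<tau>}) k" "integrable (lebesgue_on {0..\<tau>}) (\<lambda>p. k p * \<psi> p)"
      using k_int k\<psi>_int by (simp_all add: M_def)
    show "0 \<le> k p" for p by (simp add: k_def)
    show "\<tau> \<in> {0..\<tau>}" using \<tau> by simp
    fix t assume t: "t \<in> {0..\<tau>}"
    have "\<psi> t = (\<integral>p. 2 * inner (g p) (u p) \<partial>lebesgue_on {0..t})"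
      using energy(2)[OF t] u0(2) by (simp add: \<psi>_def)
    also have "\<dots> = (\<integral>p. k p * \<psi> p \<partial>lebesgue_on {0..t})"
    proof (rule integral_cong_AE)
      show "(\<lambda>p. 2 * inner (g p) (u p)) \<in> borel_measurable (lebesgue_on {0..t})"
        "(\<lambda>p. k p * \<psi> p) \<in> borel_measurable (lebesgue_on {0..t})"
        using integrable_subinterval[OF gu_int[unfolded M_def], of 0 t]
          integrable_subinterval[OF k\<psi>_int[unfolded M_def], of 0 t] t by auto
    qed (rule sub_AE[OF rate t])
    finally show "\<psi> t = (\<integral>p. k p * \<psi> p \<partial>lebesgue_on {0..t})" .
  qed
  then show ?thesis using uL2[of \<tau>] \<tau> by (simp add: unit_sphere_def \<psi>_def)
qed

end

theorem proposition5p3: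
  fixes \<Omega> :: "'a::euclidean_space set" and n T :: real
    and S :: "real \<Rightarrow> 'a l2 \<Rightarrow> 'a l2" and u0 :: "'a l2" and u :: "real \<Rightarrow> 'a l2"
  assumes "smooth_bounded_domain \<Omega>"
    and "n > 1 / 2"
    and "self_adjoint_in (L2 \<Omega>) (E_space \<Omega>) (A_op \<Omega>)"
    and "analytic_semigroup (L2 \<Omega>) S"
    and "is_generator (L2 \<Omega>) S (E_space \<Omega>) (\<lambda>v. - A_op \<Omega> v)"
    and "max_regularity \<Omega> S"
    and "u0 \<in> V_space \<Omega>"
    and "mild_solution \<Omega> n S u0 T u"
    and "(norm u0)\<^sup>2 = 1"
  shows "\<forall>t\<in>{0..<T}. u t \<in> unit_sphere \<Omega>"
proof
  fix t assume t: "t \<in> {0..<T}"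
  have dense: "L2 \<Omega> \<subseteq> closure (E_space \<Omega>)"
    using assms(3) by (simp add: self_adjoint_in_def)
  also have "\<dots> \<subseteq> closure (H01 \<Omega>)"
    by (rule closure_mono) (auto simp: E_space_def)
  finally interpret bounded_dense_H01 \<Omega>
    using assms(1) by unfold_locales (auto simp: smooth_bounded_domain_def)
  have "dissipative_semigroup (L2 \<Omega>) (E_space \<Omega>) S (A_op \<Omega>) (l2_mult (indicator \<Omega>))"
  proof
    show "inner (A_op \<Omega> v) w = inner v (A_op \<Omega> w)" if "v \<in> E_space \<Omega>" "w \<in> E_space \<Omega>" for v w
    proof -
      have "w \<in> L2 \<Omega>" using that(2) by (auto simp: E_space_def dest: sobolev_L2)
      then show ?thesis
        using assms(3) A_op_in_L2[OF that(2)] that unfolding self_adjoint_in_def by blast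
    qed
    show "0 \<le> inner (A_op \<Omega> v) v" if "v \<in> E_space \<Omega>" for v
      by (simp add: inner_A_op_self[OF that])
    have "bounded_linear (l2_mult (indicat_real \<Omega>))"
      by (rule bounded_linear_l2_mult[where C=1]) (auto simp: indicator_def)
    then show "continuous_on UNIV (l2_mult (indicat_real \<Omega>))"
      by (rule linear_continuous_on)
  qed (use assms in \<open>auto simp: subspace_L2 l2_mult_indicator_in_L2 l2_mult_indicator_id\<close>)
  from mild_solution_unit_sphere[OF assms(2) dense this V_space_L2[OF assms(7)] assms(9,8) t]
  show "u t \<in> unit_sphere \<Omega>" .
qed

end
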